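(* Let $V:\mathbb{Z}\to\mathbb{R}$ be periodic, and let $H_V:\ell^2(\mathbb{Z})\to\ell^2(\mathbb{Z})$ be the discrete Schr\"odinger operator $[H_V\psi](n)=\psi(n-1)+\psi(n+1)+V(n)\psi(n)$. Then there is a constant $M>0$ such that $$\|e^{-\mathbf{i}tH_V}\psi\|_\infty\le M\langle t\rangle^{-1/3}\|\psi\|_1$$ for all $t\in\mathbb{R}$ and all $\psi\in\ell^1(\mathbb{Z})$.
   Context: Notation: $\mathbf{i}$ is the imaginary unit, $\langle t\rangle=\sqrt{1+t^2}$, and $\|\cdot\|_q$ denotes the $\ell^q(\mathbb{Z})$ norm on complex-valued sequences. "Periodic" means there is an integer $p\ge 1$ with $V(n+p)=V(n)$ for all $n\in\mathbb{Z}$. Since $V$ is bounded and real, $H_V$ is a bounded self-adjoint operator on $\ell^2(\mathbb{Z})$, and $e^{-\mathbf{i}tH_V}$ is the associated unitary group, applied to $\psi\in\ell^1(\mathbb{Z})\subset\ell^2(\mathbb{Z})$. *)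

theory Defs
  imports "HOL-Analysis.Analysis"
begin

section \<open>The Hilbert space of square-summable complex sequences over the integers\<close>

definition sq_summable :: "(int \<Rightarrow> complex) \<Rightarrow> bool"
  where "sq_summable f \<longleftrightarrow> (\<lambda>n. (cmod (f n))\<^sup>2) summable_on UNIV"

lemma sq_summableI_le:
  assumes "g summable_on UNIV" and "\<And>n. (cmod (f n))\<^sup>2 \<le> g n"
  shows "sq_summable f"
  unfolding sq_summable_def
  by (rule summable_on_comparison_test[OF assms(1)]) (use assms(2) in auto)

lemma sq_summable_zero: "sq_summable (\<lambda>n. 0)"
  by (simp add: sq_summable_def)

lemma norm_sum_power2_le:
  fixes x y :: "'b::real_normed_vector"
  shows "(norm (x + y))\<^sup>2 \<le> 2 * (norm x)\<^sup>2 + 2 * (norm y)\<^sup>2"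
proof -
  have "(norm (x + y))\<^sup>2 \<le> (norm x + norm y)\<^sup>2"
    by (simp add: norm_triangle_ineq power_mono)
  also have "\<dots> \<le> 2 * (norm x)\<^sup>2 + 2 * (norm y)\<^sup>2"
    using sum_squares_bound[of "norm x" "norm y"] by (simp add: power2_sum)
  finally show ?thesis .
qed

lemma sq_summable_add:
  assumes "sq_summable f" "sq_summable g"
  shows "sq_summable (\<lambda>n. f n + g n)"
proof (rule sq_summableI_le)
  show "(\<lambda>n. 2 * (cmod (f n))\<^sup>2 + 2 * (cmod (g n))\<^sup>2) summable_on UNIV"
    using assms unfolding sq_summable_def
    by (intro summable_on_add summable_on_cmult_right)
qed (rule norm_sum_power2_le)

lemma sq_summable_mult_shift:
  assumes f: "sq_summable f" and b: "\<And>n. cmod (b n) \<le> C"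
  shows "sq_summable (\<lambda>n. b n * f (n + k))"
proof (rule sq_summableI_le)
  have "bij_betw (\<lambda>n::int. n + k) UNIV UNIV"
    by (rule bij_betwI[of _ _ _ "\<lambda>n. n - k"]) auto
  then have "(\<lambda>n. (cmod (f (n + k)))\<^sup>2) summable_on UNIV"
    using f unfolding sq_summable_def
    by (simp add: summable_on_reindex_bij_betw[where f = "\<lambda>n. (cmod (f n))\<^sup>2"])
  then show "(\<lambda>n. C\<^sup>2 * (cmod (f (n + k)))\<^sup>2) summable_on UNIV"
    by (rule summable_on_cmult_right)
  show "(cmod (b n * f (n + k)))\<^sup>2 \<le> C\<^sup>2 * (cmod (f (n + k)))\<^sup>2" for n
    using b[of n] by (auto simp: norm_mult power_mult_distrib intro!: mult_right_mono power_mono)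
qed

lemma sq_summable_cmult: "sq_summable f \<Longrightarrow> sq_summable (\<lambda>n. c * f n)"
  using sq_summable_mult_shift[of f "\<lambda>_. c" "cmod c" 0] by simp

lemma sq_summable_scaleR: "sq_summable f \<Longrightarrow> sq_summable (\<lambda>n. r *\<^sub>R f n)"
  using sq_summable_cmult[of f "of_real r"] by (simp add: scaleR_conv_of_real)

lemma sq_summable_uminus: "sq_summable f \<Longrightarrow> sq_summable (\<lambda>n. - f n)"
  using sq_summable_cmult[of f "-1"] by simp

lemma sq_summable_diff:
  "sq_summable f \<Longrightarrow> sq_summable g \<Longrightarrow> sq_summable (\<lambda>n. f n - g n)"
  using sq_summable_add[OF _ sq_summable_uminus, of f g] by simp

typedef ell2 = "{f. sq_summable f}"
  morphisms ell2_seq Abs_ell2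
  using sq_summable_zero by auto

setup_lifting type_definition_ell2

lemma sq_summable_seq: "sq_summable (ell2_seq \<psi>)"
  using ell2_seq by auto

lemma ell2_seq_inverse': "sq_summable f \<Longrightarrow> ell2_seq (Abs_ell2 f) = f"
  by (simp add: Abs_ell2_inverse)

lemma ell2_eqI: "(\<And>n. ell2_seq \<phi> n = ell2_seq \<psi> n) \<Longrightarrow> \<phi> = \<psi>"
  by (metis ell2_seq_inject ext)

lemma summable_inner:
  assumes "sq_summable f" "sq_summable g"
  shows "(\<lambda>n. f n \<bullet> g n) summable_on UNIV"
proof -
  have "(\<lambda>n. (cmod (f n))\<^sup>2 + (cmod (g n))\<^sup>2) summable_on UNIV"
    using assms unfolding sq_summable_def by (intro summable_on_add)
  moreover have "\<bar>f n \<bullet> g n\<bar> \<le> (cmod (f n))\<^sup>2 + (cmod (g n))\<^sup>2" for n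
  proof -
    have "\<bar>f n \<bullet> g n\<bar> \<le> cmod (f n) * cmod (g n)"
      by (rule Cauchy_Schwarz_ineq2)
    also have "\<dots> \<le> (cmod (f n))\<^sup>2 + (cmod (g n))\<^sup>2"
      using sum_squares_bound[of "cmod (f n)" "cmod (g n)"]
        mult_nonneg_nonneg[OF norm_ge_zero[of "f n"] norm_ge_zero[of "g n"]]
      by linarith
    finally show ?thesis .
  qed
  ultimately have "(\<lambda>n. \<bar>f n \<bullet> g n\<bar>) summable_on UNIV"
    by (rule summable_on_comparison_test) auto
  then show ?thesis
    using abs_summable_summable[of "\<lambda>n. f n \<bullet> g n" UNIV] by simp
qed

instantiation ell2 :: real_vector
begin

lift_definition zero_ell2 :: ell2 is "\<lambda>n. 0" by (rule sq_summable_zero)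
lift_definition plus_ell2 :: "ell2 \<Rightarrow> ell2 \<Rightarrow> ell2" is "\<lambda>f g n. f n + g n"
  by (rule sq_summable_add)
lift_definition minus_ell2 :: "ell2 \<Rightarrow> ell2 \<Rightarrow> ell2" is "\<lambda>f g n. f n - g n"
  by (rule sq_summable_diff)
lift_definition uminus_ell2 :: "ell2 \<Rightarrow> ell2" is "\<lambda>f n. - f n"
  by (rule sq_summable_uminus)
lift_definition scaleR_ell2 :: "real \<Rightarrow> ell2 \<Rightarrow> ell2" is "\<lambda>r f n. r *\<^sub>R f n"
  by (rule sq_summable_scaleR)

instance
proof
  fix x y z :: ell2 and r s :: real
  show "x + y + z = x + (y + z)" by transfer (simp add: add.assoc)
  show "x + y = y + x" by transfer (simp add: add.commute)
  show "0 + x = x" by transfer simp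
  show "- x + x = 0" by transfer simp
  show "x - y = x + - y" by transfer simp
  show "r *\<^sub>R (x + y) = r *\<^sub>R x + r *\<^sub>R y" by transfer (simp add: scaleR_add_right)
  show "(r + s) *\<^sub>R x = r *\<^sub>R x + s *\<^sub>R x" by transfer (simp add: scaleR_add_left)
  show "r *\<^sub>R s *\<^sub>R x = (r * s) *\<^sub>R x" by transfer simp
  show "1 *\<^sub>R x = x" by transfer simp
qed

end

text \<open>
  The real inner product below is the real part of the usual complex one, so the norm is the
  usual one (see \<open>norm_ell2\<close>). Scalar multiplication by complex numbers is
  \<open>ell2_scaleC\<close> further down, because the library's vector space classes are real.
\<close>

instantiation ell2 :: real_inner
begin

lift_definition inner_ell2 :: "ell2 \<Rightarrow> ell2 \<Rightarrow> real" is "\<lambda>f g. \<Sum>\<^sub>\<infinity>n. f n \<bullet> g n" .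

definition norm_ell2 :: "ell2 \<Rightarrow> real"
  where "norm_ell2 \<psi> = sqrt (\<Sum>\<^sub>\<infinity>n. (cmod (ell2_seq \<psi> n))\<^sup>2)"
definition dist_ell2 :: "ell2 \<Rightarrow> ell2 \<Rightarrow> real"
  where "dist_ell2 \<phi> \<psi> = norm (\<phi> - \<psi>)"
definition sgn_ell2 :: "ell2 \<Rightarrow> ell2"
  where "sgn_ell2 \<psi> = \<psi> /\<^sub>R norm \<psi>"
definition uniformity_ell2 :: "(ell2 \<times> ell2) filter"
  where "uniformity_ell2 = (INF e\<in>{0<..}. principal {(x, y). dist x y < e})"
definition open_ell2 :: "ell2 set \<Rightarrow> bool"
  where "open_ell2 U \<longleftrightarrow> (\<forall>x\<in>U. \<forall>\<^sub>F (x', y) in uniformity. x' = x \<longrightarrow> y \<in> U)"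

instance
proof
  fix x y z :: ell2 and r s :: real
  show "dist x y = norm (x - y)" by (rule dist_ell2_def)
  show "sgn x = x /\<^sub>R norm x" by (rule sgn_ell2_def)
  show "uniformity = (INF e\<in>{0<..}. principal {(x :: ell2, y). dist x y < e})"
    by (rule uniformity_ell2_def)
  show "open U \<longleftrightarrow> (\<forall>x\<in>U. \<forall>\<^sub>F (x', y) in uniformity. x' = x \<longrightarrow> y \<in> U)" for U :: "ell2 set"
    by (rule open_ell2_def)
  show "x \<bullet> y = y \<bullet> x" by transfer (simp add: inner_commute)
  show "(x + y) \<bullet> z = x \<bullet> z + y \<bullet> z"
    by transfer (simp add: inner_add_left infsum_add summable_inner)
  show "(r *\<^sub>R x) \<bullet> y = r * (x \<bullet> y)"
    by transfer (simp add: infsum_cmult_right')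
  show "0 \<le> x \<bullet> x" by transfer (simp add: infsum_nonneg)
  show "x \<bullet> x = 0 \<longleftrightarrow> x = 0"
  proof
    assume "x \<bullet> x = 0"
    then show "x = 0"
    proof transfer
      fix f :: "int \<Rightarrow> complex"
      assume f: "sq_summable f" and 0: "(\<Sum>\<^sub>\<infinity>n. f n \<bullet> f n) = 0"
      have "f n \<bullet> f n = 0" for n
        by (rule nonneg_infsum_le_0D[where A = UNIV]) (use f 0 summable_inner in auto)
      then show "f = (\<lambda>n. 0)" by auto
    qed
  next
    assume "x = 0"
    then show "x \<bullet> x = 0" by (simp, transfer) simp
  qed
  show "norm x = sqrt (x \<bullet> x)"
    unfolding norm_ell2_def inner_ell2.rep_eq by (simp only: power2_norm_eq_inner)
qed

end

lemmas norm_ell2 = norm_ell2_def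

lemma norm_ell2_sq: "(norm \<psi>)\<^sup>2 = (\<Sum>\<^sub>\<infinity>n. (cmod (ell2_seq \<psi> n))\<^sup>2)"
  by (simp add: norm_ell2 infsum_nonneg)

lemma sum_le_norm_ell2_sq:
  "finite F \<Longrightarrow> (\<Sum>n\<in>F. (cmod (ell2_seq \<psi> n))\<^sup>2) \<le> (norm \<psi>)\<^sup>2"
  unfolding norm_ell2_sq
  using sq_summable_seq[of \<psi>] unfolding sq_summable_def
  by (intro finite_sum_le_infsum) auto

lemma cmod_le_norm_ell2: "cmod (ell2_seq \<psi> n) \<le> norm \<psi>"
  by (rule power2_le_imp_le) (use sum_le_norm_ell2_sq[of "{n}" \<psi>] in auto)

lemma
  assumes "\<And>F. finite F \<Longrightarrow> (\<Sum>n\<in>F. (cmod (f n))\<^sup>2) \<le> B\<^sup>2" "B \<ge> 0"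
  shows sq_summable_bound: "sq_summable f"
    and norm_ell2_bound: "norm (Abs_ell2 f) \<le> B"
proof -
  show *: "sq_summable f"
    unfolding sq_summable_def
    by (rule nonneg_bdd_above_summable_on) (use assms in \<open>auto intro!: bdd_aboveI2\<close>)
  have "(norm (Abs_ell2 f))\<^sup>2 \<le> B\<^sup>2"
    unfolding norm_ell2_sq ell2_seq_inverse'[OF *]
    by (rule infsum_le_finite_sums) (use * assms in \<open>auto simp: sq_summable_def\<close>)
  then show "norm (Abs_ell2 f) \<le> B"
    using assms(2) by (rule power2_le_imp_le)
qed

instance ell2 :: banach
proof
  fix X :: "nat \<Rightarrow> ell2"
  assume X: "Cauchy X"
  have "Cauchy (\<lambda>k. ell2_seq (X k) n)" for n
  proof (rule metric_CauchyI)
    fix e :: real assume "e > 0"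
    then obtain N where N: "\<And>j k. j \<ge> N \<Longrightarrow> k \<ge> N \<Longrightarrow> dist (X j) (X k) < e"
      using metric_CauchyD[OF X] by blast
    have "dist (ell2_seq (X j) n) (ell2_seq (X k) n) \<le> dist (X j) (X k)" for j k
      using cmod_le_norm_ell2[of "X j - X k" n] by (simp add: dist_norm minus_ell2.rep_eq)
    with N show "\<exists>N. \<forall>j\<ge>N. \<forall>k\<ge>N. dist (ell2_seq (X j) n) (ell2_seq (X k) n) < e"
      by (meson order_le_less_trans)
  qed
  then have "\<forall>n. \<exists>l. (\<lambda>k. ell2_seq (X k) n) \<longlonglongrightarrow> l"
    by (simp add: Cauchy_convergent_iff convergent_def)
  then obtain l where l: "\<And>n. (\<lambda>k. ell2_seq (X k) n) \<longlonglongrightarrow> l n"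
    by metis
  have main: "(\<Sum>n\<in>F. (cmod (ell2_seq (X j) n - l n))\<^sup>2) \<le> e\<^sup>2"
    if "finite F" "e > 0" and N: "\<And>k. k \<ge> N \<Longrightarrow> dist (X j) (X k) < e" for F j N e
  proof (rule LIMSEQ_le_const2)
    show "(\<lambda>k. \<Sum>n\<in>F. (cmod (ell2_seq (X j) n - ell2_seq (X k) n))\<^sup>2)
            \<longlonglongrightarrow> (\<Sum>n\<in>F. (cmod (ell2_seq (X j) n - l n))\<^sup>2)"
      by (intro tendsto_intros l)
    have "(\<Sum>n\<in>F. (cmod (ell2_seq (X j) n - ell2_seq (X k) n))\<^sup>2) \<le> e\<^sup>2" if "k \<ge> N" for k
    proof -
      have "(\<Sum>n\<in>F. (cmod (ell2_seq (X j) n - ell2_seq (X k) n))\<^sup>2) \<le> (norm (X j - X k))\<^sup>2"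
        using sum_le_norm_ell2_sq[OF \<open>finite F\<close>, of "X j - X k"] by (simp add: minus_ell2.rep_eq)
      also have "\<dots> \<le> e\<^sup>2"
        using N[OF that] by (intro power_mono) (auto simp: dist_norm)
      finally show ?thesis .
    qed
    then show "\<exists>N. \<forall>k\<ge>N. (\<Sum>n\<in>F. (cmod (ell2_seq (X j) n - ell2_seq (X k) n))\<^sup>2) \<le> e\<^sup>2"
      by blast
  qed
  have sq: "sq_summable l"
  proof -
    obtain N where N: "\<And>j k. j \<ge> N \<Longrightarrow> k \<ge> N \<Longrightarrow> dist (X j) (X k) < 1"
      using metric_CauchyD[OF X, of 1] by auto
    have "sq_summable (\<lambda>n. ell2_seq (X N) n - l n)"
      by (rule sq_summable_bound[of _ 1]) (use main[of _ 1 N N] N in auto)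
    from sq_summable_diff[OF sq_summable_seq[of "X N"] this] show ?thesis by simp
  qed
  have "X \<longlonglongrightarrow> Abs_ell2 l"
  proof (rule metric_LIMSEQ_I)
    fix e :: real assume e: "e > 0"
    obtain N where N: "\<And>j k. j \<ge> N \<Longrightarrow> k \<ge> N \<Longrightarrow> dist (X j) (X k) < e / 2"
      using metric_CauchyD[OF X, of "e / 2"] e by auto
    have "dist (X j) (Abs_ell2 l) < e" if "j \<ge> N" for j
    proof -
      have "X j - Abs_ell2 l = Abs_ell2 (\<lambda>n. ell2_seq (X j) n - l n)"
        by (rule ell2_eqI)
          (simp add: minus_ell2.rep_eq ell2_seq_inverse' sq sq_summable_diff sq_summable_seq)
      moreover have "norm (Abs_ell2 (\<lambda>n. ell2_seq (X j) n - l n)) \<le> e / 2"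
        by (rule norm_ell2_bound) (use main[of _ "e / 2" N j] N that e in auto)
      ultimately show ?thesis
        using e by (simp add: dist_norm)
    qed
    then show "\<exists>N. \<forall>j\<ge>N. dist (X j) (Abs_ell2 l) < e" by blast
  qed
  then show "convergent X" by (auto simp: convergent_def)
qed


section \<open>The sequence space of summable sequences and the norms in the estimate\<close>

definition ell1 :: "(int \<Rightarrow> complex) set"
  where "ell1 = {f. (\<lambda>n. cmod (f n)) summable_on UNIV}"

definition ell1_norm :: "(int \<Rightarrow> complex) \<Rightarrow> real"
  where "ell1_norm f = (\<Sum>\<^sub>\<infinity>n. cmod (f n))"

text \<open>
  Only meaningful for bounded sequences, in particular for the elements of \<open>ell2\<close>
  (see \<open>bdd_above_ell2\<close>).
\<close>

definition sup_norm :: "(int \<Rightarrow> complex) \<Rightarrow> real"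
  where "sup_norm f = (SUP n. cmod (f n))"

lemma bdd_above_ell2: "bdd_above (range (\<lambda>n. cmod (ell2_seq \<psi> n)))"
  using cmod_le_norm_ell2 by (rule bdd_aboveI2)

lemma ell1_imp_sq_summable:
  assumes "f \<in> ell1"
  shows "sq_summable f"
proof (rule sq_summableI_le)
  have f: "(\<lambda>n. cmod (f n)) summable_on UNIV"
    using assms by (simp add: ell1_def)
  then show "(\<lambda>n. ell1_norm f * cmod (f n)) summable_on UNIV"
    by (rule summable_on_cmult_right)
  show "(cmod (f n))\<^sup>2 \<le> ell1_norm f * cmod (f n)" for n
    using finite_sum_le_infsum[OF f, of "{n}"]
    by (auto simp: power2_eq_square ell1_norm_def intro!: mult_right_mono)
qed

lemma ell2_seq_Abs_ell1: "f \<in> ell1 \<Longrightarrow> ell2_seq (Abs_ell2 f) = f"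
  by (simp add: ell1_imp_sq_summable ell2_seq_inverse')


section \<open>Bounded operators and the exponential\<close>

lemma bounded_linear_mult_shift:
  assumes b: "\<And>n. cmod (b n) \<le> C"
  shows "bounded_linear (\<lambda>\<psi>. Abs_ell2 (\<lambda>n. b n * ell2_seq \<psi> (n + k)))"
proof (rule bounded_linear_intro[where K = C])
  note S = sq_summable_mult_shift[OF sq_summable_seq b]
  have C: "C \<ge> 0" using b[of 0] norm_ge_zero order_trans by blast
  fix \<phi> \<psi> :: ell2 and r :: real
  show "Abs_ell2 (\<lambda>n. b n * ell2_seq (\<phi> + \<psi>) (n + k)) =
      Abs_ell2 (\<lambda>n. b n * ell2_seq \<phi> (n + k)) + Abs_ell2 (\<lambda>n. b n * ell2_seq \<psi> (n + k))"
    by (rule ell2_eqI) (simp only: plus_ell2.rep_eq[of "Abs_ell2 _"] ell2_seq_inverse'[OF S],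
        simp only: plus_ell2.rep_eq distrib_left)
  show "Abs_ell2 (\<lambda>n. b n * ell2_seq (r *\<^sub>R \<psi>) (n + k)) =
      r *\<^sub>R Abs_ell2 (\<lambda>n. b n * ell2_seq \<psi> (n + k))"
    by (rule ell2_eqI) (simp only: scaleR_ell2.rep_eq[of _ "Abs_ell2 _"] ell2_seq_inverse'[OF S],
        simp only: scaleR_ell2.rep_eq mult_scaleR_right)
  show "norm (Abs_ell2 (\<lambda>n. b n * ell2_seq \<psi> (n + k))) \<le> norm \<psi> * C"
  proof (rule norm_ell2_bound)
    fix F :: "int set" assume F: "finite F"
    have "(\<Sum>n\<in>F. (cmod (b n * ell2_seq \<psi> (n + k)))\<^sup>2)
        \<le> (\<Sum>n\<in>F. C\<^sup>2 * (cmod (ell2_seq \<psi> (n + k)))\<^sup>2)"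
      using b by (auto simp: norm_mult power_mult_distrib intro!: sum_mono mult_right_mono power_mono)
    also have "\<dots> = C\<^sup>2 * (\<Sum>n\<in>(\<lambda>n. n + k) ` F. (cmod (ell2_seq \<psi> n))\<^sup>2)"
      by (simp add: sum_distrib_left sum.reindex inj_on_def)
    also have "\<dots> \<le> C\<^sup>2 * (norm \<psi>)\<^sup>2"
      using F by (intro mult_left_mono sum_le_norm_ell2_sq) auto
    finally show "(\<Sum>n\<in>F. (cmod (b n * ell2_seq \<psi> (n + k)))\<^sup>2) \<le> (norm \<psi> * C)\<^sup>2"
      by (simp add: power_mult_distrib mult.commute)
  qed (use C in auto)
qed

definition ell2_scaleC :: "complex \<Rightarrow> ell2 \<Rightarrow>\<^sub>L ell2"
  where "ell2_scaleC c = Blinfun (\<lambda>\<psi>. Abs_ell2 (\<lambda>n. c * ell2_seq \<psi> n))"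

lemma ell2_scaleC_apply: "ell2_seq (blinfun_apply (ell2_scaleC c) \<psi>) n = c * ell2_seq \<psi> n"
  using bounded_linear_mult_shift[of "\<lambda>_. c" "cmod c" 0]
  by (simp add: ell2_scaleC_def bounded_linear_Blinfun_apply ell2_seq_inverse'
      sq_summable_cmult sq_summable_seq)

definition blinfun_exp :: "('a::banach \<Rightarrow>\<^sub>L 'a) \<Rightarrow> ('a \<Rightarrow>\<^sub>L 'a)"
  where "blinfun_exp A = (\<Sum>k. (1 / fact k) *\<^sub>R (((\<lambda>B. A o\<^sub>L B) ^^ k) id_blinfun))"

lemma norm_blinfun_pow_le:
  fixes A :: "'a::real_normed_vector \<Rightarrow>\<^sub>L 'a"
  shows "norm (((\<lambda>B. A o\<^sub>L B) ^^ k) id_blinfun) \<le> norm A ^ k"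
proof (induction k)
  case 0
  show ?case
    by (auto intro: norm_blinfun_bound)
next
  case (Suc k)
  have "norm (((\<lambda>B. A o\<^sub>L B) ^^ Suc k) id_blinfun)
      \<le> norm A * norm (((\<lambda>B. A o\<^sub>L B) ^^ k) id_blinfun)"
    by (simp add: norm_blinfun_compose)
  also have "\<dots> \<le> norm A * norm A ^ k"
    by (intro mult_left_mono Suc.IH) auto
  finally show ?case by simp
qed

lemma summable_blinfun_exp:
  fixes A :: "'a::banach \<Rightarrow>\<^sub>L 'a"
  shows "summable (\<lambda>k. (1 / fact k) *\<^sub>R (((\<lambda>B. A o\<^sub>L B) ^^ k) id_blinfun))"
proof (rule summable_comparison_test)
  show "summable (\<lambda>k. inverse (fact k) * norm A ^ k)"
    by (rule summable_exp)
  show "\<exists>N. \<forall>k\<ge>N. norm ((1 / fact k) *\<^sub>R (((\<lambda>B. A o\<^sub>L B) ^^ k) id_blinfun))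
      \<le> inverse (fact k) * norm A ^ k"
    using norm_blinfun_pow_le[of _ A]
    by (auto simp: inverse_eq_divide intro!: divide_right_mono)
qed


section \<open>The periodic discrete Schroedinger operator\<close>

definition periodic_potential :: "(int \<Rightarrow> real) \<Rightarrow> bool"
  where "periodic_potential V \<longleftrightarrow> (\<exists>p::int. p \<ge> 1 \<and> (\<forall>n. V (n + p) = V n))"

text \<open>
  \<^const>\<open>Blinfun\<close> is only meaningful on bounded linear maps; \<open>schroedinger_apply\<close> shows that this
  is the case for bounded, hence for periodic, potentials.
\<close>

definition schroedinger :: "(int \<Rightarrow> real) \<Rightarrow> ell2 \<Rightarrow>\<^sub>L ell2"
  where "schroedinger V = Blinfun (\<lambda>\<psi>. Abs_ell2 (\<lambda>n.
    ell2_seq \<psi> (n - 1) + ell2_seq \<psi> (n + 1) + of_real (V n) * ell2_seq \<psi> n))"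

definition schroedinger_group :: "(int \<Rightarrow> real) \<Rightarrow> real \<Rightarrow> ell2 \<Rightarrow>\<^sub>L ell2"
  where "schroedinger_group V t = blinfun_exp (ell2_scaleC (- \<i> * of_real t) o\<^sub>L schroedinger V)"

definition japanese_bracket :: "real \<Rightarrow> real"
  where "japanese_bracket t = sqrt (1 + t\<^sup>2)"

lemma periodic_potential_bounded:
  assumes "periodic_potential V"
  obtains C where "\<And>n. \<bar>V n\<bar> \<le> C"
proof -
  obtain p :: int where p: "p \<ge> 1" and V: "\<And>n. V (n + p) = V n"
    using assms by (auto simp: periodic_potential_def)
  have nat: "V (n + int k * p) = V n" for n k
  proof (induction k)
    case (Suc k)
    have "V (n + int (Suc k) * p) = V (n + int k * p + p)"
      by (simp add: algebra_simps)
    with Suc V show ?case by simp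
  qed simp
  have "V n = V (n mod p)" for n
  proof (cases "n div p \<ge> 0")
    case True
    then show ?thesis
      using nat[of "n mod p" "nat (n div p)"] by simp
  next
    case False
    have "n mod p = n + - (n div p) * p"
      by (simp add: minus_div_mult_eq_mod[symmetric])
    with False show ?thesis
      using nat[of n "nat (- (n div p))"] by simp
  qed
  moreover have "n mod p \<in> {0..<p}" for n
    using p by simp
  ultimately have "\<bar>V n\<bar> \<le> Max ((\<lambda>n. \<bar>V n\<bar>) ` {0..<p})" for n
    by (metis (no_types, lifting) Max_ge finite_atLeastLessThan_int finite_imageI imageI)
  then show thesis by (rule that)
qed

lemma schroedinger_apply:
  assumes "\<And>n. \<bar>V n\<bar> \<le> C"
  shows "ell2_seq (blinfun_apply (schroedinger V) \<psi>) n =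
    ell2_seq \<psi> (n - 1) + ell2_seq \<psi> (n + 1) + of_real (V n) * ell2_seq \<psi> n"
proof -
  let ?T = "\<lambda>b k \<psi>. Abs_ell2 (\<lambda>n. b n * ell2_seq \<psi> (n + k))"
  let ?V = "\<lambda>n. complex_of_real (V n)"
  let ?H = "\<lambda>\<psi> n. ell2_seq \<psi> (n - 1) + ell2_seq \<psi> (n + 1) + ?V n * ell2_seq \<psi> n"
  have V: "cmod (?V n) \<le> C" for n
    using assms by simp
  have sq: "sq_summable (\<lambda>n. ell2_seq \<psi> (n - 1))" "sq_summable (\<lambda>n. ell2_seq \<psi> (n + 1))"
    "sq_summable (\<lambda>n. ?V n * ell2_seq \<psi> n)" for \<psi>
    using sq_summable_mult_shift[OF sq_summable_seq[of \<psi>], of "\<lambda>_. 1" 1 "-1"]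
      sq_summable_mult_shift[OF sq_summable_seq[of \<psi>], of "\<lambda>_. 1" 1 1]
      sq_summable_mult_shift[OF sq_summable_seq[of \<psi>], of ?V C 0] V by simp_all
  have H: "sq_summable (?H \<psi>)" for \<psi>
    by (intro sq_summable_add sq)
  have "(\<lambda>\<psi>. Abs_ell2 (?H \<psi>)) = (\<lambda>\<psi>. ?T (\<lambda>_. 1) (-1) \<psi> + ?T (\<lambda>_. 1) 1 \<psi> + ?T ?V 0 \<psi>)"
    by (intro ext ell2_eqI)
      (simp add: plus_ell2.rep_eq ell2_seq_inverse'[OF H] ell2_seq_inverse'[OF sq(1)]
        ell2_seq_inverse'[OF sq(2)] ell2_seq_inverse'[OF sq(3)])
  moreover have "bounded_linear (\<lambda>\<psi>. ?T (\<lambda>_. 1) (-1) \<psi> + ?T (\<lambda>_. 1) 1 \<psi> + ?T ?V 0 \<psi>)"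
    by (intro bounded_linear_add bounded_linear_mult_shift[where C = 1]
        bounded_linear_mult_shift[where C = C]) (use V in auto)
  ultimately have "bounded_linear (\<lambda>\<psi>. Abs_ell2 (?H \<psi>))"
    by simp
  then show ?thesis
    by (simp add: schroedinger_def bounded_linear_Blinfun_apply ell2_seq_inverse'[OF H])
qed

end

theory Submission
  imports Defs "HOL-Complex_Analysis.Complex_Analysis"
    "HOL-Computational_Algebra.Fundamental_Theorem_Algebra"
begin

text \<open>
  Let \<open>p\<close> be a period and let \<open>D\<close> be the discriminant of the operator, so that the spectrum of the fibre
  operator with Floquet multiplier \<open>exp (i \<theta>)\<close> is the set of roots of \<open>D E = 2 cos \<theta>\<close>. On each fibre
  Lagrange interpolation expresses the propagator as a sum over these roots of
  \<open>exp (- i t E) * \<phi> E / D' E\<close>, with an explicit Bloch solution \<open>\<phi>\<close>, and the kernel is the average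
  over \<open>\<theta>\<close>. Near every \<open>\<theta>\<close>, closed gaps included, the roots form \<open>p\<close> analytic branches and the
  amplitudes \<open>\<phi> E / D' E\<close> extend analytically: at a double root \<open>\<phi>\<close> vanishes by self-adjointness.

  The exponent \<open>1/3\<close> comes from van der Corput's lemma and the fact that the second and third
  derivative of a branch never vanish simultaneously. Indeed, \<open>D\<close> takes no value in \<open>[-2, 2]\<close> off
  the real line, so that \<open>\<Theta> = arccos (D / 2)\<close> is a holomorphic map of the upper half plane to itself. If both
  derivatives vanished at \<open>\<theta>\<close>, then \<open>\<Theta>\<close> would agree with an affine function \<open>\<theta> + d * (z - x)\<close> up to
  order four, and the function \<open>1 / (d * (z - x)) - 1 / (\<Theta> z - \<theta>)\<close> would contradict the minimum principle.
\<close>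

section \<open>Van der Corput's lemma\<close>

text \<open>The bound must be uniform in the lattice site, and this shapes the argument. With
  \<open>n = N * p + k\<close> the residue \<open>k\<close> selects one of finitely many amplitudes,
  while \<open>N\<close> enters only as the linear phase \<open>N * \<theta>\<close>, invisible to
  second and third derivatives; critical points are therefore never located, and constants found
  near one \<open>\<theta>\<close> serve all sites. Nothing quantitative is available about the
  bands of a general potential: nondegeneracy is a pointwise statement proved by contradiction, and
  a single constant results from compactness of \<open>[0, 2 * pi]\<close>. The obstacle is the
  closed gap. There the eigenvalues ordered by size have corners and \<open>D'\<close> vanishes, so
  bands are treated as germs at each \<open>\<theta>\<close>, labelled only locally. An open gap
  edge is harmless: \<open>D'\<close> is nonzero there, the branch stays analytic in
  \<open>\<theta>\<close>, and its slope vanishes while its second derivative does not.\<close>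

lemma norm_integral_cis_first:
  fixes f f1 f2 :: "real \<Rightarrow> real"
  assumes ab: "a \<le> b" and \<mu>: "\<mu> > 0"
    and f1: "\<And>x. x \<in> {a..b} \<Longrightarrow> (f has_real_derivative f1 x) (at x within {a..b})"
    and f2: "\<And>x. x \<in> {a..b} \<Longrightarrow> (f1 has_real_derivative f2 x) (at x within {a..b})"
    and f2c: "continuous_on {a..b} f2"
    and pos: "\<And>x. x \<in> {a..b} \<Longrightarrow> f2 x \<ge> 0"
    and big: "\<And>x. x \<in> {a..b} \<Longrightarrow> \<bar>f1 x\<bar> \<ge> \<mu>"
  shows "norm (integral {a..b} (\<lambda>x. cis (f x))) \<le> 4 / \<mu>"
proof -
  have nz: "f1 x \<noteq> 0" if "x \<in> {a..b}" for x
    using big[OF that] \<mu> by auto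
  have fc: "continuous_on {a..b} f" and f1c: "continuous_on {a..b} f1"
    using DERIV_continuous_on[OF f1] DERIV_continuous_on[OF f2] by auto
  \<comment> \<open>Integration by parts: \<open>G' = cis f + g\<close>, where \<open>g\<close>
    carries the derivative of \<open>1 / f1\<close>. As \<open>f2 \<ge> 0\<close>, the norm of
    \<open>g\<close> is the derivative of \<open>- 1 / f1\<close>, so its integral telescopes: two
    boundary values of \<open>G\<close> and two of \<open>1 / f1\<close> give
    \<open>4 / \<mu>\<close>.\<close>
  define G where "G = (\<lambda>x. - \<i> * cis (f x) * of_real (1 / f1 x))"
  define g where "g = (\<lambda>x. \<i> * cis (f x) * of_real (f2 x / (f1 x)\<^sup>2))"
  have inv: "((\<lambda>x. 1 / f1 x) has_real_derivative - (f2 x / (f1 x)\<^sup>2)) (at x within {a..b})"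
    if "x \<in> {a..b}" for x
    using f2[OF that] nz[OF that]
    by (auto intro!: derivative_eq_intros simp: power2_eq_square)
  have cisd: "((\<lambda>x. cis (f x)) has_vector_derivative (of_real (f1 x) * (\<i> * cis (f x)))) (at x within {a..b})"
    if "x \<in> {a..b}" for x
  proof -
    have "((\<lambda>x. \<i> * complex_of_real (f x)) has_vector_derivative \<i> * of_real (f1 x)) (at x within {a..b})"
      using f1[OF that]
      by (intro derivative_intros has_vector_derivative_of_real)
        (simp add: has_real_derivative_iff_has_vector_derivative)
    from field_vector_diff_chain_within[OF this, of exp "exp (\<i> * of_real (f x))"]
    show ?thesis
      by (simp add: o_def cis_conv_exp mult_ac DERIV_exp has_field_derivative_at_within)
  qed
  have invd: "((\<lambda>x. complex_of_real (1 / f1 x)) has_vector_derivative of_real (- (f2 x / (f1 x)\<^sup>2)))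
      (at x within {a..b})" if "x \<in> {a..b}" for x
    by (rule has_vector_derivative_of_real)
      (use inv[OF that] in \<open>simp add: has_real_derivative_iff_has_vector_derivative\<close>)
  have Gd: "(G has_vector_derivative (cis (f x) + g x)) (at x within {a..b})" if "x \<in> {a..b}" for x
  proof -
    have "((\<lambda>x. - \<i> * (cis (f x) * of_real (1 / f1 x))) has_vector_derivative
        - \<i> * (cis (f x) * of_real (- (f2 x / (f1 x)\<^sup>2)) + (of_real (f1 x) * (\<i> * cis (f x))) * of_real (1 / f1 x)))
        (at x within {a..b})"
      by (intro derivative_intros has_vector_derivative_mult invd cisd that)
    moreover have "- \<i> * (cis (f x) * of_real (- (f2 x / (f1 x)\<^sup>2)) + (of_real (f1 x) * (\<i> * cis (f x))) * of_real (1 / f1 x))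
      = cis (f x) + g x"
      using nz[OF that] by (simp add: g_def field_simps)
    ultimately show ?thesis
      by (simp add: G_def mult.assoc)
  qed
  have I: "((\<lambda>x. cis (f x) + g x) has_integral (G b - G a)) {a..b}"
    by (rule fundamental_theorem_of_calculus[OF ab Gd])
  have R: "((\<lambda>x. f2 x / (f1 x)\<^sup>2) has_integral (- (1 / f1 b) - - (1 / f1 a))) {a..b}"
  proof (rule fundamental_theorem_of_calculus[OF ab])
    show "((\<lambda>x. - (1 / f1 x)) has_vector_derivative f2 x / (f1 x)\<^sup>2) (at x within {a..b})"
      if "x \<in> {a..b}" for x
      using DERIV_minus[OF inv[OF that]]
      by (simp add: has_real_derivative_iff_has_vector_derivative)
  qed
  have cint: "(\<lambda>x. cis (f x)) integrable_on {a..b}"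
    by (intro integrable_continuous_interval continuous_intros fc)
  have gint: "g integrable_on {a..b}"
    unfolding g_def using nz
    by (intro integrable_continuous_interval continuous_intros fc f1c f2c) auto
  have gle: "norm (integral {a..b} g) \<le> integral {a..b} (\<lambda>x. f2 x / (f1 x)\<^sup>2)"
    by (rule integral_norm_bound_integral[OF gint])
      (use R pos in \<open>auto simp: g_def norm_mult norm_divide norm_power has_integral_iff\<close>)
  have inv_le: "\<bar>1 / f1 x\<bar> \<le> 1 / \<mu>" if "x \<in> {a..b}" for x
    using big[OF that] \<mu> by (simp add: field_simps)
  have Gle: "norm (G x) \<le> 1 / \<mu>" if "x \<in> {a..b}" for x
    using inv_le[OF that] by (simp add: G_def norm_mult norm_divide)
  have "integral {a..b} (\<lambda>x. cis (f x)) = G b - G a - integral {a..b} g"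
    using integral_add[OF cint gint] I by (simp add: has_integral_iff eq_diff_eq)
  also have "norm \<dots> \<le> norm (G b) + norm (G a) + norm (integral {a..b} g)"
    by (meson add_mono norm_triangle_ineq4 order_trans order_refl)
  also have "\<dots> \<le> 1/\<mu> + 1/\<mu> + (1/\<mu> + 1/\<mu>)"
  proof -
    have "integral {a..b} (\<lambda>x. f2 x / (f1 x)\<^sup>2) = 1 / f1 a - 1 / f1 b"
      using R by (simp add: has_integral_iff)
    moreover have "1 / f1 a \<le> 1 / \<mu>" "- (1 / f1 b) \<le> 1 / \<mu>"
      using inv_le[of a] inv_le[of b] ab by (auto simp only: abs_le_iff atLeastAtMost_iff)
    moreover have "norm (G a) \<le> 1 / \<mu>" "norm (G b) \<le> 1 / \<mu>"
      using Gle ab by auto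
    ultimately show ?thesis using gle by linarith
  qed
  finally show ?thesis by simp
qed

text \<open>
  The scale-splitting step of van der Corput's lemma: an interval of length \<open>2 * \<delta>\<close> around the
  zero of \<open>h\<close> is estimated trivially.
\<close>

lemma norm_integral_split:
  fixes g :: "real \<Rightarrow> complex" and h :: "real \<Rightarrow> real"
  assumes ab: "a \<le> b" and gc: "continuous_on {a..b} g" and g1: "\<And>x. norm (g x) \<le> 1"
    and hc: "continuous_on {a..b} h" and l: "\<kappa> > 0" and d: "\<delta> > 0"
    and grow: "\<And>x y. a \<le> x \<Longrightarrow> x \<le> y \<Longrightarrow> y \<le> b \<Longrightarrow> h y - h x \<ge> \<kappa> * (y - x)"
    and K: "\<And>u v. a \<le> u \<Longrightarrow> u \<le> v \<Longrightarrow> v \<le> b \<Longrightarrow> (\<forall>x\<in>{u..v}. \<bar>h x\<bar> \<ge> \<kappa> * \<delta>) \<Longrightarrow>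
          norm (integral {u..v} g) \<le> K" and K0: "K \<ge> 0"
  shows "norm (integral {a..b} g) \<le> 2 * K + 2 * \<delta>"
proof -
  \<comment> \<open>If \<open>h\<close> does not change sign, \<open>c\<close> is the endpoint where
    \<open>h\<close> is closest to zero; the implication for the missing side is vacuous, and the
    corresponding outer piece below is empty.\<close>
  obtain c where c: "a \<le> c" "c \<le> b" "c > a \<Longrightarrow> h c \<le> 0" "c < b \<Longrightarrow> h c \<ge> 0"
  proof (cases "h a \<ge> 0 \<or> h b \<le> 0")
    case True
    then show thesis using that[of a] that[of b] ab by auto
  next
    case False
    then obtain c where "a \<le> c" "c \<le> b" "h c = 0"
      using IVT'[of h a 0 b] hc ab by auto
    then show thesis using that by auto
  qed
  define u where "u = max a (c - \<delta>)"
  define v where "v = min b (c + \<delta>)"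
  have uv: "a \<le> u" "u \<le> v" "v \<le> b" "v - u \<le> 2 * \<delta>"
    using c d by (auto simp: u_def v_def)
  have int: "g integrable_on {x..y}" if "a \<le> x" "y \<le> b" for x y
    using gc that by (intro integrable_continuous_interval) (auto intro: continuous_on_subset)
  have "integral {a..b} g = integral {a..u} g + integral {u..v} g + integral {v..b} g"
    using uv Henstock_Kurzweil_Integration.integral_combine[of a u b g, symmetric]
      Henstock_Kurzweil_Integration.integral_combine[of u v b g, symmetric] int ab
    by simp
  moreover have "norm (integral {a..u} g) \<le> K"
  proof (cases "u = a")
    case False
    then have u: "u = c - \<delta>" "c > a" using d by (auto simp: u_def max_def split: if_splits)
    show ?thesis
    proof (rule K)
      show "\<forall>x\<in>{a..u}. \<bar>h x\<bar> \<ge> \<kappa> * \<delta>"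
      proof
        fix x assume x: "x \<in> {a..u}"
        have "\<kappa> * \<delta> \<le> \<kappa> * (c - x)" using x u l by (intro mult_left_mono) auto
        also have "\<dots> \<le> h c - h x" using x u c d by (intro grow) auto
        finally show "\<bar>h x\<bar> \<ge> \<kappa> * \<delta>" using c(3) u by auto
      qed
    qed (use uv in auto)
  qed (use K0 in auto)
  moreover have "norm (integral {v..b} g) \<le> K"
  proof (cases "v = b")
    case False
    then have v: "v = c + \<delta>" "c < b" using d by (auto simp: v_def min_def split: if_splits)
    show ?thesis
    proof (rule K)
      show "\<forall>x\<in>{v..b}. \<bar>h x\<bar> \<ge> \<kappa> * \<delta>"
      proof
        fix x assume x: "x \<in> {v..b}"
        have "\<kappa> * \<delta> \<le> \<kappa> * (x - c)" using x v l by (intro mult_left_mono) auto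
        also have "\<dots> \<le> h x - h c" using x v c d by (intro grow) auto
        finally show "\<bar>h x\<bar> \<ge> \<kappa> * \<delta>" using c(4) v by auto
      qed
    qed (use uv in auto)
  qed (use K0 in auto)
  moreover have "norm (integral {u..v} g) \<le> 2 * \<delta>"
  proof -
    have "norm (integral {u..v} g) \<le> 1 * (v - u)"
      using uv gc g1 by (intro integral_bound) (auto intro: continuous_on_subset)
    then show ?thesis using uv by simp
  qed
  ultimately show ?thesis
    using norm_triangle_ineq[of "integral {a..u} g + integral {u..v} g" "integral {v..b} g"]
      norm_triangle_ineq[of "integral {a..u} g" "integral {u..v} g"] by simp
qed

lemma growth_from_deriv:
  fixes h :: "real \<Rightarrow> real"
  assumes "\<And>x. x \<in> {a..b} \<Longrightarrow> (h has_real_derivative h' x) (at x within {a..b})"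
    and "\<And>x. x \<in> {a..b} \<Longrightarrow> h' x \<ge> \<kappa>" and "a \<le> x" "x \<le> y" "y \<le> b"
  shows "h y - h x \<ge> \<kappa> * (y - x)"
proof (cases "x = y")
  case False
  then have "x < y" using assms by auto
  moreover have "(h has_derivative (\<lambda>d. h' u * d)) (at u within {x..y})" if "x \<le> u" "u \<le> y" for u
    by (rule has_derivative_subset[of _ _ _ "{a..b}"])
      (use that assms(1)[of u] assms(3-5) in \<open>auto simp: has_field_derivative_def\<close>)
  ultimately obtain u where u: "u \<in> {x<..<y}" "h y - h x = h' u * (y - x)"
    using mvt_simple[of x y h "\<lambda>u d. h' u * d"] by blast
  have "h' u \<ge> \<kappa>" using u assms by auto
  then show ?thesis using u assms(4) by (simp add: mult_right_mono)
qed simp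

lemma norm_integral_cis_second:
  fixes f f1 f2 :: "real \<Rightarrow> real"
  assumes ab: "a \<le> b" and l: "\<kappa> > 0"
    and f1: "\<And>x. x \<in> {a..b} \<Longrightarrow> (f has_real_derivative f1 x) (at x within {a..b})"
    and f2: "\<And>x. x \<in> {a..b} \<Longrightarrow> (f1 has_real_derivative f2 x) (at x within {a..b})"
    and f2c: "continuous_on {a..b} f2"
    and pos: "\<And>x. x \<in> {a..b} \<Longrightarrow> f2 x \<ge> \<kappa>"
  shows "norm (integral {a..b} (\<lambda>x. cis (f x))) \<le> 10 / sqrt \<kappa>"
proof -
  have fc: "continuous_on {a..b} f" and f1c: "continuous_on {a..b} f1"
    using DERIV_continuous_on[OF f1] DERIV_continuous_on[OF f2] by auto
  \<comment> \<open>This value balances the two contributions: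
    \<open>\<kappa> * \<delta> = sqrt \<kappa>\<close> turns
    \<open>2 * (4 / (\<kappa> * \<delta>)) + 2 * \<delta>\<close> into
    \<open>10 / sqrt \<kappa>\<close>.\<close>
  define \<delta> where "\<delta> = 1 / sqrt \<kappa>"
  have ld: "\<kappa> * \<delta> = sqrt \<kappa>"
    using l by (simp add: \<delta>_def real_div_sqrt)
  have "norm (integral {a..b} (\<lambda>x. cis (f x))) \<le> 2 * (4 / (\<kappa> * \<delta>)) + 2 * \<delta>"
  proof (rule norm_integral_split[where h = f1 and \<kappa> = \<kappa>])
    show "f1 y - f1 x \<ge> \<kappa> * (y - x)" if "a \<le> x" "x \<le> y" "y \<le> b" for x y
      by (rule growth_from_deriv[OF f2 pos that])
    show "norm (integral {u..v} (\<lambda>x. cis (f x))) \<le> 4 / (\<kappa> * \<delta>)"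
      if "a \<le> u" "u \<le> v" "v \<le> b" "\<forall>x\<in>{u..v}. \<bar>f1 x\<bar> \<ge> \<kappa> * \<delta>" for u v
    proof (rule norm_integral_cis_first[where ?f1.0 = f1 and ?f2.0 = f2])
      show "(f has_real_derivative f1 x) (at x within {u..v})" if "x \<in> {u..v}" for x
        using \<open>a \<le> u\<close> \<open>v \<le> b\<close> that by (intro has_field_derivative_subset[OF f1]) auto
      show "(f1 has_real_derivative f2 x) (at x within {u..v})" if "x \<in> {u..v}" for x
        using \<open>a \<le> u\<close> \<open>v \<le> b\<close> that by (intro has_field_derivative_subset[OF f2]) auto
      show "continuous_on {u..v} f2"
        using that by (intro continuous_on_subset[OF f2c]) auto
      show "f2 x \<ge> 0" if "x \<in> {u..v}" for x
        using \<open>a \<le> u\<close> \<open>v \<le> b\<close> that pos[of x] l by auto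
    qed (use that l ld in auto)
  qed (use ab l ld fc f1c in \<open>auto intro!: continuous_intros simp: \<delta>_def\<close>)
  also have "\<dots> = 10 / sqrt \<kappa>"
    by (simp add: ld) (simp add: \<delta>_def)
  finally show ?thesis .
qed

text \<open>Conjugation of the integral; it allows the sign of the controlling derivative of the
  phase to be normalised.\<close>

lemma norm_integral_cis_uminus:
  "norm (integral {a..b} (\<lambda>x. cis (- f x))) = norm (integral {a..b} (\<lambda>x. cis (f x)))"
proof -
  have "integral {a..b} (\<lambda>x. cis (- f x)) = integral {a..b} (\<lambda>x. cnj (cis (f x)))"
    by (simp add: cis_cnj)
  also have "\<dots> = cnj (integral {a..b} (\<lambda>x. cis (f x)))"
    by (rule integral_cnj[symmetric])
  finally show ?thesis by simp
qed

lemma norm_integral_cis_second_abs: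
  fixes f f1 f2 :: "real \<Rightarrow> real"
  assumes ab: "a \<le> b" and l: "\<kappa> > 0"
    and f1: "\<And>x. x \<in> {a..b} \<Longrightarrow> (f has_real_derivative f1 x) (at x within {a..b})"
    and f2: "\<And>x. x \<in> {a..b} \<Longrightarrow> (f1 has_real_derivative f2 x) (at x within {a..b})"
    and f2c: "continuous_on {a..b} f2"
    and big: "\<And>x. x \<in> {a..b} \<Longrightarrow> \<bar>f2 x\<bar> \<ge> \<kappa>"
  shows "norm (integral {a..b} (\<lambda>x. cis (f x))) \<le> 10 / sqrt \<kappa>"
proof (cases "\<forall>x\<in>{a..b}. f2 x \<ge> \<kappa>")
  case True
  then show ?thesis
    using norm_integral_cis_second[OF ab l f1 f2 f2c] by auto
next
  case False
  then obtain x0 where x0: "x0 \<in> {a..b}" "f2 x0 < 0" using big l by force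
  have neg: "- f2 x \<ge> \<kappa>" if x: "x \<in> {a..b}" for x
  proof (rule ccontr)
    assume "\<not> ?thesis"
    then have "f2 x > 0" using big[OF x] l by auto
    moreover have "connected (f2 ` {a..b})"
      by (rule connected_continuous_image[OF f2c]) auto
    ultimately have "0 \<in> f2 ` {a..b}"
      using x x0 unfolding connected_iff_interval by (meson imageI less_imp_le)
    then show False using big l by force
  qed
  have "norm (integral {a..b} (\<lambda>x. cis (- f x))) \<le> 10 / sqrt \<kappa>"
    by (rule norm_integral_cis_second[where ?f1.0 = "\<lambda>x. - f1 x" and ?f2.0 = "\<lambda>x. - f2 x"])
      (use ab l f1 f2 f2c neg in \<open>auto intro!: derivative_intros continuous_intros\<close>)
  then show ?thesis by (simp only: norm_integral_cis_uminus)
qed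

lemma norm_integral_cis_third:
  fixes f f1 f2 f3 :: "real \<Rightarrow> real"
  assumes ab: "a \<le> b" and l: "\<kappa> > 0"
    and f1: "\<And>x. x \<in> {a..b} \<Longrightarrow> (f has_real_derivative f1 x) (at x within {a..b})"
    and f2: "\<And>x. x \<in> {a..b} \<Longrightarrow> (f1 has_real_derivative f2 x) (at x within {a..b})"
    and f3: "\<And>x. x \<in> {a..b} \<Longrightarrow> (f2 has_real_derivative f3 x) (at x within {a..b})"
    and pos: "\<And>x. x \<in> {a..b} \<Longrightarrow> f3 x \<ge> \<kappa>"
  shows "norm (integral {a..b} (\<lambda>x. cis (f x))) \<le> 22 * \<kappa> powr (-1/3)"
proof -
  have fc: "continuous_on {a..b} f" and f2c: "continuous_on {a..b} f2"
    using DERIV_continuous_on[OF f1] DERIV_continuous_on[OF f3] by auto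
  \<comment> \<open>Chosen with \<open>\<kappa> * \<delta> ^ 3 = 1\<close>, so that the
    second-derivative bound \<open>10 / sqrt (\<kappa> * \<delta>)\<close> equals
    \<open>10 * \<delta>\<close>; hence \<open>22 = 2 * 10 + 2\<close>.\<close>
  define \<delta> where "\<delta> = \<kappa> powr (-1/3)"
  have ld: "\<kappa> * \<delta> = \<kappa> powr (2/3)"
    using l powr_add[of \<kappa> 1 "-1/3"] by (simp add: \<delta>_def)
  have d: "10 / sqrt (\<kappa> * \<delta>) = 10 * \<delta>"
    unfolding ld using l by (simp add: \<delta>_def powr_half_sqrt[symmetric] powr_powr powr_minus_divide)
  have "norm (integral {a..b} (\<lambda>x. cis (f x))) \<le> 2 * (10 * \<delta>) + 2 * \<delta>"
  proof (rule norm_integral_split[where h = f2 and \<kappa> = \<kappa>])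
    show "f2 y - f2 x \<ge> \<kappa> * (y - x)" if "a \<le> x" "x \<le> y" "y \<le> b" for x y
      by (rule growth_from_deriv[OF f3 pos that])
    show "norm (integral {u..v} (\<lambda>x. cis (f x))) \<le> 10 * \<delta>"
      if "a \<le> u" "u \<le> v" "v \<le> b" "\<forall>x\<in>{u..v}. \<bar>f2 x\<bar> \<ge> \<kappa> * \<delta>" for u v
      unfolding d[symmetric]
    proof (rule norm_integral_cis_second_abs[where ?f1.0 = f1 and ?f2.0 = f2])
      show "(f has_real_derivative f1 x) (at x within {u..v})" if "x \<in> {u..v}" for x
        using \<open>a \<le> u\<close> \<open>v \<le> b\<close> that by (intro has_field_derivative_subset[OF f1]) auto
      show "(f1 has_real_derivative f2 x) (at x within {u..v})" if "x \<in> {u..v}" for x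
        using \<open>a \<le> u\<close> \<open>v \<le> b\<close> that by (intro has_field_derivative_subset[OF f2]) auto
      show "continuous_on {u..v} f2"
        using that by (intro continuous_on_subset[OF f2c]) auto
    qed (use that l ld in auto)
  qed (use ab l ld fc f2c in \<open>auto intro!: continuous_intros simp: \<delta>_def\<close>)
  then show ?thesis by (simp add: \<delta>_def)
qed

lemma norm_integral_cis_third_abs:
  fixes f f1 f2 f3 :: "real \<Rightarrow> real"
  assumes ab: "a \<le> b" and l: "\<kappa> > 0"
    and f1: "\<And>x. x \<in> {a..b} \<Longrightarrow> (f has_real_derivative f1 x) (at x within {a..b})"
    and f2: "\<And>x. x \<in> {a..b} \<Longrightarrow> (f1 has_real_derivative f2 x) (at x within {a..b})"
    and f3: "\<And>x. x \<in> {a..b} \<Longrightarrow> (f2 has_real_derivative f3 x) (at x within {a..b})"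
    and sgn: "(\<forall>x\<in>{a..b}. f3 x \<ge> \<kappa>) \<or> (\<forall>x\<in>{a..b}. f3 x \<le> - \<kappa>)"
  shows "norm (integral {a..b} (\<lambda>x. cis (f x))) \<le> 22 * \<kappa> powr (-1/3)"
proof (cases "\<forall>x\<in>{a..b}. f3 x \<ge> \<kappa>")
  case True
  then show ?thesis
    using norm_integral_cis_third[OF ab l f1 f2 f3] by auto
next
  case False
  then have neg: "- f3 x \<ge> \<kappa>" if "x \<in> {a..b}" for x
    using sgn that by force
  have "norm (integral {a..b} (\<lambda>x. cis (- f x))) \<le> 22 * \<kappa> powr (-1/3)"
    by (rule norm_integral_cis_third[where ?f1.0 = "\<lambda>x. - f1 x" and ?f2.0 = "\<lambda>x. - f2 x"
          and ?f3.0 = "\<lambda>x. - f3 x"])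
      (use ab l f1 f2 f3 neg in \<open>auto intro!: derivative_intros\<close>)
  then show ?thesis by (simp only: norm_integral_cis_uminus)
qed

text \<open>Integration by parts against the primitive \<open>G\<close> of the oscillating factor
  leaves one boundary term and the integral of \<open>G * A'\<close>. This is why the estimate for
  \<open>g\<close> is demanded on all initial intervals \<open>{a..x}\<close>.\<close>

lemma norm_integral_amplitude:
  fixes g A A' :: "real \<Rightarrow> complex"
  assumes ab: "a \<le> b" and gc: "continuous_on {a..b} g"
    and A: "\<And>x. x \<in> {a..b} \<Longrightarrow> (A has_vector_derivative A' x) (at x within {a..b})"
    and A'c: "continuous_on {a..b} A'"
    and K: "\<And>x. x \<in> {a..b} \<Longrightarrow> norm (A x) \<le> K" "\<And>x. x \<in> {a..b} \<Longrightarrow> norm (A' x) \<le> K"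
    and B: "\<And>x. x \<in> {a..b} \<Longrightarrow> norm (integral {a..x} g) \<le> B"
  shows "norm (integral {a..b} (\<lambda>x. g x * A x)) \<le> B * K * (1 + (b - a))"
proof -
  define G where "G = (\<lambda>x. integral {a..x} g)"
  have Ac: "continuous_on {a..b} A"
    using A by (intro continuous_on_vector_derivative)
  have B0: "B \<ge> 0" and K0: "K \<ge> 0"
    using B[of a] order_trans[OF norm_ge_zero K(1)[of a]] ab by auto
  have Gd: "(G has_vector_derivative g x) (at x within {a..b})" if "x \<in> {a..b}" for x
    unfolding G_def by (rule integral_has_vector_derivative[OF gc that])
  have Gc: "continuous_on {a..b} G"
    using Gd by (intro continuous_on_vector_derivative)
  have I: "((\<lambda>x. G x * A' x + g x * A x) has_integral (G b * A b - G a * A a)) {a..b}"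
    by (rule fundamental_theorem_of_calculus[OF ab]) (intro has_vector_derivative_mult Gd A)
  have i1: "(\<lambda>x. G x * A' x) integrable_on {a..b}" and i2: "(\<lambda>x. g x * A x) integrable_on {a..b}"
    by (intro integrable_continuous_interval continuous_intros Gc A'c gc Ac)+
  have "G a = 0" by (simp add: G_def)
  then have "integral {a..b} (\<lambda>x. g x * A x) = G b * A b - integral {a..b} (\<lambda>x. G x * A' x)"
    using integral_add[OF i1 i2] I by (simp add: has_integral_iff eq_diff_eq add.commute)
  also have "norm \<dots> \<le> norm (G b * A b) + norm (integral {a..b} (\<lambda>x. G x * A' x))"
    by (rule norm_triangle_ineq4)
  also have "\<dots> \<le> B * K + B * K * (b - a)"
  proof (rule add_mono)
    show "norm (G b * A b) \<le> B * K"
      using B[of b] K(1)[of b] ab B0 by (auto simp: norm_mult G_def intro!: mult_mono)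
    show "norm (integral {a..b} (\<lambda>x. G x * A' x)) \<le> B * K * (b - a)"
      using B K ab B0 by (intro integral_bound continuous_intros Gc A'c)
        (auto simp: norm_mult G_def intro!: mult_mono)
  qed
  finally show ?thesis by (simp add: algebra_simps)
qed

text \<open>
  Uniformity in the linear part \<open>N * x\<close> of the phase is what makes the final bound independent of
  the lattice site.
\<close>

lemma van_der_Corput_linear_phase:
  fixes e e1 e2 e3 :: "real \<Rightarrow> real" and A A' :: "real \<Rightarrow> complex"
  assumes ab: "a \<le> b" "b - a \<le> 1" and c: "c > 0"
    and e1: "\<And>x. x \<in> {a..b} \<Longrightarrow> (e has_real_derivative e1 x) (at x within {a..b})"
    and e2: "\<And>x. x \<in> {a..b} \<Longrightarrow> (e1 has_real_derivative e2 x) (at x within {a..b})"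
    and e3: "\<And>x. x \<in> {a..b} \<Longrightarrow> (e2 has_real_derivative e3 x) (at x within {a..b})"
    and nd: "(\<forall>x\<in>{a..b}. \<bar>e2 x\<bar> \<ge> c) \<or> (\<forall>x\<in>{a..b}. e3 x \<ge> c) \<or> (\<forall>x\<in>{a..b}. e3 x \<le> - c)"
    and A: "\<And>x. x \<in> {a..b} \<Longrightarrow> (A has_vector_derivative A' x) (at x within {a..b})"
    and A'c: "continuous_on {a..b} A'"
    and K: "\<And>x. x \<in> {a..b} \<Longrightarrow> norm (A x) \<le> K" "\<And>x. x \<in> {a..b} \<Longrightarrow> norm (A' x) \<le> K"
    and t: "\<bar>t\<bar> \<ge> 1"
  shows "norm (integral {a..b} (\<lambda>x. cis (N * x - t * e x) * A x))
    \<le> 2 * K * (10 / sqrt c + 22 * c powr (-1/3)) * \<bar>t\<bar> powr (-1/3)"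
proof -
  define B where "B = (10 / sqrt c + 22 * c powr (-1/3)) * \<bar>t\<bar> powr (-1/3)"
  have B0: "B \<ge> 0" using c by (simp add: B_def)
  have K0: "K \<ge> 0" using order_trans[OF norm_ge_zero K(1)[of a]] ab by auto
  have ec: "continuous_on {a..b} e" "continuous_on {a..b} e2"
    using DERIV_continuous_on[OF e1] DERIV_continuous_on[OF e3] by auto
  \<comment> \<open>\<open>N\<close> drops out once the phase is differentiated twice; the first
    derivative \<open>N - t * e1 x\<close> may vanish anywhere and is never bounded from
    below.\<close>
  have part: "norm (integral {a..y} (\<lambda>x. cis (N * x - t * e x))) \<le> B" if y: "y \<in> {a..b}" for y
  proof -
    have sub: "{a..y} \<subseteq> {a..b}" using y by auto
    note s = has_field_derivative_subset[OF _ sub]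
    have d1: "((\<lambda>x. N * x - t * e x) has_real_derivative N - t * e1 x) (at x within {a..y})"
      and d2: "((\<lambda>x. N - t * e1 x) has_real_derivative - t * e2 x) (at x within {a..y})"
      and d3: "((\<lambda>x. - t * e2 x) has_real_derivative - t * e3 x) (at x within {a..y})"
      if "x \<in> {a..y}" for x
      using that sub by (auto intro!: derivative_eq_intros s[OF e1] s[OF e2] s[OF e3])
    from nd show ?thesis
    proof
      assume *: "\<forall>x\<in>{a..b}. \<bar>e2 x\<bar> \<ge> c"
      have "norm (integral {a..y} (\<lambda>x. cis (N * x - t * e x))) \<le> 10 / sqrt (\<bar>t\<bar> * c)"
        by (rule norm_integral_cis_second_abs[OF _ _ d1 d2])
          (use y c t * in \<open>auto intro!: continuous_intros continuous_on_subset[OF ec(2)] mult_left_mono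
              simp: abs_mult\<close>)
      also have "\<dots> = 10 / sqrt c * \<bar>t\<bar> powr (-1/2)"
        using t by (simp add: real_sqrt_mult powr_minus_divide powr_half_sqrt)
      \<comment> \<open>For \<open>\<bar>t\<bar> \<ge> 1\<close> the better exponent
        \<open>-1/2\<close> may be weakened to \<open>-1/3\<close>, the one common to all
        alternatives.\<close>
      also have "\<dots> \<le> 10 / sqrt c * \<bar>t\<bar> powr (-1/3)"
        using t c by (intro mult_left_mono powr_mono) auto
      also have "\<dots> \<le> B"
        unfolding B_def by (intro mult_right_mono) auto
      finally show ?thesis .
    next
      assume *: "(\<forall>x\<in>{a..b}. e3 x \<ge> c) \<or> (\<forall>x\<in>{a..b}. e3 x \<le> - c)"
      have sg: "(\<forall>x\<in>{a..y}. - t * e3 x \<ge> \<bar>t\<bar> * c) \<or> (\<forall>x\<in>{a..y}. - t * e3 x \<le> - (\<bar>t\<bar> * c))"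
      proof (cases "(t > 0) = (\<forall>x\<in>{a..b}. e3 x \<ge> c)")
        case True
        then have "t * e3 x \<ge> \<bar>t\<bar> * c" if "x \<in> {a..y}" for x
          using * sub that mult_left_mono[of c "e3 x" t] mult_left_mono_neg[of "e3 x" "-c" t]
          by (cases "t > 0") auto
        then show ?thesis by auto
      next
        case False
        then have "- t * e3 x \<ge> \<bar>t\<bar> * c" if "x \<in> {a..y}" for x
          using * sub that mult_left_mono[of "e3 x" "-c" t] mult_left_mono_neg[of c "e3 x" t]
          by (cases "t > 0") auto
        then show ?thesis by auto
      qed
      have "norm (integral {a..y} (\<lambda>x. cis (N * x - t * e x))) \<le> 22 * (\<bar>t\<bar> * c) powr (-1/3)"
        by (rule norm_integral_cis_third_abs[OF _ _ d1 d2 d3 sg]) (use y c t in auto)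
      also have "\<dots> = 22 * c powr (-1/3) * \<bar>t\<bar> powr (-1/3)"
        using t c by (simp add: powr_mult)
      also have "\<dots> \<le> B"
        unfolding B_def using c by (intro mult_right_mono) auto
      finally show ?thesis .
    qed
  qed
  have "norm (integral {a..b} (\<lambda>x. cis (N * x - t * e x) * A x)) \<le> B * K * (1 + (b - a))"
    by (rule norm_integral_amplitude[OF ab(1) _ A A'c K part]) (auto intro!: continuous_intros ec)
  also have "\<dots> \<le> B * K * 2"
    using ab B0 K0 by (intro mult_left_mono) auto
  also have "\<dots> = 2 * K * (10 / sqrt c + 22 * c powr (-1/3)) * \<bar>t\<bar> powr (-1/3)"
    unfolding B_def by (simp only: mult_ac)
  finally show ?thesis .
qed

section \<open>Nondegeneracy of the bands\<close>

text \<open>Read backwards: where \<open>cos z\<close> is large, so is \<open>Im z\<close>. With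
  \<open>D = 2 * cos T\<close> the growth of a polynomial becomes growth of
  \<open>Im T\<close>.\<close>

lemma cmod_cos_le_exp_Im:
  assumes "Im z \<ge> 0"
  shows "cmod (cos z) \<le> exp (Im z)"
proof -
  have "cmod (cos z) = cmod (exp (\<i> * z) + exp (- (\<i> * z))) / 2"
    by (simp add: cos_exp_eq norm_divide)
  also have "\<dots> \<le> (exp (- Im z) + exp (Im z)) / 2"
    using norm_triangle_ineq[of "exp (\<i> * z)" "exp (- (\<i> * z))"] by simp
  also have "exp (- Im z) \<le> exp (Im z)" using assms by simp
  finally show ?thesis by simp
qed

lemma cos_real_of_Im_0:
  assumes "Im z = 0"
  shows "cos z \<in> \<real>" "\<bar>Re (cos z)\<bar> \<le> 1"
proof -
  have "z = of_real (Re z)" using assms by (simp add: complex_eq_iff)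
  then have "cos z = of_real (cos (Re z))"
    by (metis cos_of_real)
  then show "cos z \<in> \<real>" "\<bar>Re (cos z)\<bar> \<le> 1" by auto
qed

text \<open>As \<open>\<omega>\<close> runs through the open upper half plane, the argument of
  \<open>\<omega> ^ k\<close> sweeps an open interval of length \<open>k * pi \<ge> 2 * pi\<close>,
  hence every direction except possibly the positive real one.\<close>

lemma exists_direction_Im_neg:
  fixes b :: complex
  assumes "b \<noteq> 0" "k \<ge> 2"
  obtains \<omega> where "Im \<omega> > 0" "Im (\<omega> ^ k * b) < 0"
proof -
  note witness = that
  have dir: thesis if "0 < y" "y < pi * k" "Im (cis y * b) < 0" for y
  proof (rule witness)
    have "0 < y / k" "y / k < pi"
      using that assms by (auto simp: field_simps)
    then show "Im (cis (y / k)) > 0" by (simp add: sin_gt_zero)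
    have "cis (y / k) ^ k = cis y"
      using assms by (simp add: Complex.DeMoivre)
    then show "Im (cis (y / k) ^ k * b) < 0" using that by simp
  qed
  have k: "pi * 2 \<le> pi * k" using assms by (intro mult_left_mono) auto
  consider "Re b > 0" | "Re b < 0" | "Re b = 0" "Im b > 0" | "Re b = 0" "Im b < 0"
    using assms by (metis complex_eq_iff linorder_neqE_linordered_idom zero_complex.simps)
  then show thesis
  proof cases
    case 1
    show ?thesis
    proof (rule dir[of "3 * pi / 2"])
      have "cis (3 * pi / 2) = - \<i>"
        using cis_mult[of pi "pi / 2"] by (simp add: field_simps)
      then show "Im (cis (3 * pi / 2) * b) < 0" using 1 by simp
      show "3 * pi / 2 < pi * k" using k pi_gt_zero by linarith
    qed auto
  next
    case 2
    show ?thesis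
    proof (rule dir[of "pi / 2"])
      show "Im (cis (pi / 2) * b) < 0" using 2 by simp
      show "pi / 2 < pi * k" using k pi_gt_zero by linarith
    qed auto
  next
    case 3
    show ?thesis
    proof (rule dir[of pi])
      show "Im (cis pi * b) < 0" using 3 by simp
      show "pi < pi * k" using k pi_gt_zero by linarith
    qed auto
  next
    case 4
    show ?thesis
    \<comment> \<open>The angle 0 would be natural here but belongs to a real
      \<open>\<omega>\<close>; a small positive rotation keeps the sign.\<close>
    proof (rule dir[of "pi / 4"])
      show "Im (cis (pi / 4) * b) < 0" using 4 by (simp add: cos_45 mult_pos_neg)
      show "pi / 4 < pi * k" using k pi_gt_zero by linarith
    qed auto
  qed
qed

text \<open>Along the ray from \<open>x\<close> in direction \<open>\<omega>\<close> the expression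
  is \<open>r ^ k\<close> times a quantity tending to \<open>\<omega> ^ k * g x\<close>, and some
  \<open>\<omega>\<close> in the upper half plane makes the imaginary part of this limit
  negative.\<close>

lemma no_high_order_contact:
  fixes x :: complex and g :: "complex \<Rightarrow> complex"
  assumes \<rho>: "\<rho> > 0" and x: "Im x = 0" and gc: "continuous_on (ball x \<rho>) g" and g: "g x \<noteq> 0" and k: "k \<ge> 2"
    and pos: "\<And>z. Im z > 0 \<Longrightarrow> z \<in> ball x \<rho> \<Longrightarrow> Im ((z - x) ^ k * g z) \<ge> 0"
  shows False
proof -
  obtain \<omega> where \<omega>: "Im \<omega> > 0" "Im (\<omega> ^ k * g x) < 0"
    using exists_direction_Im_neg[OF g k] by blast
  have cont: "isCont g x"
    using gc \<rho> by (simp add: continuous_on_eq_continuous_at)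
  have lim: "((\<lambda>r::real. x + of_real r * \<omega>) \<longlongrightarrow> x) (at_right 0)"
    by (auto intro!: tendsto_eq_intros)
  have "((\<lambda>r::real. Im (\<omega> ^ k * g (x + of_real r * \<omega>))) \<longlongrightarrow> Im (\<omega> ^ k * g x)) (at_right 0)"
    by (intro tendsto_intros isCont_tendsto_compose[OF cont lim])
  moreover have "eventually (\<lambda>r::real. Im (\<omega> ^ k * g (x + of_real r * \<omega>)) \<ge> 0) (at_right 0)"
  proof -
    have "eventually (\<lambda>r. x + of_real r * \<omega> \<in> ball x \<rho>) (at_right (0::real))"
      by (rule topological_tendstoD[OF lim]) (use \<rho> in auto)
    moreover have "eventually (\<lambda>r::real. r > 0) (at_right 0)"
      by (simp add: eventually_at_right_less)
    ultimately show ?thesis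
    proof eventually_elim
      case (elim r)
      have "Im ((of_real r * \<omega>) ^ k * g (x + of_real r * \<omega>)) \<ge> 0"
        using pos[of "x + of_real r * \<omega>"] elim \<omega> x by simp
      then have "r ^ k * Im (\<omega> ^ k * g (x + of_real r * \<omega>)) \<ge> 0"
        by (simp add: power_mult_distrib mult.assoc flip: of_real_power)
      moreover have "r ^ k > 0" using elim by simp
      ultimately show ?case by (metis zero_le_mult_iff not_less)
    qed
  qed
  ultimately have "Im (\<omega> ^ k * g x) \<ge> 0"
    by (rule tendsto_lowerbound) auto
  then show False using \<omega> by simp
qed

text \<open>
  The contradiction behind the nondegeneracy of the bands: near \<open>x\<close> the function
  \<open>1 / (d * (z - x)) - 1 / (T z - \<theta>)\<close> vanishes to second order, but its imaginary part is
  non-negative on the whole upper half plane, which is impossible for a map that opens angles by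
  a factor of at least two. Only interior values are used, so no boundary regularity of \<open>T\<close> is
  needed.
\<close>

lemma upper_half_minimum_principle:
  fixes T :: "complex \<Rightarrow> complex" and x d \<theta> :: real
  assumes T: "T holomorphic_on {z. Im z > 0}" and Tpos: "\<And>z. Im z > 0 \<Longrightarrow> Im (T z) > 0"
    and grow: "\<And>M. \<exists>R. \<forall>z. Im z > 0 \<longrightarrow> norm z \<ge> R \<longrightarrow> Im (T z) \<ge> M"
    and d: "d \<noteq> 0" and \<rho>: "\<rho> > 0" and B: "B holomorphic_on ball (of_real x) \<rho>"
    and GB: "\<And>z. Im z > 0 \<Longrightarrow> z \<in> ball (of_real x) \<rho> \<Longrightarrow>
      1 / (of_real d * (z - of_real x)) - 1 / (T z - of_real \<theta>) = (z - of_real x)\<^sup>2 * B z"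
    and z0: "Im z0 > 0"
  shows "Im (1 / (of_real d * (z0 - of_real x)) - 1 / (T z0 - of_real \<theta>)) \<ge> 0"
proof (rule field_le_epsilon)
  fix \<eta> :: real assume \<eta>: "\<eta> > 0"
  let ?x = "complex_of_real x"
  define G where "G = (\<lambda>z. 1 / (of_real d * (z - ?x)) - 1 / (T z - of_real \<theta>))"
  have nz: "T z - of_real \<theta> \<noteq> 0" "z - ?x \<noteq> 0" if "Im z > 0" for z
    using Tpos[OF that] that by (auto simp: complex_eq_iff)
  have GH: "G holomorphic_on {z. Im z > 0}"
    unfolding G_def using nz d by (intro holomorphic_intros T) auto
  obtain M where M: "M > 0" "\<And>z. z \<in> cball ?x (\<rho>/2) \<Longrightarrow> norm (B z) \<le> M"
  proof -
    have "compact (B ` cball ?x (\<rho>/2))"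
      using \<rho> by (intro compact_continuous_image holomorphic_on_imp_continuous_on
          holomorphic_on_subset[OF B]) auto
    then obtain M where "M > 0" "\<forall>y\<in>B ` cball ?x (\<rho>/2). norm y \<le> M"
      using bounded_pos[THEN iffD1, OF compact_imp_bounded] by blast
    then show thesis using that by blast
  qed
  \<comment> \<open>Radius of the half disc cut out around \<open>x\<close>: on its boundary the
    norm of \<open>G\<close> is at most \<open>M * r^2 \<le> \<eta>\<close> by second-order
    vanishing, and \<open>z0\<close> stays outside.\<close>
  define r where "r = min (min (\<rho>/2) (norm (z0 - ?x) / 2)) (sqrt (\<eta> / M))"
  have r: "r > 0" "r \<le> \<rho>/2" "r < norm (z0 - ?x)" "M * r\<^sup>2 \<le> \<eta>"
  proof -
    have "norm (z0 - ?x) > 0" using nz[OF z0] by simp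
    then show "r > 0" "r \<le> \<rho>/2" "r < norm (z0 - ?x)"
      using \<rho> \<eta> M by (auto simp: r_def min_less_iff_disj)
    then have "r\<^sup>2 \<le> (sqrt (\<eta> / M))\<^sup>2"
      by (intro power_mono) (auto simp: r_def)
    also have "\<dots> = \<eta> / M" using \<eta> M by simp
    finally show "M * r\<^sup>2 \<le> \<eta>" using M by (simp add: field_simps)
  qed
  obtain R0 where R0: "\<And>z. Im z > 0 \<Longrightarrow> norm z \<ge> R0 \<Longrightarrow> Im (T z) \<ge> 2 / \<eta>"
    using grow by blast
  \<comment> \<open>On the outer arc both terms of \<open>G\<close> are at most
    \<open>\<eta> / 2\<close>: the first by the size of \<open>R\<close>, the second because
    \<open>Im (T z) \<ge> 2 / \<eta>\<close> there.\<close>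
  define R where "R = Max {\<bar>R0\<bar> + \<bar>x\<bar>, norm (z0 - ?x) + 1, 2 / (\<bar>d\<bar> * \<eta>)}"
  have "R \<ge> \<bar>R0\<bar> + \<bar>x\<bar>" "R \<ge> norm (z0 - ?x) + 1" and R2: "R \<ge> 2 / (\<bar>d\<bar> * \<eta>)"
    by (auto simp: R_def)
  then have R: "R \<ge> \<bar>R0\<bar> + \<bar>x\<bar>" "R > norm (z0 - ?x)" "R > 0"
    using norm_ge_zero[of "z0 - ?x"] by linarith+
  \<comment> \<open>Height of the lower edge. There \<open>1 / (T z - \<theta>)\<close> lies in the
    lower half plane and has the favourable sign; the other term contributes at least
    \<open>- \<epsilon> / (\<bar>d\<bar> * r^2)\<close> outside the small disc, whatever the sign of
    \<open>d\<close>.\<close>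
  define \<epsilon> where "\<epsilon> = min (Im z0 / 2) (\<eta> * \<bar>d\<bar> * r\<^sup>2)"
  have \<epsilon>: "\<epsilon> > 0" "\<epsilon> < Im z0" "\<epsilon> / (\<bar>d\<bar> * r\<^sup>2) \<le> \<eta>"
  proof -
    have dr: "\<bar>d\<bar> * r\<^sup>2 > 0" using d r by simp
    then show "\<epsilon> > 0" "\<epsilon> < Im z0" using z0 \<eta> by (auto simp: \<epsilon>_def mult.assoc)
    have "\<epsilon> \<le> \<eta> * (\<bar>d\<bar> * r\<^sup>2)" by (simp add: \<epsilon>_def mult.assoc)
    then show "\<epsilon> / (\<bar>d\<bar> * r\<^sup>2) \<le> \<eta>" using dr by (simp add: pos_divide_le_eq)
  qed
  define S where "S = {z. Im z \<ge> \<epsilon>} \<inter> cball ?x R - ball ?x r"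
  have clS: "closed S"
    unfolding S_def by (intro closed_Diff closed_Int closed_halfspace_Im_ge) auto
  have S_sub: "S \<subseteq> {z. Im z > 0}" using \<epsilon> by (auto simp: S_def)
  \<comment> \<open>The real part of \<open>\<i> * G\<close> is \<open>- Im G\<close>, so the lower
    bound is a maximum principle on the truncated half plane.\<close>
  have "Re (\<i> * G z0) \<le> \<eta>"
  proof (rule maximum_real_frontier[where f = "\<lambda>z. \<i> * G z" and S = S])
    show "(\<lambda>z. \<i> * G z) holomorphic_on interior S"
      using S_sub interior_subset by (intro holomorphic_intros holomorphic_on_subset[OF GH]) blast
    show "continuous_on (closure S) (\<lambda>z. \<i> * G z)"
      using clS S_sub
      by (intro continuous_on_mult_left holomorphic_on_imp_continuous_on holomorphic_on_subset[OF GH]) simp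
    show "bounded S" by (rule bounded_subset[OF bounded_cball[of ?x R]]) (auto simp: S_def)
    show "z0 \<in> S" using r R \<epsilon> by (auto simp: S_def dist_norm norm_minus_commute)
    fix z assume z: "z \<in> frontier S"
    have "{z. Im z > \<epsilon>} \<inter> ball ?x R - cball ?x r \<subseteq> interior S"
      by (rule interior_maximal)
        (auto simp: S_def intro!: open_Diff open_Int open_halfspace_Im_gt)
    moreover have "z \<notin> interior S" and zS: "z \<in> S"
      using z clS by (auto simp: frontier_def)
    ultimately have "\<not> (Im z > \<epsilon> \<and> norm (z - ?x) < R \<and> norm (z - ?x) > r)"
      by (auto simp: dist_norm norm_minus_commute)
    moreover have zle: "Im z \<ge> \<epsilon>" "norm (z - ?x) \<le> R" and zr: "norm (z - ?x) \<ge> r"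
      using zS by (auto simp: S_def dist_norm norm_minus_commute)
    ultimately have zS2: "Im z = \<epsilon> \<or> norm (z - ?x) = R \<or> norm (z - ?x) = r"
      by linarith
    have Imz: "Im z > 0"
      using zle \<epsilon> by linarith
    from zS2 have "- Im (G z) \<le> \<eta>"
    proof (elim disjE)
      assume "norm (z - ?x) = r"
      then have zb: "z \<in> cball ?x (\<rho>/2)" "z \<in> ball ?x \<rho>"
        using r \<rho> by (auto simp: dist_norm norm_minus_commute)
      have "norm (G z) = r\<^sup>2 * norm (B z)"
        using GB[OF Imz zb(2)] \<open>norm (z - ?x) = r\<close> by (simp add: G_def norm_mult norm_power)
      also have "\<dots> \<le> r\<^sup>2 * M"
        using M(2)[OF zb(1)] by (intro mult_left_mono) auto
      finally show ?thesis
        using r abs_Im_le_cmod[of "G z"] by (simp add: mult.commute)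
    next
      assume zR: "norm (z - ?x) = R"
      have "norm z \<ge> R0"
        using zR R norm_triangle_ineq4[of z ?x] by simp
      then have "Im (T z) \<ge> 2 / \<eta>" using R0 Imz by blast
      then have "norm (T z - of_real \<theta>) \<ge> 2 / \<eta>"
        using abs_Im_le_cmod[of "T z - of_real \<theta>"] by simp
      moreover have "2 / \<eta> > 0" using \<eta> by simp
      ultimately have "1 / norm (T z - of_real \<theta>) \<le> 1 / (2 / \<eta>)"
        by (intro divide_left_mono mult_pos_pos) auto
      then have 1: "norm (1 / (T z - of_real \<theta>)) \<le> \<eta> / 2" by (simp add: norm_divide)
      have 2: "norm (1 / (of_real d * (z - ?x))) \<le> \<eta> / 2"
      proof -
        have "2 / \<eta> \<le> \<bar>d\<bar> * R"
          using mult_left_mono[OF R2, of "\<bar>d\<bar>"] d by simp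
        then have "1 / (\<bar>d\<bar> * R) \<le> 1 / (2 / \<eta>)"
          using \<eta> R d by (intro divide_left_mono mult_pos_pos) auto
        then show ?thesis using zR by (simp add: norm_divide norm_mult)
      qed
      have "norm (G z) \<le> \<eta>"
        using norm_triangle_ineq4[of "1 / (of_real d * (z - ?x))" "1 / (T z - of_real \<theta>)"] 1 2
        by (simp add: G_def)
      then show ?thesis using abs_Im_le_cmod[of "G z"] by linarith
    next
      assume zi: "Im z = \<epsilon>"
      have "Im (1 / (T z - of_real \<theta>)) \<le> 0"
        using Tpos[OF Imz] by (simp add: Im_divide divide_le_0_iff)
      moreover have "- Im (1 / (of_real d * (z - ?x))) \<le> \<eta>"
      proof -
        have "Im (inverse (z - ?x)) = - \<epsilon> / (norm (z - ?x))\<^sup>2"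
          unfolding inverse_complex.simps cmod_power2 using zi by simp
        moreover have "1 / (of_real d * (z - ?x)) = of_real (1 / d) * inverse (z - ?x)"
          by (simp add: divide_inverse)
        ultimately have "Im (1 / (of_real d * (z - ?x))) = (1 / d) * (- \<epsilon> / (norm (z - ?x))\<^sup>2)"
          by (simp only: Im_complex_of_real Re_complex_of_real times_complex.simps mult_zero_left add_0_right)
        then have "- Im (1 / (of_real d * (z - ?x))) = (\<epsilon> / (norm (z - ?x))\<^sup>2) * (1 / d)"
          by simp
        also have "\<dots> \<le> (\<epsilon> / (norm (z - ?x))\<^sup>2) * (1 / \<bar>d\<bar>)"
          using \<epsilon> by (intro mult_left_mono) (auto simp: abs_if)
        also have "\<dots> = \<epsilon> / (\<bar>d\<bar> * (norm (z - ?x))\<^sup>2)"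
          by simp
        also have "\<dots> \<le> \<epsilon> / (\<bar>d\<bar> * r\<^sup>2)"
          using zr r d \<epsilon> by (intro divide_left_mono mult_left_mono power_mono mult_pos_pos) auto
        also have "\<dots> \<le> \<eta>" by (rule \<epsilon>)
        finally show ?thesis .
      qed
      ultimately show ?thesis by (simp only: G_def minus_complex.simps, linarith?)
    qed
    then show "Re (\<i> * G z) \<le> \<eta>" by simp
  qed
  then have "0 \<le> Im (G z0) + \<eta>" by simp
  then show "0 \<le> Im (1 / (of_real d * (z0 - of_real x)) - 1 / (T z0 - of_real \<theta>)) + \<eta>"
    by (simp only: G_def)
qed

text \<open>By the minimum principle \<open>Im G \<ge> 0\<close> on the half plane. If
  \<open>B\<close> is not identically zero near \<open>x\<close>, then \<open>G\<close> vanishes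
  there to a finite order of at least two and opens angles too far; otherwise \<open>G\<close>
  vanishes throughout, \<open>T\<close> is affine, and its imaginary part stays constant along
  horizontal lines, against \<open>grow\<close>.\<close>

lemma upper_half_no_contact:
  fixes T :: "complex \<Rightarrow> complex" and x d \<theta> :: real
  assumes T: "T holomorphic_on {z. Im z > 0}" and Tpos: "\<And>z. Im z > 0 \<Longrightarrow> Im (T z) > 0"
    and grow: "\<And>M. \<exists>R. \<forall>z. Im z > 0 \<longrightarrow> norm z \<ge> R \<longrightarrow> Im (T z) \<ge> M"
    and d: "d \<noteq> 0" and \<rho>: "\<rho> > 0" and B: "B holomorphic_on ball (of_real x) \<rho>"
    and GB: "\<And>z. Im z > 0 \<Longrightarrow> z \<in> ball (of_real x) \<rho> \<Longrightarrow>
      1 / (of_real d * (z - of_real x)) - 1 / (T z - of_real \<theta>) = (z - of_real x)\<^sup>2 * B z"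
  shows False
proof -
  let ?x = "complex_of_real x"
  define G where "G = (\<lambda>z. 1 / (of_real d * (z - ?x)) - 1 / (T z - of_real \<theta>))"
  have pos: "Im (G z) \<ge> 0" if "Im z > 0" for z
    unfolding G_def by (rule upper_half_minimum_principle[OF assms that])
  have nz: "T z - of_real \<theta> \<noteq> 0" "z - ?x \<noteq> 0" if "Im z > 0" for z
    using Tpos[OF that] that by (auto simp: complex_eq_iff)
  have GH: "G holomorphic_on {z. Im z > 0}"
    unfolding G_def using nz d by (intro holomorphic_intros T) auto
  consider "B ?x \<noteq> 0" | "B ?x = 0" "\<not> B constant_on ball ?x \<rho>" | "\<forall>z\<in>ball ?x \<rho>. B z = 0"
    using \<rho> unfolding constant_on_def by (metis centre_in_ball)
  then show False
  proof cases
    case 1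
    show False
      by (rule no_high_order_contact[OF \<rho> _ holomorphic_on_imp_continuous_on[OF B] 1, of 2])
        (use GB pos in \<open>simp_all add: G_def flip: GB\<close>)
  next
    case 2
    obtain g r n where n: "0 < n" "0 < r" "ball ?x r \<subseteq> ball ?x \<rho>" "g holomorphic_on ball ?x r"
      "\<And>w. w \<in> ball ?x r \<Longrightarrow> B w = (w - ?x) ^ n * g w" "\<And>w. w \<in> ball ?x r \<Longrightarrow> g w \<noteq> 0"
      by (rule holomorphic_factor_zero_nonconstant[OF B open_ball connected_ball _ 2])
        (use \<rho> in auto)
    show False
    proof (rule no_high_order_contact[OF n(2) _ holomorphic_on_imp_continuous_on[OF n(4)], of "n + 2"])
      fix z assume z: "Im z > 0" "z \<in> ball ?x r"
      then have "G z = (z - ?x)\<^sup>2 * ((z - ?x) ^ n * g z)"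
        using GB[of z] n(3) n(5)[of z] by (auto simp: G_def)
      also have "\<dots> = (z - ?x) ^ (n + 2) * g z"
        by (simp only: power_add mult_ac)
      finally show "Im ((z - ?x) ^ (n + 2) * g z) \<ge> 0"
        using pos[OF z(1)] by (simp only:)
    qed (use n in auto)
  next
    case 3
    have G0: "G z = 0" if z: "Im z > 0" for z
    proof (rule analytic_continuation_open[where f = G and g = "\<lambda>_. 0"
          and s = "{z. Im z > 0} \<inter> ball ?x \<rho>" and s' = "{z. Im z > 0}"])
      have "?x + of_real (\<rho>/2) * \<i> \<in> {z. Im z > 0} \<inter> ball ?x \<rho>"
        using \<rho> by (auto simp: dist_norm norm_mult)
      then show "{z. Im z > 0} \<inter> ball ?x \<rho> \<noteq> {}" by blast
      show "connected {z. Im z > 0}" by (simp add: convex_halfspace_Im_gt convex_connected)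
      show "G w = 0" if "w \<in> {z. Im z > 0} \<inter> ball ?x \<rho>" for w
        using GB[of w] that 3 by (auto simp: G_def)
    qed (use z GH in \<open>auto intro!: open_halfspace_Im_gt open_Int\<close>)
    have T_eq: "T z = of_real \<theta> + of_real d * (z - ?x)" if z: "Im z > 0" for z
      using G0[OF z] nz[OF z] d by (auto simp: G_def field_simps)
    obtain R where R: "\<And>z. Im z > 0 \<Longrightarrow> norm z \<ge> R \<Longrightarrow> Im (T z) \<ge> \<bar>d\<bar> + 1"
      using grow by blast
    define z where "z = of_real \<bar>R\<bar> + \<i>"
    have "norm z \<ge> R" "Im z > 0"
      using abs_Re_le_cmod[of z] by (auto simp: z_def)
    with R[of z] T_eq[of z] show False by (simp add: z_def)
  qed
qed

text \<open>\<open>cos f - cos g\<close> is a product of two sines, one of which vanishes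
  identically by the identity theorem; a continuous function with values in the multiples of
  \<open>2 * pi\<close> is constant. This compares an arccosine on the half plane with a local
  inverse of a band.\<close>

lemma cos_eq_on_connected:
  assumes U: "open U" "connected U" "U \<noteq> {}" and f: "f holomorphic_on U" and g: "g holomorphic_on U"
    and eq: "\<And>z. z \<in> U \<Longrightarrow> cos (f z) = cos (g z)"
  obtains s c :: real where "s = 1 \<or> s = -1" "\<And>z. z \<in> U \<Longrightarrow> f z = of_real s * g z + of_real c"
proof -
  have const: "\<exists>c::real. \<forall>z\<in>U. h z = of_real c"
    if h: "h holomorphic_on U" and h0: "\<And>z. z \<in> U \<Longrightarrow> sin (h z / 2) = 0" for h
  proof -
    have hi: "\<exists>n::int. h z = of_real (2 * of_int n * pi)" if "z \<in> U" for z
      using h0[OF that] unfolding sin_eq_0 by (auto simp: field_simps)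
    have "h constant_on U"
    proof (rule continuous_discrete_range_constant[OF U(2) holomorphic_on_imp_continuous_on[OF h]])
      fix z assume z: "z \<in> U"
      show "\<exists>e>0. \<forall>y. y \<in> U \<and> h y \<noteq> h z \<longrightarrow> e \<le> norm (h y - h z)"
      proof (intro exI[of _ 1] conjI allI impI)
        fix y assume y: "y \<in> U \<and> h y \<noteq> h z"
        obtain n m :: int where nm: "h z = of_real (2 * of_int n * pi)" "h y = of_real (2 * of_int m * pi)"
          using hi z y by blast
        have "h y - h z = of_real (2 * pi * of_int (m - n))"
          by (simp add: nm algebra_simps)
        then have "norm (h y - h z) = 2 * pi * \<bar>of_int (m - n)\<bar>"
          by (simp only: norm_of_real) (simp add: abs_mult)
        moreover have "m \<noteq> n" using y nm by auto
        then have "\<bar>of_int (m - n)\<bar> \<ge> (1::real)" by linarith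
        ultimately have "norm (h y - h z) \<ge> 2 * pi * 1"
          using mult_left_mono[of 1 "\<bar>of_int (m - n)\<bar>" "2 * pi"] by simp
        then show "1 \<le> norm (h y - h z)" using pi_gt3 by linarith
      qed auto
    qed
    then obtain c where c: "\<And>z. z \<in> U \<Longrightarrow> h z = c" by (auto simp: constant_on_def)
    obtain z0 where "z0 \<in> U" using U by blast
    with hi[of z0] c show ?thesis by metis
  qed
  have prod0: "sin ((f z - g z) / 2) * sin ((f z + g z) / 2) = 0" if "z \<in> U" for z
  proof -
    have "sin ((f z + g z) / 2) * sin ((g z - f z) / 2) = 0"
      using eq[OF that] cos_diff_cos[of "f z" "g z"] by simp
    moreover have "(g z - f z) / 2 = - ((f z - g z) / 2)" by (simp add: field_simps)
    ultimately show ?thesis by (auto simp only: sin_minus mult_eq_0_iff neg_equal_0_iff_equal)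
  qed
  show thesis
  proof (cases "\<forall>z\<in>U. sin ((f z - g z) / 2) = 0")
    case True
    then obtain c where "\<forall>z\<in>U. f z - g z = of_real c"
      using const[of "\<lambda>z. f z - g z"] f g by (auto intro: holomorphic_intros)
    then show thesis using that[of 1 c] by (auto simp: algebra_simps)
  next
    case False
    then obtain z0 where z0: "z0 \<in> U" "sin ((f z0 - g z0) / 2) \<noteq> 0" by blast
    have cont: "continuous_on U (\<lambda>z. sin ((f z - g z) / 2))"
      by (intro continuous_intros holomorphic_on_imp_continuous_on f g) auto
    \<comment> \<open>Where the first factor is nonzero the second vanishes, and a non-empty open
      set of zeros suffices.\<close>
    define W where "W = U \<inter> (\<lambda>z. sin ((f z - g z) / 2)) -` (- {0})"
    have W1: "open W"
      unfolding W_def by (rule continuous_open_preimage[OF cont U(1)]) auto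
    have W2: "W \<noteq> {}" "W \<subseteq> U"
      using z0 by (auto simp: W_def)
    have W3: "sin ((f w + g w) / 2) = 0" if "w \<in> W" for w
      using that prod0[of w] by (auto simp: W_def)
    have H: "(\<lambda>z. sin ((f z + g z) / 2)) holomorphic_on U"
      by (intro holomorphic_intros f g) auto
    have "sin ((f z + g z) / 2) = 0" if "z \<in> U" for z
      by (rule analytic_continuation_open[OF W1 U(1) W2(1) U(2) W2(2) H holomorphic_on_const W3 that])
    then obtain c where "\<forall>z\<in>U. f z + g z = of_real c"
      using const[of "\<lambda>z. f z + g z"] f g by (auto intro: holomorphic_intros)
    then show thesis using that[of "-1" c] by (auto simp: algebra_simps)
  qed
qed


text \<open>With the linear part subtracted, the first derivative surviving at \<open>a\<close> has
  order at least four; if none survives, the remainder is zero and \<open>g = 0\<close>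
  serves.\<close>

lemma holomorphic_cubic_flat_factor:
  assumes f: "f holomorphic_on ball a r" and r: "r > 0"
    and 2: "(deriv ^^ 2) f a = 0" and 3: "(deriv ^^ 3) f a = 0"
  obtains g \<rho> where "0 < \<rho>" "\<rho> \<le> r" "g holomorphic_on ball a \<rho>"
    "\<And>w. w \<in> ball a \<rho> \<Longrightarrow> f w = f a + deriv f a * (w - a) + (w - a) ^ 4 * g w"
proof -
  define F where "F = (\<lambda>w. f w - deriv f a * w)"
  have F: "F holomorphic_on ball a r"
    unfolding F_def by (intro holomorphic_intros f)
  have dF: "(deriv ^^ n) F a = (deriv ^^ n) f a - (if n = 0 then deriv f a * a else if n = 1 then deriv f a else 0)" for n
    unfolding F_def by (subst higher_deriv_diff[OF f _ open_ball]) (use r in \<open>auto intro!: holomorphic_intros\<close>)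
  have small: "(deriv ^^ n) F a = 0" if "0 < n" "n < 4" for n
  proof -
    have "n = 1 \<or> n = 2 \<or> n = 3" using that by auto
    then show ?thesis using 2 3 by (auto simp: dF)
  qed
  show thesis
  proof (cases "\<forall>n>0. (deriv ^^ n) F a = 0")
    case True
    have "F w = F a" if "w \<in> ball a r" for w
      using holomorphic_fun_eq_const_on_connected[OF F open_ball connected_ball, of a w] True that r by auto
    then show thesis
      using r by (intro that[of r "\<lambda>_. 0"]) (auto simp: F_def algebra_simps)
  next
    case False
    define n where "n = (LEAST n. n > 0 \<and> (deriv ^^ n) F a \<noteq> 0)"
    have n: "n > 0" "(deriv ^^ n) F a \<noteq> 0"
      using False LeastI_ex[of "\<lambda>n. n > 0 \<and> (deriv ^^ n) F a \<noteq> 0"] by (auto simp: n_def)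
    have below: "(deriv ^^ i) F a = 0" if "0 < i" "i < n" for i
      using not_less_Least[of i "\<lambda>n. n > 0 \<and> (deriv ^^ n) F a \<noteq> 0"] that by (auto simp: n_def)
    have n4: "n \<ge> 4" using small n by (meson not_less)
    obtain g \<rho> where g: "0 < \<rho>" "g holomorphic_on ball a \<rho>"
      "\<And>w. w \<in> ball a \<rho> \<Longrightarrow> F w - F a = (w - a) ^ n * g w"
      by (rule holomorphic_factor_order_of_zero[OF F open_ball _ n below]) (use r in auto)
    show thesis
    proof (rule that[of "min \<rho> r" "\<lambda>w. (w - a) ^ (n - 4) * g w"])
      show "(\<lambda>w. (w - a) ^ (n - 4) * g w) holomorphic_on ball a (min \<rho> r)"
        by (intro holomorphic_intros holomorphic_on_subset[OF g(2)]) auto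
      fix w assume "w \<in> ball a (min \<rho> r)"
      then have "F w - F a = (w - a) ^ (4 + (n - 4)) * g w"
        using g(3)[of w] n4 by simp
      then show "f w = f a + deriv f a * (w - a) + (w - a) ^ 4 * ((w - a) ^ (n - 4) * g w)"
        unfolding power_add by (simp add: F_def algebra_simps)
    qed (use g r in auto)
  qed
qed

text \<open>Difference quotients along the real axis are real, and the reals are closed. Applied
  repeatedly, this makes every derivative of a band real on the axis.\<close>

lemma deriv_real_of_real_valued:
  assumes E: "(E has_field_derivative s) (at (of_real \<theta>))"
    and real: "\<And>u::real. \<bar>u - \<theta>\<bar> < r \<Longrightarrow> E (of_real u) \<in> \<real>" and r: "r > 0"
  shows "s \<in> (\<real> :: complex set)"
proof -
  have "((\<lambda>h. (E (of_real \<theta> + h) - E (of_real \<theta>)) / h) \<longlongrightarrow> s) (at 0)"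
    using E unfolding DERIV_def .
  moreover have "filterlim (\<lambda>h::real. complex_of_real h) (at 0) (at_right 0)"
    by (rule filterlim_atI) (auto intro!: tendsto_eq_intros simp: eventually_at_filter)
  ultimately have lim: "((\<lambda>h::real. (E (of_real \<theta> + of_real h) - E (of_real \<theta>)) / of_real h) \<longlongrightarrow> s) (at_right 0)"
    by (rule filterlim_compose)
  have "eventually (\<lambda>h::real. h \<in> {0<..<r}) (at_right 0)"
    using r by (rule eventually_at_right_real)
  then have "eventually (\<lambda>h::real. (E (of_real \<theta> + of_real h) - E (of_real \<theta>)) / of_real h \<in> \<real>) (at_right 0)"
  proof eventually_elim
    case (elim h)
    then show ?case
      using real[of "\<theta> + h"] real[of \<theta>] by (auto intro!: Reals_divide Reals_diff)
  qed
  then show ?thesis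
    by (rule Lim_in_closed_set[OF closed_complex_Reals _ _ lim]) auto
qed

text \<open>\<open>T\<close>, an arccosine of \<open>D / 2\<close> on the upper half plane, and
  \<open>g\<close>, the local inverse of \<open>E\<close> at \<open>x\<close>, both solve
  \<open>D = 2 * cos\<close>; they agree up to sign and a real constant. With
  \<open>q = g z - \<theta>\<close>, flatness reads \<open>z - x = s * q + q ^ 4 * k (g z)\<close>.
  The difference of reciprocals is thus a holomorphic multiple of
  \<open>q ^ 4 / ((z - x) * q)\<close>, which vanishes to second order at \<open>x\<close>.\<close>

lemma band_nondegenerate:
  fixes D :: "complex poly" and E :: "complex \<Rightarrow> complex" and \<theta> :: real
  assumes deg: "degree D \<ge> 1"
    and real: "\<And>z. poly D z \<in> \<real> \<Longrightarrow> \<bar>Re (poly D z)\<bar> \<le> 2 \<Longrightarrow> z \<in> \<real>"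
    and an: "E analytic_on {of_real \<theta>}"
    and ev: "eventually (\<lambda>z. poly D (E z) = 2 * cos z) (nhds (of_real \<theta>))"
  shows "(deriv ^^ 2) E (of_real \<theta>) \<noteq> 0 \<or> (deriv ^^ 3) E (of_real \<theta>) \<noteq> 0"
proof (rule ccontr)
  let ?a = "complex_of_real \<theta>"
  assume "\<not> ?thesis"
  then have E2: "(deriv ^^ 2) E ?a = 0" and E3: "(deriv ^^ 3) E ?a = 0" by auto
  obtain r1 where r1: "r1 > 0" "E holomorphic_on ball ?a r1"
      "\<And>z. z \<in> ball ?a r1 \<Longrightarrow> poly D (E z) = 2 * cos z"
  proof -
    obtain ra where ra: "ra > 0" "E holomorphic_on ball ?a ra"
      using an by (auto simp: analytic_on_def)
    obtain rb where rb: "rb > 0" "\<And>z. dist z ?a < rb \<Longrightarrow> poly D (E z) = 2 * cos z"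
      using ev by (auto simp: eventually_nhds_metric)
    show thesis
      by (rule that[of "min ra rb"]) (use ra rb in \<open>auto simp: dist_commute intro: holomorphic_on_subset\<close>)
  qed
  define s where "s = deriv E ?a"
  have Ed: "(E has_field_derivative deriv E z) (at z)" if "z \<in> ball ?a r1" for z
    by (rule holomorphic_derivI[OF r1(2) open_ball that])
  have d1: "poly (pderiv D) (E z) * deriv E z = - 2 * sin z" if z: "z \<in> ball ?a r1" for z
  proof -
    have "((\<lambda>z. poly D (E z)) has_field_derivative poly (pderiv D) (E z) * deriv E z) (at z)"
      by (rule DERIV_chain2[OF poly_DERIV Ed[OF z]])
    moreover have "((\<lambda>z. 2 * cos z) has_field_derivative - 2 * sin z) (at z)"
      by (auto intro!: derivative_eq_intros)
    then have "((\<lambda>z. poly D (E z)) has_field_derivative - 2 * sin z) (at z)"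
      by (rule has_field_derivative_transform_within_open[OF _ open_ball z]) (use r1 in simp)
    ultimately show ?thesis by (rule DERIV_unique)
  qed
  have a: "?a \<in> ball ?a r1" using r1 by simp
  \<comment> \<open>At a band edge the slope may vanish, but then the second derivative does not:
    differentiating \<open>D E = 2 * cos\<close> twice with \<open>E' = E'' = 0\<close> would give
    \<open>cos \<theta> = 0\<close> besides \<open>sin \<theta> = 0\<close>.\<close>
  have s0: "s \<noteq> 0"
  proof
    assume s: "s = 0"
    have sin0: "sin ?a = 0" using d1[OF a] s by (simp add: s_def)
    have "(deriv E has_field_derivative deriv (deriv E) ?a) (at ?a)"
      by (rule holomorphic_derivI[OF holomorphic_deriv[OF r1(2) open_ball] open_ball a])
    then have Edd: "(deriv E has_field_derivative 0) (at ?a)"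
      using E2 by (simp add: numeral_2_eq_2)
    have "((\<lambda>z. poly (pderiv D) (E z) * deriv E z) has_field_derivative 0) (at ?a)"
      using DERIV_mult[OF DERIV_chain2[OF poly_DERIV Ed[OF a]] Edd] s by (simp add: s_def)
    moreover have "((\<lambda>z. - 2 * sin z) has_field_derivative - 2 * cos ?a) (at ?a)"
      by (auto intro!: derivative_eq_intros)
    then have "((\<lambda>z. poly (pderiv D) (E z) * deriv E z) has_field_derivative - 2 * cos ?a) (at ?a)"
      by (rule has_field_derivative_transform_within_open[OF _ open_ball a]) (use d1 in simp)
    ultimately have "cos ?a = 0" using DERIV_unique by fastforce
    with sin0 show False using sin_cos_squared_add[of ?a] by simp
  qed
  have Ereal: "E (of_real u) \<in> \<real>" if u: "\<bar>u - \<theta>\<bar> < r1" for u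
  proof (rule real)
    have "of_real u \<in> ball ?a r1"
      using u by (simp add: dist_norm norm_minus_commute flip: of_real_diff)
    then have "poly D (E (of_real u)) = of_real (2 * cos u)"
      using r1(3) by (simp add: cos_of_real)
    then show "poly D (E (of_real u)) \<in> \<real>" "\<bar>Re (poly D (E (of_real u)))\<bar> \<le> 2"
      by (auto simp: abs_mult)
  qed
  have "s \<in> \<real>" unfolding s_def
    by (rule deriv_real_of_real_valued[OF Ed[OF a] Ereal r1(1)])
  then obtain \<sigma> where \<sigma>: "s = of_real \<sigma>" "\<sigma> \<noteq> 0" using s0 by (auto elim!: Reals_cases)
  obtain x where x: "E ?a = of_real x" using Ereal[of \<theta>] r1 by (auto elim!: Reals_cases)
  obtain k r2 where r2: "0 < r2" "r2 \<le> r1" "k holomorphic_on ball ?a r2"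
    "\<And>w. w \<in> ball ?a r2 \<Longrightarrow> E w = of_real x + s * (w - ?a) + (w - ?a) ^ 4 * k w"
    using holomorphic_cubic_flat_factor[OF r1(2,1) E2 E3] unfolding s_def x by metis
  have hE2: "E holomorphic_on ball ?a r2"
    using r2 by (intro holomorphic_on_subset[OF r1(2)]) auto
  obtain r3 where r3: "r3 > 0" "ball ?a r3 \<subseteq> ball ?a r2" "open (E ` ball ?a r3)" "inj_on E (ball ?a r3)"
    by (rule has_complex_derivative_locally_invertible[OF hE2 _ open_ball]) (use r2 s0 in \<open>auto simp: s_def\<close>)
  have hE3: "E holomorphic_on ball ?a r3" by (rule holomorphic_on_subset[OF hE2 r3(2)])
  obtain g where g: "g holomorphic_on E ` ball ?a r3" "\<And>z. z \<in> ball ?a r3 \<Longrightarrow> g (E z) = z"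
    by (rule holomorphic_has_inverse[OF hE3 open_ball r3(4)]) blast
  have "of_real x \<in> E ` ball ?a r3" using r3 x[symmetric] by auto
  then obtain \<rho> where \<rho>: "\<rho> > 0" "ball (of_real x) \<rho> \<subseteq> E ` ball ?a r3"
    using r3(3) open_contains_ball by blast
  have gE: "g z \<in> ball ?a r2" "g z \<in> ball ?a r1" "E (g z) = z" if z: "z \<in> ball (of_real x) \<rho>" for z
  proof -
    obtain w where "w \<in> ball ?a r3" "z = E w" using \<rho>(2) z by blast
    then show "g z \<in> ball ?a r2" "g z \<in> ball ?a r1" "E (g z) = z" using g(2) r3(2) r2(2) by auto
  qed
  have gh: "g holomorphic_on ball (of_real x) \<rho>" by (rule holomorphic_on_subset[OF g(1) \<rho>(2)])
  have gx: "g (of_real x) = ?a"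
    using g(2)[of ?a] r3(1) unfolding x by simp
  obtain T0 where T0: "T0 holomorphic_on {z. Im z > 0}" "\<And>z. Im z > 0 \<Longrightarrow> poly D z / 2 = cos (T0 z)"
  proof (rule contractible_imp_holomorphic_arccos[of "\<lambda>z. poly D z / 2" "{z. Im z > 0}"])
    show "(\<lambda>z. poly D z / 2) holomorphic_on {z. Im z > 0}"
      by (intro holomorphic_intros) auto
    show "contractible {z. Im z > 0}"
      by (intro convex_imp_contractible convex_halfspace_Im_gt)
    show "poly D z / 2 \<noteq> 1 \<and> poly D z / 2 \<noteq> - 1" if "z \<in> {z. Im z > 0}" for z
    proof (rule ccontr)
      assume "\<not> ?thesis"
      then have "poly D z = 2 \<or> poly D z = -2" by (auto simp: field_simps)
      then have "z \<in> \<real>" using real[of z] by auto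
      then show False using that by (auto simp: complex_is_Real_iff)
    qed
  qed auto
  have Im0: "Im (T0 z) \<noteq> 0" if z: "Im z > 0" for z
  proof
    assume "Im (T0 z) = 0"
    from cos_real_of_Im_0[OF this] T0(2)[OF z]
    have "poly D z / 2 \<in> \<real>" "\<bar>Re (poly D z / 2)\<bar> \<le> 1" by simp_all
    then have "z \<in> \<real>" using real[of z] Reals_mult[of "poly D z / 2" 2] by simp
    then show False using z by (auto simp: complex_is_Real_iff)
  qed
  \<comment> \<open>\<open>Im T0\<close> has no zeros, hence one sign; as cosine is even,
    \<open>- T0\<close> may replace \<open>T0\<close>.\<close>
  obtain T where T: "T holomorphic_on {z. Im z > 0}" "\<And>z. Im z > 0 \<Longrightarrow> poly D z = 2 * cos (T z)"
     "\<And>z. Im z > 0 \<Longrightarrow> Im (T z) > 0"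
  proof -
    have conn: "connected ((\<lambda>z. Im (T0 z)) ` {z. Im z > 0})"
      by (intro connected_continuous_image continuous_intros holomorphic_on_imp_continuous_on T0
          convex_connected convex_halfspace_Im_gt)
    have "(\<forall>z. Im z > 0 \<longrightarrow> Im (T0 z) > 0) \<or> (\<forall>z. Im z > 0 \<longrightarrow> Im (T0 z) < 0)"
    proof (rule ccontr)
      assume "\<not> ?thesis"
      then obtain u v where uv: "Im u > 0" "Im v > 0" "Im (T0 u) < 0" "Im (T0 v) > 0"
        using Im0 by (meson linorder_neqE_linordered_idom)
      then have "0 \<in> (\<lambda>z. Im (T0 z)) ` {z. Im z > 0}"
        using conn[unfolded connected_iff_interval, rule_format, of "Im (T0 u)" "Im (T0 v)" 0] by auto
      then show False using Im0 by auto
    qed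
    then show thesis
    proof
      assume "\<forall>z. Im z > 0 \<longrightarrow> Im (T0 z) > 0"
      then show thesis using that[of T0] T0 by (auto simp: field_simps)
    next
      assume "\<forall>z. Im z > 0 \<longrightarrow> Im (T0 z) < 0"
      then show thesis using that[of "\<lambda>z. - T0 z"] T0 by (auto simp: field_simps intro!: holomorphic_intros)
    qed
  qed
  define U where "U = {z. Im z > 0} \<inter> ball (complex_of_real x) \<rho>"
  have "of_real x + of_real (\<rho>/2) * \<i> \<in> U"
    using \<rho> by (auto simp: dist_norm norm_mult U_def)
  then have "U \<noteq> {}" by blast
  moreover have "open U" "connected U"
    by (auto simp: U_def intro!: open_Int open_halfspace_Im_gt convex_connected convex_Int convex_halfspace_Im_gt)
  moreover have "T holomorphic_on U" "g holomorphic_on U"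
    by (auto simp: U_def intro: holomorphic_on_subset[OF T(1)] holomorphic_on_subset[OF gh])
  moreover have "cos (T z) = cos (g z)" if "z \<in> U" for z
    using that T(2)[of z] r1(3)[of "g z"] gE[of z] by (auto simp: U_def)
  ultimately obtain \<kappa> c :: real where \<kappa>: "\<kappa> = 1 \<or> \<kappa> = -1"
    and Tg: "\<And>z. z \<in> U \<Longrightarrow> T z = of_real \<kappa> * g z + of_real c"
    using cos_eq_on_connected[of U T g] by metis
  \<comment> \<open>Difference quotient of \<open>g\<close> extended over \<open>x\<close>: it makes
    \<open>q / (z - x)\<close> a holomorphic factor.\<close>
  define Q where "Q = (\<lambda>z. if z = of_real x then deriv g (of_real x) else (g z - g (of_real x)) / (z - of_real x))"
  have Q: "Q holomorphic_on ball (of_real x) \<rho>"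
    unfolding Q_def by (rule pole_lemma_open[OF gh open_ball])
  show False
  proof (rule upper_half_no_contact[OF T(1,3)])
    show "\<exists>R. \<forall>z. Im z > 0 \<longrightarrow> norm z \<ge> R \<longrightarrow> Im (T z) \<ge> M" for M
    proof -
      obtain a0 q where Dq: "D = pCons a0 q" by (cases D)
      have "q \<noteq> 0" using deg Dq by auto
      then obtain R where R: "\<And>z. R \<le> norm z \<Longrightarrow> 2 * exp M \<le> norm (poly D z)"
        using poly_infinity[of q "2 * exp M" a0] Dq by blast
      have "Im (T z) \<ge> M" if "Im z > 0" "norm z \<ge> R" for z
      proof -
        have "2 * exp M \<le> norm (2 * cos (T z))" using R[OF that(2)] T(2)[OF that(1)] by simp
        also have "\<dots> \<le> 2 * exp (Im (T z))"
          using cmod_cos_le_exp_Im[of "T z"] T(3)[OF that(1)] by (simp add: norm_mult)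
        finally show ?thesis by simp
      qed
      then show ?thesis by blast
    qed
    show "\<kappa> / \<sigma> \<noteq> 0" using \<kappa> \<sigma> by auto
    show "\<rho> > 0" by fact
    show "(\<lambda>z. - of_real \<kappa> * Q z ^ 3 * k (g z)) holomorphic_on ball (of_real x) \<rho>"
    proof -
      have "(k \<circ> g) holomorphic_on ball (of_real x) \<rho>"
        by (rule holomorphic_on_compose_gen[OF gh r2(3)]) (use gE in auto)
      then show ?thesis using Q by (auto intro!: holomorphic_intros simp: o_def)
    qed
    fix z assume z: "Im z > 0" "z \<in> ball (of_real x) \<rho>"
    define q where "q = g z - ?a"
    have zx: "z - of_real x \<noteq> 0" using z by (auto simp: complex_eq_iff)
    have "z = of_real x + s * q + q ^ 4 * k (g z)"
      using r2(4)[OF gE(1)[OF z(2)]] unfolding gE(3)[OF z(2)] q_def .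
    then have zq: "z - of_real x = s * q + q ^ 4 * k (g z)"
      by (metis add.assoc add_diff_cancel_left')
    have q0: "q \<noteq> 0" using zx zq by auto
    have Qz: "Q z = q / (z - of_real x)" using zx by (auto simp: Q_def q_def gx)
    have Tz: "T z - of_real (\<kappa> * \<theta> + c) = of_real \<kappa> * q"
      using Tg[of z] z by (simp add: U_def q_def algebra_simps)
    have k1: "1 / (of_real \<kappa> * w) = of_real \<kappa> / w" for w :: complex
      using \<kappa> by auto
    have "1 / (of_real (\<kappa> / \<sigma>) * (z - of_real x)) - 1 / (T z - of_real (\<kappa> * \<theta> + c))
        = of_real \<kappa> * (s / (z - of_real x) - 1 / q)"
    proof -
      have k2: "1 / (of_real (\<kappa> / \<sigma>) * w) = of_real \<kappa> * (s / w)" for w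
        using \<kappa> \<sigma> by auto
      show ?thesis unfolding Tz k1 k2 by (subst right_diff_distrib) simp
    qed
    also have "\<dots> = of_real \<kappa> * ((s * q - (z - of_real x)) / ((z - of_real x) * q))"
      using zx q0 by (simp add: field_simps)
    also have "s * q - (z - of_real x) = - (q ^ 4 * k (g z))"
      using zq by simp
    also have "- (q ^ 4 * k (g z)) / ((z - of_real x) * q) = (z - of_real x)\<^sup>2 * (- ((q / (z - of_real x)) ^ 3 * k (g z)))"
      using zx q0 by (simp add: power_divide eval_nat_numeral)
    also have "of_real \<kappa> * \<dots> = (z - of_real x)\<^sup>2 * (- of_real \<kappa> * Q z ^ 3 * k (g z))"
      unfolding Qz by simp
    finally show "1 / (of_real (\<kappa> / \<sigma>) * (z - of_real x)) - 1 / (T z - of_real (\<kappa> * \<theta> + c))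
      = (z - of_real x)\<^sup>2 * (- of_real \<kappa> * Q z ^ 3 * k (g z))" .
  qed
qed

section \<open>Bloch solutions and the discriminant\<close>

text \<open>Lagrange interpolation of \<open>q\<close> at the roots of \<open>Q\<close>, read off in
  the top possible degree. As \<open>card Z\<close> equals the degree, all roots are simple, and
  \<open>P (Z - {x})\<close> takes the value of \<open>pderiv Q\<close> at \<open>x\<close>.\<close>

lemma sum_Lagrange_coeff:
  fixes Q q :: "'a::field poly"
  assumes Z: "finite Z" "card Z = degree Q" and roots: "\<And>x. x \<in> Z \<Longrightarrow> poly Q x = 0"
    and monic: "lead_coeff Q = 1" and q: "degree q < degree Q"
  shows "(\<Sum>x\<in>Z. poly q x / poly (pderiv Q) x) = coeff q (degree Q - 1)"
proof -
  define P where "P = (\<lambda>A. \<Prod>y\<in>A. [:- y, 1::'a:])"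
  have degP: "degree (P A) = card A" and lcP: "coeff (P A) (card A) = 1" for A
  proof -
    show d: "degree (P A) = card A"
      unfolding P_def by (subst degree_prod_eq_sum_degree) auto
    show "coeff (P A) (card A) = 1"
      using lead_coeff_prod[of "\<lambda>y. [:- y, 1::'a:]" A] d by (simp add: P_def)
  qed
  have polyP: "poly (P A) x = (\<Prod>y\<in>A. x - y)" for A x
    by (simp add: P_def poly_prod)
  have QP: "Q = P Z"
    by (rule poly_eqI_degree_lead_coeff[where A = Z and n = "card Z"])
      (use Z roots monic degP lcP[of Z, unfolded Z(2)] polyP in auto)
  have dQ: "poly (pderiv Q) x = (\<Prod>y\<in>Z - {x}. x - y)" if x: "x \<in> Z" for x
  proof -
    have "Q = [:- x, 1:] * P (Z - {x})"
      using Z x by (simp add: QP P_def prod.remove)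
    then have "poly (pderiv Q) x = poly (P (Z - {x})) x"
      by (simp add: pderiv_diff pderiv_smult pderiv_pCons)
    then show ?thesis by (simp add: polyP)
  qed
  have dQ0: "poly (pderiv Q) x \<noteq> 0" if x: "x \<in> Z" for x
    using Z by (auto simp: dQ[OF x])
  define L where "L = (\<Sum>x\<in>Z. smult (poly q x / poly (pderiv Q) x) (P (Z - {x})))"
  have cZ: "card (Z - {x}) = card Z - 1" if "x \<in> Z" for x
    using Z that by simp
  have "q = L"
  proof (rule poly_eqI_degree[where A = Z])
    fix x assume x: "x \<in> Z"
    have "poly L x = (\<Sum>y\<in>Z. poly q y / poly (pderiv Q) y * (\<Prod>u\<in>Z - {y}. x - u))"
      by (simp add: L_def poly_sum polyP)
    also have "\<dots> = (\<Sum>y\<in>{x}. poly q y / poly (pderiv Q) y * (\<Prod>u\<in>Z - {y}. x - u))"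
      using Z x by (intro sum.mono_neutral_right) (auto intro!: prod_zero bexI[of _ x])
    also have "\<dots> = poly q x"
      using dQ[OF x] dQ0[OF x] by simp
    finally show "poly q x = poly L x" ..
  next
    have "degree L \<le> card Z - 1"
      unfolding L_def
      by (rule degree_sum_le[OF Z(1)]) (use degP cZ in \<open>auto intro: order_trans[OF degree_smult_le]\<close>)
    then show "degree L < card Z" using Z q by auto
  qed (use q Z in auto)
  then have "coeff q (card Z - 1) = coeff L (card Z - 1)" by simp
  also have "\<dots> = (\<Sum>x\<in>Z. poly q x / poly (pderiv Q) x)"
    unfolding L_def coeff_sum coeff_smult
    by (intro sum.cong refl) (metis cZ lcP mult.right_neutral)
  finally show ?thesis using Z by simp
qed

text \<open>The Dirichlet solution as a polynomial in the energy: for \<open>k \<ge> 1\<close>, the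
  characteristic polynomial of the operator truncated to the sites \<open>1..k-1\<close>.\<close>

fun recurrence_poly :: "(nat \<Rightarrow> real) \<Rightarrow> nat \<Rightarrow> complex poly" where
  "recurrence_poly v 0 = 0"
| "recurrence_poly v (Suc 0) = 1"
| "recurrence_poly v (Suc (Suc k)) =
    [:- of_real (v (Suc k)), 1:] * recurrence_poly v (Suc k) - recurrence_poly v k"

lemma recurrence_poly_degree: "degree (recurrence_poly v k) \<le> k - 1"
proof (induction v k rule: recurrence_poly.induct)
  case (3 v k)
  have "degree ([:- of_real (v (Suc k)), 1:] * recurrence_poly v (Suc k)) \<le> Suc k"
    using degree_mult_le[of "[:- of_real (v (Suc k)), 1:]" "recurrence_poly v (Suc k)"] 3 by simp
  then show ?case
    using 3 by (auto intro!: degree_diff_le)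
qed auto

lemma recurrence_poly_lead: "coeff (recurrence_poly v (Suc k)) k = 1"
proof (induction k)
  case (Suc k)
  have "coeff (recurrence_poly v (Suc k)) (Suc k) = 0" "coeff (recurrence_poly v k) (Suc k) = 0"
    by (rule coeff_eq_0, use recurrence_poly_degree[of v "Suc k"] recurrence_poly_degree[of v k] in linarith)+
  then show ?case using Suc by simp
qed simp

lemma recurrence_poly_real: "poly (recurrence_poly v k) (of_real x) \<in> \<real>"
  by (induction v k rule: recurrence_poly.induct) (auto intro!: Reals_diff Reals_mult Reals_add)

text \<open>The operator on arbitrary sequences: Bloch solutions and combs are in general not
  square-summable, so the fibres cannot be treated inside \<open>ell2\<close>.\<close>

definition hop :: "(int \<Rightarrow> real) \<Rightarrow> (int \<Rightarrow> complex) \<Rightarrow> int \<Rightarrow> complex"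
  where "hop V f n = f (n - 1) + f (n + 1) + of_real (V n) * f n"

text \<open>The potential terms cancel because \<open>V\<close> is real, and the hopping terms
  telescope to a difference of Wronskians at the two ends.\<close>

lemma hop_Green_identity:
  "(\<Sum>i<m. cnj (f (a + int i)) * hop V g (a + int i) - cnj (hop V f (a + int i)) * g (a + int i))
    = (cnj (f a) * g (a - 1) - cnj (f (a - 1)) * g a)
      - (cnj (f (a + int m)) * g (a + int m - 1) - cnj (f (a + int m - 1)) * g (a + int m))"
  by (induction m) (simp_all add: hop_def algebra_simps)

lemma sum_cmod_sq_eq_0:
  assumes "finite A" "(\<Sum>i\<in>A. cnj (f i) * f i) = 0" "i \<in> A"
  shows "f i = (0::complex)"
proof -
  have "of_real (\<Sum>i\<in>A. (cmod (f i))\<^sup>2) = (0 :: complex)"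
    unfolding of_real_sum complex_norm_square using assms(2) by (simp add: mult.commute)
  then have "(\<Sum>i\<in>A. (cmod (f i))\<^sup>2) = 0" by (simp only: of_real_eq_0_iff)
  then have "(cmod (f i))\<^sup>2 = 0"
    using assms by (subst (asm) sum_nonneg_eq_0_iff) auto
  then show ?thesis by simp
qed

lemma hop_sum: "hop V (\<lambda>n. \<Sum>x\<in>A. f x n) = (\<lambda>n. \<Sum>x\<in>A. hop V (f x) n)"
  by (auto simp: hop_def sum.distrib sum_distrib_left)

lemma hop_cmult: "hop V (\<lambda>n. c * f n) = (\<lambda>n. c * hop V f n)"
  by (auto simp: hop_def algebra_simps)

text \<open>A period \<open>p \<ge> 2\<close> is obtained by doubling; it makes the Dirichlet block
  \<open>1..p-1\<close> non-empty.\<close>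

locale periodic_chain =
  fixes V :: "int \<Rightarrow> real" and p :: nat
  assumes p2: "p \<ge> 2" and per: "V (n + int p) = V n"
begin

lemma per_mult: "V (n + N * int p) = V n"
proof -
  have nat: "V (n + int k * int p) = V n" for n k
  proof (induction k)
    case (Suc k)
    show ?case using per[of "n + int k * int p"] Suc by (simp add: algebra_simps)
  qed simp
  show ?thesis
  proof (cases "N \<ge> 0")
    case True
    then show ?thesis using nat[of n "nat N"] by simp
  next
    case False
    then show ?thesis using nat[of "n + N * int p" "nat (- N)"] by simp
  qed
qed

definition lsol :: "nat \<Rightarrow> complex poly"
  where "lsol k = recurrence_poly (\<lambda>j. V (int j)) k"

text \<open>\<open>lsol\<close> vanishes at 0 and \<open>rsol\<close> vanishes at \<open>p\<close>; the latter is obtained by running the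
  recurrence backwards, hence the reversed potential.\<close>

definition rsol :: "nat \<Rightarrow> complex poly"
  where "rsol k = recurrence_poly (\<lambda>j. V (int (p - j))) (p - k)"

lemma lsol_0 [simp]: "lsol 0 = 0" and lsol_1 [simp]: "lsol (Suc 0) = 1"
  by (simp_all add: lsol_def)

lemma lsol_Suc: "0 < k \<Longrightarrow> lsol (Suc k) = [:- of_real (V (int k)), 1:] * lsol k - lsol (k - 1)"
  by (cases k) (simp_all add: lsol_def)

lemma rsol_p [simp]: "rsol p = 0" and rsol_p1 [simp]: "rsol (p - Suc 0) = 1"
  using p2 by (simp_all add: rsol_def)

lemma rsol_pred:
  assumes "0 < k" "k < p"
  shows "rsol (k - 1) = [:- of_real (V (int k)), 1:] * rsol k - rsol (Suc k)"
proof -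
  define m where "m = p - Suc k"
  have e: "p - (k - 1) = Suc (Suc m)" "p - k = Suc m" "p - Suc k = m" "p - Suc m = k"
    using assms by (auto simp: m_def)
  show ?thesis unfolding rsol_def e recurrence_poly.simps by (simp only: e)
qed

text \<open>The Wronskian of two solutions is constant. Its value at \<open>k = 0\<close> is
  \<open>rsol 0\<close>, that at \<open>k = p - 1\<close> is \<open>lsol p\<close>.\<close>

lemma rsol_lsol_Wronskian: "k < p \<Longrightarrow> rsol k * lsol (Suc k) - rsol (Suc k) * lsol k = rsol 0"
proof (induction k)
  case (Suc k)
  have "rsol k = [:- of_real (V (int (Suc k))), 1:] * rsol (Suc k) - rsol (Suc (Suc k))"
    using rsol_pred[of "Suc k"] Suc.prems by simp
  moreover have "lsol (Suc (Suc k)) = [:- of_real (V (int (Suc k))), 1:] * lsol (Suc k) - lsol k"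
    using lsol_Suc[of "Suc k"] by simp
  moreover have "rsol k * lsol (Suc k) - rsol (Suc k) * lsol k = rsol 0"
    using Suc by simp
  ultimately show ?case by algebra
qed simp

lemma rsol_0: "rsol 0 = lsol p"
  using rsol_lsol_Wronskian[of "p - 1"] p2 by simp

text \<open>Trace of the monodromy matrix. Since \<open>V p = V 0\<close>, the first and last terms
  make up \<open>lsol (p + 1)\<close>; so this is the characteristic polynomial on
  \<open>1..p\<close> minus that on \<open>2..p-1\<close>.\<close>

definition discr :: "complex poly"
  where "discr = [:- of_real (V 0), 1:] * lsol p - rsol 1 - lsol (p - 1)"

lemma lsol_degree: "degree (lsol k) \<le> k - 1" "coeff (lsol (Suc k)) k = 1"
  using recurrence_poly_degree recurrence_poly_lead by (auto simp: lsol_def)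

lemma rsol_degree: "degree (rsol k) \<le> p - k - 1"
  using recurrence_poly_degree[of _ "p - k"] by (simp add: rsol_def)

lemma discr_degree: "degree discr = p" "lead_coeff discr = 1"
proof -
  have c: "coeff discr p = 1"
  proof -
    have "coeff ([:a, 1:] * q) p = a * coeff q p + coeff q (p - 1)" for a and q :: "complex poly"
      using p2 by (cases p) auto
    moreover have "coeff (lsol p) (p - 1) = 1" using lsol_degree(2)[of "p - 1"] p2 by simp
    moreover have "coeff (lsol p) p = 0" "coeff (rsol 1) p = 0" "coeff (lsol (p - 1)) p = 0"
      by (rule coeff_eq_0, use lsol_degree(1)[of p] rsol_degree[of 1] lsol_degree(1)[of "p - 1"] p2 in linarith)+
    ultimately show ?thesis by (simp only: discr_def coeff_diff) simp
  qed
  have "degree ([:- of_real (V 0), 1:] * lsol p) \<le> p"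
    using degree_mult_le[of "[:- of_real (V 0), 1:]" "lsol p"] lsol_degree(1)[of p] p2 by simp
  then have "degree discr \<le> p"
    unfolding discr_def using lsol_degree(1)[of "p - 1"] rsol_degree[of 1]
    by (intro degree_diff_le) auto
  then show "degree discr = p" using c by (intro antisym le_degree) auto
  with c show "lead_coeff discr = 1" by simp
qed

text \<open>For \<open>cmod w = 1\<close> this is a column of the adjugate of \<open>z - H\<close> on the fibre with Floquet
  multiplier \<open>w\<close>.\<close>

definition bloch :: "complex \<Rightarrow> int \<Rightarrow> complex poly"
  where "bloch w n = smult (w powi (n div int p))
    (rsol (nat (n mod int p)) + smult w (lsol (nat (n mod int p))))"

text \<open>The case \<open>k = p\<close> is included so that right neighbours stay within the
  formula of one cell; it agrees with the next cell because \<open>rsol 0 = lsol p\<close>.\<close>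

lemma bloch_eq:
  assumes "k \<le> p" "w \<noteq> 0"
  shows "bloch w (N * int p + int k) = smult (w powi N) (rsol k + smult w (lsol k))"
proof (cases "k = p")
  case True
  have "N * int p + int k = (N + 1) * int p" using True by (simp add: algebra_simps)
  then have "bloch w (N * int p + int k) = smult (w powi (N + 1)) (rsol 0)"
    using p2 by (simp add: bloch_def)
  then show ?thesis using True assms by (simp add: rsol_0 power_int_add_1)
next
  case False
  then have "(N * int p + int k) div int p = N" "(N * int p + int k) mod int p = int k"
    using assms p2 by auto
  then show ?thesis by (simp add: bloch_def)
qed

lemma int_decompose:
  obtains N k where "n = N * int p + int k" "k < p"
proof -
  have "n = (n div int p) * int p + int (nat (n mod int p))" "nat (n mod int p) < p"
    using p2 by (simp_all add: nat_less_iff)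
  then show thesis by (rule that)
qed

lemma bloch_shift: "w \<noteq> 0 \<Longrightarrow> bloch w (n + int p) = smult w (bloch w n)"
  using p2 by (simp add: bloch_def power_int_add_1 mult.commute)

text \<open>Dirac comb on the multiples of \<open>p\<close> with multiplier \<open>w\<close>: the
  fibre component of the delta sequence at 0, which is its average over the unit circle.\<close>

definition comb :: "complex \<Rightarrow> int \<Rightarrow> complex"
  where "comb w n = (if int p dvd n then w powi (n div int p) else 0)"

lemma comb_eq:
  assumes "k < p"
  shows "comb w (N * int p + int k) = (if k = 0 then w powi N else 0)"
proof -
  have "int p dvd N * int p + int k \<longleftrightarrow> p dvd k" by simp
  also have "\<dots> \<longleftrightarrow> k = 0" using assms nat_dvd_not_less by auto
  finally show ?thesis using assms p2 by (simp add: comb_def)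
qed

text \<open>One column of the identity \<open>(z - H) adj(z - H) = det(z - H)\<close> on the fibre.
  Being an identity of polynomials in \<open>z\<close>, it can also be differentiated at the roots
  of \<open>discr - w - 1/w\<close>.\<close>

lemma bloch_equation:
  assumes w: "w \<noteq> 0"
  shows "[:- of_real (V n), 1:] * bloch w n - bloch w (n - 1) - bloch w (n + 1)
    = smult (comb w n) (discr - [:w + inverse w:])"
proof -
  obtain N k where n: "n = N * int p + int k" "k < p" by (rule int_decompose)
  have b: "bloch w n = smult (w powi N) (rsol k + smult w (lsol k))"
    using bloch_eq[of k w N] w n by simp
  have b1: "bloch w (n + 1) = smult (w powi N) (rsol (Suc k) + smult w (lsol (Suc k)))"
    using bloch_eq[of "Suc k" w N] w n by (simp add: algebra_simps)
  have Vn: "V n = V (int k)" using per_mult[of "int k" N] n by (simp add: add.commute)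
  show ?thesis
  proof (cases "k = 0")
    case True
    have "n - 1 = (N - 1) * int p + int (p - 1)"
      using n True p2 by (simp add: algebra_simps of_nat_diff)
    then have "bloch w (n - 1) = smult (w powi (N - 1)) (rsol (p - 1) + smult w (lsol (p - 1)))"
      using bloch_eq[of "p - 1" w "N - 1"] w by simp
    also have "\<dots> = smult (w powi N) (smult (inverse w) 1 + lsol (p - 1))"
      using w by (simp add: power_int_diff smult_add_right field_simps)
    finally have b0: "bloch w (n - 1) = smult (w powi N) ([:inverse w:] + lsol (p - 1))"
      by simp
    have "comb w n = w powi N" using comb_eq[of k w N] n True by simp
    then show ?thesis
      unfolding b b0 b1 Vn discr_def using True
      by (simp add: rsol_0 algebra_simps smult_add_right smult_diff_right)
  next
    case False
    then obtain m where m: "k = Suc m" by (cases k) auto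
    have "n - 1 = N * int p + int m" using n m by simp
    then have b0: "bloch w (n - 1) = smult (w powi N) (rsol m + smult w (lsol m))"
      using bloch_eq[of m w N] w n m by simp
    have c: "comb w n = 0" using comb_eq[of k w N] n False by simp
    have r: "[:- of_real (V (int k)), 1:] * rsol k = rsol m + rsol (Suc k)"
      using rsol_pred[of k] m n by simp
    have l: "[:- of_real (V (int k)), 1:] * lsol k = lsol m + lsol (Suc k)"
      using lsol_Suc[of k] m n by simp
    have "[:- of_real (V (int k)), 1:] * smult (w powi N) (rsol k + smult w (lsol k))
      = smult (w powi N) ([:- of_real (V (int k)), 1:] * rsol k + smult w ([:- of_real (V (int k)), 1:] * lsol k))"
      by (simp only: mult_smult_right distrib_left)
    then show ?thesis
      unfolding b b0 b1 Vn c r l by (simp add: smult_add_right)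
  qed
qed

text \<open>Degree \<open>p - 1\<close> is reached exactly at the multiples of \<open>p\<close>, and
  its coefficient reproduces the comb; this is what Lagrange interpolation returns.\<close>

lemma bloch_degree:
  assumes w: "w \<noteq> 0"
  shows "degree (bloch w n) < p" "coeff (bloch w n) (p - 1) = comb w n"
proof -
  obtain N k where n: "n = N * int p + int k" "k < p" by (rule int_decompose)
  have b: "bloch w n = smult (w powi N) (rsol k + smult w (lsol k))"
    using bloch_eq[of k w N] w n by simp
  have "degree (rsol k + smult w (lsol k)) \<le> (if k = 0 then p - 1 else p - 2)"
  proof (rule degree_add_le)
    show "degree (rsol k) \<le> (if k = 0 then p - 1 else p - 2)"
      using rsol_degree[of k] by auto
    show "degree (smult w (lsol k)) \<le> (if k = 0 then p - 1 else p - 2)"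
      using lsol_degree(1)[of k] n degree_smult_le[of w "lsol k"] by auto
  qed
  then have d: "degree (bloch w n) \<le> (if k = 0 then p - 1 else p - 2)"
    unfolding b using degree_smult_le order_trans by blast
  then show "degree (bloch w n) < p" using p2 by (auto split: if_splits)
  show "coeff (bloch w n) (p - 1) = comb w n"
  proof (cases "k = 0")
    case True
    have "coeff (lsol p) (p - 1) = 1" using lsol_degree(2)[of "p - 1"] p2 by simp
    moreover have "comb w n = w powi N" using comb_eq[of k w N] n True by simp
    ultimately show ?thesis unfolding b using True by (simp add: rsol_0)
  next
    case False
    have c: "comb w n = 0" using comb_eq[of k w N] n False by simp
    have "coeff (bloch w n) (p - 1) = 0"
      by (rule coeff_eq_0) (use d False p2 in auto)
    then show ?thesis using c by simp
  qed
qed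

text \<open>The boundary Wronskians of Green's identity at \<open>0\<close> and at \<open>p\<close>
  differ by the factor \<open>cnj w * w = 1\<close>.\<close>

lemma bloch_self_adjoint:
  assumes w: "cmod w = 1" and f: "\<And>n. f (n + int p) = w * f n" and g: "\<And>n. g (n + int p) = w * g n"
  shows "(\<Sum>i<p. cnj (f (int i)) * hop V g (int i) - cnj (hop V f (int i)) * g (int i)) = 0"
proof -
  have w1: "cnj w * w = 1"
    using w complex_norm_square[of w] by (simp add: mult.commute)
  have e: "cnj (w * a) * (w * b) = cnj a * b" for a b
  proof -
    have "cnj (w * a) * (w * b) = (cnj w * w) * (cnj a * b)" by simp
    then show ?thesis unfolding w1 by simp
  qed
  have "(\<Sum>i<p. cnj (f (int i)) * hop V g (int i) - cnj (hop V f (int i)) * g (int i))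
    = (cnj (f 0) * g (- 1) - cnj (f (- 1)) * g 0)
      - (cnj (w * f 0) * (w * g (- 1)) - cnj (w * f (- 1)) * (w * g 0))"
    using hop_Green_identity[where a = 0 and m = p and f = f and g = g and V = V]
      f[of 0] g[of 0] f[of "-1"] g[of "-1"]
    by (simp del: complex_cnj_mult)
  then show ?thesis unfolding e by simp
qed

lemma hop_bloch:
  assumes w: "w \<noteq> 0" and z: "poly discr z = w + inverse w"
  shows "hop V (\<lambda>n. poly (bloch w n) z) n = z * poly (bloch w n) z"
  using arg_cong[OF bloch_equation[OF w, of n], of "\<lambda>q. poly q z"] z
  by (simp add: hop_def algebra_simps)

lemma hop_lsol:
  "n > 0 \<Longrightarrow> hop V (\<lambda>n. poly (lsol (nat n)) z) n = z * poly (lsol (nat n)) z"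
  using arg_cong[OF lsol_Suc[of "nat n"], of "\<lambda>q. poly q z"]
  by (simp add: hop_def nat_add_distrib nat_diff_distrib algebra_simps)

lemma hop_lsol_deriv:
  assumes "n > 0"
  shows "hop V (\<lambda>n. poly (pderiv (lsol (nat n))) z) n
    = z * poly (pderiv (lsol (nat n))) z + poly (lsol (nat n)) z"
  using arg_cong[OF lsol_Suc[of "nat n"], of "\<lambda>q. poly (pderiv q) z"] assms
  by (simp add: hop_def nat_add_distrib nat_diff_distrib algebra_simps pderiv_mult pderiv_diff
      pderiv_add pderiv_smult pderiv_pCons)

text \<open>Such a \<open>z\<close> is an eigenvalue of a self-adjoint fibre, with the Bloch
  sequence as eigenvector unless it vanishes. Its value at site 0 is that of \<open>lsol p\<close>;
  if this is zero, \<open>z\<close> is instead an eigenvalue of the Dirichlet block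
  \<open>1..p-1\<close>, with eigenvector \<open>lsol\<close>, which is 1 at site 1.\<close>

lemma discr_real_rooted:
  assumes "poly discr z \<in> \<real>" "\<bar>Re (poly discr z)\<bar> \<le> 2"
  shows "z \<in> \<real>"
proof -
  define \<theta> where "\<theta> = arccos (Re (poly discr z) / 2)"
  define w where "w = cis \<theta>"
  have w: "w \<noteq> 0" "cmod w = 1" by (simp_all add: w_def)
  have "cos \<theta> = Re (poly discr z) / 2"
    unfolding \<theta>_def using assms(2) by (intro cos_arccos) auto
  then have z: "poly discr z = w + inverse w"
    using assms(1) by (simp add: w_def complex_eq_iff complex_is_Real_iff)
  have key: "z = cnj z" if "(z - cnj z) * s = 0" "s \<noteq> 0" for s
    using that by auto
  have "z = cnj z"
  proof (cases "poly (lsol p) z = 0")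
    case False
    let ?f = "\<lambda>n. poly (bloch w n) z"
    have "?f 0 = poly (lsol p) z" using bloch_eq[of 0 w 0] w by (simp add: rsol_0)
    then have f0: "?f (int 0) \<noteq> 0" using False by simp
    have sh: "?f (n + int p) = w * ?f n" for n using bloch_shift[of w n] w by simp
    have "(z - cnj z) * (\<Sum>i<p. cnj (?f (int i)) * ?f (int i)) = 0"
      using bloch_self_adjoint[where f = ?f and g = ?f, OF w(2) sh sh] unfolding hop_bloch[OF w(1) z]
      by (simp add: sum_distrib_left algebra_simps)
    moreover have "(\<Sum>i<p. cnj (?f (int i)) * ?f (int i)) \<noteq> 0"
      using sum_cmod_sq_eq_0[of "{..<p}" "\<lambda>i. ?f (int i)" 0] f0 p2 by auto
    ultimately show ?thesis by (rule key)
  next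
    case True
    let ?g = "\<lambda>n. poly (lsol (nat n)) z"
    have h: "hop V ?g (1 + int i) = z * ?g (1 + int i)" for i
      by (rule hop_lsol) simp
    have "(z - cnj z) * (\<Sum>i<p-1. cnj (?g (1 + int i)) * ?g (1 + int i)) = 0"
      using hop_Green_identity[where a = 1 and m = "p - 1" and f = ?g and g = ?g and V = V] True p2
      unfolding h by (simp add: sum_distrib_left algebra_simps of_nat_diff)
    moreover have "(\<Sum>i<p-1. cnj (?g (1 + int i)) * ?g (1 + int i)) \<noteq> 0"
      using sum_cmod_sq_eq_0[of "{..<p-1}" "\<lambda>i. ?g (1 + int i)" 0] p2 by auto
    ultimately show ?thesis by (rule key)
  qed
  then show ?thesis by (metis Reals_cnj_iff)
qed

text \<open>A self-adjoint operator has no Jordan chains. The Bloch equation differentiated in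
  \<open>z\<close> gives \<open>(H - z) f' = f\<close> while \<open>(H - z) f = 0\<close>, whence
  \<open>f = 0\<close>. At a triple root the next derivative gives \<open>f' = 0\<close> in the same
  way; then \<open>lsol p\<close> has a double zero, which the Dirichlet block excludes by the same
  argument.\<close>

lemma discr_double_point:
  assumes z: "poly discr z = 2 * cos (of_real \<theta>)" and z': "poly (pderiv discr) z = 0"
  defines "w \<equiv> cis \<theta>"
  shows "poly (bloch w n) z = 0" "sin \<theta> = 0" "poly (pderiv (pderiv discr)) z \<noteq> 0"
proof -
  have w: "w \<noteq> 0" "cmod w = 1" by (simp_all add: w_def)
  have zw: "poly discr z = w + inverse w"
    using z unfolding cos_of_real by (simp add: w_def complex_eq_iff)
  have "z \<in> \<real>"
    by (rule discr_real_rooted) (use z in \<open>auto simp: abs_mult cos_of_real\<close>)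
  then obtain x where x: "z = of_real x" by (auto elim: Reals_cases)
  let ?f = "\<lambda>n. poly (bloch w n) z"
  let ?h = "\<lambda>n. poly (pderiv (bloch w n)) z"
  let ?k = "\<lambda>n. poly (pderiv (pderiv (bloch w n))) z"
  have shf: "?f (n + int p) = w * ?f n" for n using bloch_shift[of w n] w by simp
  have shh: "?h (n + int p) = w * ?h n" for n using bloch_shift[of w n] w by (simp add: pderiv_smult)
  have shk: "?k (n + int p) = w * ?k n" for n using bloch_shift[of w n] w by (simp add: pderiv_smult)
  have hf: "hop V ?f n = z * ?f n" for n by (rule hop_bloch[OF w(1) zw])
  have hh: "hop V ?h n = z * ?h n + ?f n" for n
    using arg_cong[OF bloch_equation[OF w(1), of n], of "\<lambda>q. poly (pderiv q) z"] z'
    by (simp add: hop_def algebra_simps pderiv_mult pderiv_diff pderiv_add pderiv_smult pderiv_pCons)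
  have cz: "cnj z = z" by (simp add: x)
  have f0: "?f (int i) = 0" if "i < p" for i
  proof -
    have "(\<Sum>i<p. cnj (?f (int i)) * ?f (int i)) = 0"
      using bloch_self_adjoint[where f = ?f and g = ?h, OF w(2) shf shh] unfolding hf hh
      by (simp add: cz algebra_simps)
    then show ?thesis using that sum_cmod_sq_eq_0[of "{..<p}" "\<lambda>i. ?f (int i)" i] by simp
  qed
  have per0: "F n = 0" if "\<And>i. i < p \<Longrightarrow> F (int i) = 0" "\<And>n. F (n + int p) = w * F n" for F :: "int \<Rightarrow> complex" and n
  proof -
    obtain N k where n: "n = N * int p + int k" "k < p" by (rule int_decompose)
    have nat: "F (m + int j * int p) = w ^ j * F m" for j m
    proof (induction j)
      case (Suc j)
      then show ?case using that(2)[of "m + int j * int p"] by (simp add: algebra_simps)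
    qed simp
    show ?thesis
    proof (cases "N \<ge> 0")
      case True
      then show ?thesis using nat[of "int k" "nat N"] that(1)[OF n(2)] n(1) by (simp add: add.commute)
    next
      case False
      then have "F (int k) = w ^ nat (- N) * F n"
        using nat[of n "nat (- N)"] n(1) by (simp add: algebra_simps)
      then show ?thesis using that(1)[OF n(2)] w by simp
    qed
  qed
  show fz: "?f n = 0" for n by (rule per0[where F = ?f, OF f0 shf])
  have lp: "poly (lsol p) z = 0"
    using fz[of 0] bloch_eq[of 0 w 0] w by (simp add: rsol_0)
  \<comment> \<open>The vanishing Bloch value at site \<open>p - 1\<close> reads
    \<open>1 + w * lsol (p - 1) = 0\<close>, and \<open>lsol (p - 1)\<close> is real at the real
    point \<open>z\<close>; so \<open>w\<close> is real.\<close>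
  show "sin \<theta> = 0"
  proof -
    have "?f (int (p - 1)) = 1 + w * poly (lsol (p - 1)) z"
      using bloch_eq[of "p - 1" w 0] w by simp
    then have e: "w * poly (lsol (p - 1)) z = - 1"
      using fz[of "int (p - 1)"] by (simp only: eq_neg_iff_add_eq_0 add.commute)
    obtain y where y: "poly (lsol (p - 1)) z = of_real y"
      using recurrence_poly_real by (metis x lsol_def Reals_cases)
    have "Im (w * of_real y) = 0" "y \<noteq> 0" using e y by auto
    then show ?thesis by (simp add: w_def)
  qed
  show "poly (pderiv (pderiv discr)) z \<noteq> 0"
  proof
    assume z'': "poly (pderiv (pderiv discr)) z = 0"
    have hk: "hop V ?k n = z * ?k n + 2 * ?h n" for n
      using arg_cong[OF bloch_equation[OF w(1), of n], of "\<lambda>q. poly (pderiv (pderiv q)) z"] z''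
      by (simp add: hop_def algebra_simps pderiv_mult pderiv_diff pderiv_smult pderiv_pCons pderiv_add)
    have hh0: "hop V ?h n = z * ?h n" for n using hh fz by simp
    have "(\<Sum>i<p. 2 * (cnj (?h (int i)) * ?h (int i))) = 0"
      using bloch_self_adjoint[where f = ?h and g = ?k, OF w(2) shh shk] unfolding hh0 hk
      by (simp add: cz algebra_simps)
    then have "2 * (\<Sum>i<p. cnj (?h (int i)) * ?h (int i)) = 0" by (simp only: sum_distrib_left)
    then have "?h (int 0) = 0"
      using sum_cmod_sq_eq_0[of "{..<p}" "\<lambda>i. ?h (int i)" 0] p2 by simp
    then have lp': "poly (pderiv (lsol p)) z = 0"
      using bloch_eq[of 0 w 0] w by (simp add: rsol_0)
    let ?g = "\<lambda>n. poly (lsol (nat n)) z"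
    let ?g' = "\<lambda>n. poly (pderiv (lsol (nat n))) z"
    have h: "hop V ?g (1 + int i) = z * ?g (1 + int i)" for i
      by (rule hop_lsol) simp
    have h': "hop V ?g' (1 + int i) = z * ?g' (1 + int i) + ?g (1 + int i)" for i
      by (rule hop_lsol_deriv) simp
    have "(\<Sum>i<p-1. cnj (?g (1 + int i)) * ?g (1 + int i)) = 0"
      using hop_Green_identity[where a = 1 and m = "p - 1" and f = ?g and g = ?g' and V = V] lp lp' p2
      unfolding h h' by (simp add: cz algebra_simps of_nat_diff)
    then show False
      using sum_cmod_sq_eq_0[of "{..<p-1}" "\<lambda>i. ?g (1 + int i)" 0] p2 by simp
  qed
qed

text \<open>Spectral decomposition of a fibre with \<open>p\<close> distinct eigenvalues: Lagrange
  interpolation for \<open>k = 0\<close>, then one factor \<open>z\<close> for each application of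
  \<open>hop\<close>.\<close>

lemma hop_funpow_comb:
  assumes w: "w \<noteq> 0" and Z: "finite Z" "card Z = p" "\<And>z. z \<in> Z \<Longrightarrow> poly discr z = w + inverse w"
  shows "(hop V ^^ k) (comb w) = (\<lambda>n. \<Sum>z\<in>Z. z ^ k * poly (bloch w n) z / poly (pderiv discr) z)"
proof (induction k)
  case 0
  define Q where "Q = discr - [:w + inverse w:]"
  have cQ: "coeff Q p = 1"
    using discr_degree p2 by (simp add: Q_def coeff_pCons split: nat.split)
  have "degree Q \<le> p"
    unfolding Q_def by (rule degree_diff_le) (use discr_degree in auto)
  with cQ have degQ: "degree Q = p"
    by (intro antisym le_degree) auto
  have lc: "lead_coeff Q = 1" using cQ by (simp add: degQ)
  have dQ: "pderiv Q = pderiv discr" by (simp add: Q_def pderiv_diff pderiv_pCons)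
  have "(\<Sum>z\<in>Z. poly (bloch w n) z / poly (pderiv Q) z) = coeff (bloch w n) (degree Q - 1)" for n
    by (rule sum_Lagrange_coeff) (use Z degQ lc bloch_degree[OF w, of n] in \<open>auto simp: Q_def\<close>)
  then show ?case using bloch_degree[OF w] by (auto simp: dQ degQ)
next
  case (Suc k)
  have "(hop V ^^ Suc k) (comb w)
      = hop V (\<lambda>n. \<Sum>z\<in>Z. (z ^ k / poly (pderiv discr) z) * poly (bloch w n) z)"
    using Suc by (simp add: algebra_simps)
  also have "\<dots> = (\<lambda>n. \<Sum>z\<in>Z. (z ^ k / poly (pderiv discr) z) * (z * poly (bloch w n) z))"
    unfolding hop_sum hop_cmult
    by (intro ext sum.cong refl) (use Z(3) hop_bloch[OF w] in simp)
  finally show ?case by (simp add: algebra_simps)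
qed

end

section \<open>Reduction to the propagator kernel\<close>

lemma hop_bound:
  assumes V: "\<And>n. \<bar>V n\<bar> \<le> C" and f: "\<And>n. cmod (f n) \<le> B"
  shows "cmod (hop V f n) \<le> (2 + C) * B"
proof -
  have "cmod (of_real (V n) * f n) \<le> C * B"
    unfolding norm_mult using V[of n] f[of n] order_trans[OF abs_ge_zero V[of n]]
    by (intro mult_mono) auto
  moreover have "cmod (hop V f n) \<le> cmod (f (n - 1)) + cmod (f (n + 1)) + cmod (of_real (V n) * f n)"
    unfolding hop_def by (intro order_trans[OF norm_triangle_ineq] add_mono norm_triangle_ineq) auto
  ultimately show ?thesis using f[of "n - 1"] f[of "n + 1"] by (simp add: algebra_simps)
qed

lemma hop_funpow_bound:
  assumes V: "\<And>n. \<bar>V n\<bar> \<le> C" and f: "\<And>n. cmod (f n) \<le> 1"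
  shows "cmod ((hop V ^^ k) f n) \<le> (2 + C) ^ k"
proof (induction k arbitrary: n)
  case (Suc k)
  then show ?case using hop_bound[where V = V and C = C and f = "(hop V ^^ k) f" and B = "(2 + C) ^ k" and n = n] V by simp
qed (use f in simp)

lemma hop_funpow_Suc:
  "(hop V ^^ Suc k) f n = (hop V ^^ k) f (n - 1) + (hop V ^^ k) f (n + 1) + of_real (V n) * (hop V ^^ k) f n"
  by (simp add: hop_def[of V "(hop V ^^ k) f"])

lemma hop_series_term_bound:
  assumes V: "\<And>n. \<bar>V n\<bar> \<le> C" and f: "\<And>n. cmod (f n) \<le> 1"
  shows "cmod ((- \<i> * of_real t) ^ k / fact k * (hop V ^^ k) f n) \<le> inverse (fact k) * (\<bar>t\<bar> * (2 + C)) ^ k"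
proof -
  have "cmod ((- \<i> * of_real t) ^ k / fact k * (hop V ^^ k) f n)
      = inverse (fact k) * \<bar>t\<bar> ^ k * cmod ((hop V ^^ k) f n)"
    by (simp add: norm_mult norm_power norm_inverse divide_inverse mult_ac)
  also have "\<dots> \<le> inverse (fact k) * \<bar>t\<bar> ^ k * (2 + C) ^ k"
    by (intro mult_left_mono hop_funpow_bound assms) auto
  finally show ?thesis by (simp only: power_mult_distrib mult.assoc)
qed

definition delta :: "int \<Rightarrow> int \<Rightarrow> complex"
  where "delta m n = (if n = m then 1 else 0)"

text \<open>The column of the propagator with source 0, given sitewise by the exponential series and
  so without reference to \<open>ell2\<close>.\<close>

definition prop_kernel :: "(int \<Rightarrow> real) \<Rightarrow> real \<Rightarrow> int \<Rightarrow> complex"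
  where "prop_kernel V t n = (\<Sum>k. (- \<i> * of_real t) ^ k / fact k * (hop V ^^ k) (delta 0) n)"

lemma summable_hop_series:
  assumes V: "\<And>n. \<bar>V n\<bar> \<le> C" and f: "\<And>n. cmod (f n) \<le> 1"
  shows "summable (\<lambda>k. (- \<i> * of_real t) ^ k / fact k * (hop V ^^ k) f n)"
  by (rule summable_comparison_test'[OF summable_exp[of "\<bar>t\<bar> * (2 + C)"]])
    (rule hop_series_term_bound[OF assms])

lemma cmod_delta_le: "cmod (delta m n) \<le> 1"
  by (simp add: delta_def)

text \<open>Crude, but enough for the times \<open>\<bar>t\<bar> < 1\<close>.\<close>

lemma prop_kernel_bound:
  assumes V: "\<And>n. \<bar>V n\<bar> \<le> C"
  shows "cmod (prop_kernel V t n) \<le> exp (\<bar>t\<bar> * (2 + C))"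
proof -
  have "cmod (prop_kernel V t n) \<le> (\<Sum>k. inverse (fact k) * (\<bar>t\<bar> * (2 + C)) ^ k)"
    unfolding prop_kernel_def
    by (rule norm_suminf_le[OF hop_series_term_bound[OF V cmod_delta_le] summable_exp])
  then show ?thesis by (simp add: exp_def scaleR_conv_of_real)
qed

text \<open>Translation trades the position of the source for a translate of the potential, so that
  only kernels with source 0 have to be estimated.\<close>

lemma hop_funpow_delta_shift:
  "(hop V ^^ k) (delta m) n = (hop (\<lambda>j. V (j + m)) ^^ k) (delta 0) (n - m)"
proof (induction k arbitrary: n)
  case (Suc k)
  have e: "n - 1 - m = n - m - 1" "n + 1 - m = n - m + 1" by auto
  show ?case unfolding hop_funpow_Suc Suc e by (simp only: diff_add_cancel)
qed (auto simp: delta_def)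

section \<open>Representation of the unitary group by its kernel\<close>

lemma bounded_linear_ell2_seq: "bounded_linear (\<lambda>\<psi>. ell2_seq \<psi> n)"
  by (rule bounded_linear_intro[where K = 1])
    (use cmod_le_norm_ell2 in \<open>auto simp: plus_ell2.rep_eq scaleR_ell2.rep_eq\<close>)

lemma schroedinger_group_sums:
  assumes V: "\<And>n. \<bar>V n\<bar> \<le> C"
  shows "(\<lambda>k. (- \<i> * of_real t) ^ k / fact k * (hop V ^^ k) (ell2_seq \<psi>) n)
    sums ell2_seq (blinfun_apply (schroedinger_group V t) \<psi>) n"
proof -
  define A where "A = ell2_scaleC (- \<i> * of_real t) o\<^sub>L schroedinger V"
  have A: "ell2_seq (blinfun_apply A \<phi>) n = (- \<i> * of_real t) * hop V (ell2_seq \<phi>) n" for \<phi> n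
    by (simp add: A_def ell2_scaleC_apply schroedinger_apply[OF V] hop_def)
  have Ak: "ell2_seq (blinfun_apply (((\<lambda>B. A o\<^sub>L B) ^^ k) id_blinfun) \<phi>) =
      (\<lambda>n. (- \<i> * of_real t) ^ k * (hop V ^^ k) (ell2_seq \<phi>) n)" for k \<phi>
  proof (induction k)
    case (Suc k)
    show ?case
      by (rule ext) (simp add: A Suc, simp add: hop_def algebra_simps)
  qed simp
  interpret L: bounded_linear "\<lambda>B :: ell2 \<Rightarrow>\<^sub>L ell2. ell2_seq (blinfun_apply B \<psi>) n"
    by (intro bounded_linear_compose[OF bounded_linear_ell2_seq] blinfun.bounded_linear_left)
  have "(\<lambda>k. ell2_seq (blinfun_apply ((1 / fact k) *\<^sub>R (((\<lambda>B. A o\<^sub>L B) ^^ k) id_blinfun)) \<psi>) n)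
      sums ell2_seq (blinfun_apply (blinfun_exp A) \<psi>) n"
    unfolding blinfun_exp_def by (rule L.sums[OF summable_sums[OF summable_blinfun_exp]])
  moreover have "ell2_seq (blinfun_apply ((1 / fact k) *\<^sub>R (((\<lambda>B. A o\<^sub>L B) ^^ k) id_blinfun)) \<psi>) n
      = (- \<i> * of_real t) ^ k / fact k * (hop V ^^ k) (ell2_seq \<psi>) n" for k
    unfolding blinfun.scaleR_left scaleR_ell2.rep_eq Ak by (simp add: scaleR_conv_of_real)
  ultimately show ?thesis by (simp only: schroedinger_group_def A_def)
qed

lemma delta_ell1: "delta m \<in> ell1"
proof -
  have "(\<lambda>n. cmod (delta m n)) summable_on {m}" by simp
  then have "(\<lambda>n. cmod (delta m n)) summable_on UNIV"
    by (subst summable_on_cong_neutral[where T = "{m}" and g = "\<lambda>n. cmod (delta m n)"])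
      (auto simp: delta_def)
  then show ?thesis by (simp add: ell1_def)
qed

lemma schroedinger_group_delta:
  assumes V: "\<And>n. \<bar>V n\<bar> \<le> C"
  shows "ell2_seq (blinfun_apply (schroedinger_group V t) (Abs_ell2 (delta m))) n
    = prop_kernel (\<lambda>j. V (j + m)) t (n - m)"
  using sums_unique[OF schroedinger_group_sums[where V = V and t = t and \<psi> = "Abs_ell2 (delta m)" and n = n, OF V]]
  by (simp add: ell2_seq_Abs_ell1[OF delta_ell1] hop_funpow_delta_shift[where V = V and m = m] prop_kernel_def)

text \<open>Bounded linear functions are real linear by type; complex scalars are moved through the
  group by means of the series.\<close>

lemma schroedinger_group_scaleC:
  assumes V: "\<And>n. \<bar>V n\<bar> \<le> C"
  shows "ell2_seq (blinfun_apply (schroedinger_group V t) (blinfun_apply (ell2_scaleC c) \<psi>)) n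
    = c * ell2_seq (blinfun_apply (schroedinger_group V t) \<psi>) n"
proof -
  have e: "ell2_seq (blinfun_apply (ell2_scaleC c) \<psi>) = (\<lambda>n. c * ell2_seq \<psi> n)"
    by (rule ext) (rule ell2_scaleC_apply)
  have h: "(hop V ^^ k) (\<lambda>n. c * f n) n = c * (hop V ^^ k) f n" for k f n
    by (induction k arbitrary: n) (simp_all only: hop_funpow_Suc, simp_all add: algebra_simps)
  have "(\<lambda>k. (- \<i> * of_real t) ^ k / fact k * (hop V ^^ k) (ell2_seq (blinfun_apply (ell2_scaleC c) \<psi>)) n)
      = (\<lambda>k. c * ((- \<i> * of_real t) ^ k / fact k * (hop V ^^ k) (ell2_seq \<psi>) n))"
    unfolding e h by (simp add: algebra_simps)
  with schroedinger_group_sums[where V = V and t = t and \<psi> = "blinfun_apply (ell2_scaleC c) \<psi>" and n = n, OF V]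
    sums_mult[OF schroedinger_group_sums[where V = V and t = t and \<psi> = \<psi> and n = n, OF V], of c]
  show ?thesis by (simp only: sums_unique2)
qed

text \<open>Absolute summability in a complete space gives a sum in norm, which the coordinate
  functionals identify. Convergence in norm permits applying the group term by term.\<close>

lemma delta_expansion:
  assumes \<psi>: "\<psi> \<in> ell1"
  shows "((\<lambda>m. blinfun_apply (ell2_scaleC (\<psi> m)) (Abs_ell2 (delta m))) has_sum Abs_ell2 \<psi>) UNIV"
proof -
  let ?f = "\<lambda>m. blinfun_apply (ell2_scaleC (\<psi> m)) (Abs_ell2 (delta m))"
  have fseq: "ell2_seq (?f m) n = \<psi> m * delta m n" for m n
    by (simp add: ell2_scaleC_apply ell2_seq_Abs_ell1[OF delta_ell1])
  have fn: "norm (?f m) \<le> cmod (\<psi> m)" for m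
  proof -
    have "?f m = Abs_ell2 (ell2_seq (?f m))" by (simp add: ell2_seq_inverse)
    also have "norm \<dots> \<le> cmod (\<psi> m)"
    proof (rule norm_ell2_bound)
      fix F :: "int set" assume F: "finite F"
      have "(\<Sum>n\<in>F. (cmod (ell2_seq (?f m) n))\<^sup>2) = (\<Sum>n\<in>F. if n = m then (cmod (\<psi> m))\<^sup>2 else 0)"
        unfolding fseq by (intro sum.cong) (auto simp: delta_def)
      also have "\<dots> \<le> (cmod (\<psi> m))\<^sup>2" using F by (simp add: sum.delta)
      finally show "(\<Sum>n\<in>F. (cmod (ell2_seq (?f m) n))\<^sup>2) \<le> (cmod (\<psi> m))\<^sup>2" .
    qed auto
    finally show ?thesis .
  qed
  have "(\<lambda>m. cmod (\<psi> m)) summable_on UNIV" using \<psi> by (simp add: ell1_def)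
  then have "(\<lambda>m. norm (?f m)) summable_on UNIV"
    by (rule summable_on_comparison_test) (use fn in auto)
  then have "?f summable_on UNIV" by (rule abs_summable_summable)
  then obtain S where S: "(?f has_sum S) UNIV" by (auto simp: summable_on_def)
  have "ell2_seq S n = \<psi> n" for n
  proof -
    have "((\<lambda>m. ell2_seq (?f m) n) has_sum ell2_seq S n) UNIV"
      by (rule has_sum_bounded_linear[OF bounded_linear_ell2_seq S])
    then have 1: "((\<lambda>m. \<psi> m * delta m n) has_sum ell2_seq S n) UNIV"
      unfolding fseq .
    have "((\<lambda>m. \<psi> m * delta m n) has_sum (\<Sum>m\<in>{n}. \<psi> m * delta m n)) {n}"
      by (rule has_sum_finite) auto
    then have "((\<lambda>m. \<psi> m * delta m n) has_sum \<psi> n) UNIV"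
      by (subst has_sum_cong_neutral[where T = "{n}" and g = "\<lambda>m. \<psi> m * delta m n"])
        (auto simp: delta_def)
    with 1 show ?thesis by (rule has_sum_unique)
  qed
  then have "S = Abs_ell2 \<psi>"
    by (intro ell2_eqI) (simp add: ell2_seq_Abs_ell1[OF \<psi>])
  then show ?thesis using S by simp
qed

lemma sup_norm_schroedinger_group_le:
  assumes V: "\<And>n. \<bar>V n\<bar> \<le> C"
    and B: "\<And>m n. cmod (prop_kernel (\<lambda>j. V (j + m)) t n) \<le> B" and \<psi>: "\<psi> \<in> ell1"
  shows "sup_norm (ell2_seq (blinfun_apply (schroedinger_group V t) (Abs_ell2 \<psi>))) \<le> B * ell1_norm \<psi>"
  unfolding sup_norm_def
proof (rule cSUP_least)
  fix n :: int
  let ?U = "blinfun_apply (schroedinger_group V t)"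
  have "bounded_linear (\<lambda>\<phi>. ell2_seq (?U \<phi>) n)"
    by (intro bounded_linear_compose[OF bounded_linear_ell2_seq] blinfun.bounded_linear_right)
  from has_sum_bounded_linear[OF this delta_expansion[OF \<psi>]]
  have S: "((\<lambda>m. \<psi> m * prop_kernel (\<lambda>j. V (j + m)) t (n - m)) has_sum ell2_seq (?U (Abs_ell2 \<psi>)) n) UNIV"
    unfolding schroedinger_group_scaleC[OF V] schroedinger_group_delta[OF V] .
  have le: "norm (\<psi> m * prop_kernel (\<lambda>j. V (j + m)) t (n - m)) \<le> B * cmod (\<psi> m)" for m
    using mult_right_mono[OF B, of "cmod (\<psi> m)" m "n - m"] by (simp add: norm_mult mult.commute)
  have sm: "(\<lambda>m. B * cmod (\<psi> m)) summable_on UNIV"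
    using \<psi> by (intro summable_on_cmult_right) (simp add: ell1_def)
  have "norm (ell2_seq (?U (Abs_ell2 \<psi>)) n) \<le> (\<Sum>\<^sub>\<infinity>m. B * cmod (\<psi> m))"
    using norm_infsum_le[OF S has_sum_infsum[OF sm]] le by simp
  also have "\<dots> = B * ell1_norm \<psi>"
    by (simp add: ell1_norm_def infsum_cmult_right')
  finally show "cmod (ell2_seq (?U (Abs_ell2 \<psi>)) n) \<le> B * ell1_norm \<psi>" .
qed auto

section \<open>Averaging over the Floquet multiplier\<close>

lemma has_integral_cis_int:
  "((\<lambda>\<theta>. cis (of_int N * \<theta>)) has_integral (if N = 0 then 2 * of_real pi else 0)) {0..2 * pi}"
proof (cases "N = 0")
  case True
  then show ?thesis
    using has_integral_const_real[of "1::complex" 0 "2 * pi"] by (simp add: scaleR_conv_of_real)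
next
  case False
  have d: "((\<lambda>\<theta>. cis (of_int N * \<theta>) / (\<i> * of_int N)) has_vector_derivative cis (of_int N * x))
      (at x within {0..2 * pi})" for x
  proof -
    have "((\<lambda>\<theta>. \<i> * of_int N * complex_of_real \<theta>) has_vector_derivative \<i> * of_int N * of_real 1) (at x within {0..2 * pi})"
      by (intro derivative_intros has_vector_derivative_of_real)
    from field_vector_diff_chain_within[OF this, of exp "exp (\<i> * of_int N * of_real x)"]
    have "((\<lambda>\<theta>. exp (\<i> * of_int N * complex_of_real \<theta>)) has_vector_derivative
        (\<i> * of_int N) * exp (\<i> * of_int N * of_real x)) (at x within {0..2 * pi})"
      by (simp add: o_def DERIV_exp has_field_derivative_at_within)
    from has_vector_derivative_divide[OF this, of "\<i> * of_int N"]
    show ?thesis using False by (simp add: cis_conv_exp mult_ac)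
  qed
  have e: "cis (of_int N * (2 * pi)) = 1"
    using cis_multiple_2pi[of "of_int N"] by (simp add: mult_ac)
  have "((\<lambda>\<theta>. cis (of_int N * \<theta>)) has_integral
      (cis (of_int N * (2 * pi)) / (\<i> * of_int N) - cis (of_int N * 0) / (\<i> * of_int N))) {0..2 * pi}"
    by (rule fundamental_theorem_of_calculus[OF _ d]) simp
  then show ?thesis using False unfolding e by simp
qed

context periodic_chain
begin

lemma comb_cis: "comb (cis \<theta>) n = (if int p dvd n then cis (of_int (n div int p) * \<theta>) else 0)"
  by (simp add: comb_def cis_power_int)

text \<open>For \<open>k = 0\<close> this is orthogonality of characters; \<open>hop\<close> acts on
  \<open>n\<close> with coefficients independent of \<open>\<theta>\<close> and commutes with the
  average.\<close>

lemma has_integral_hop_comb: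
  "((\<lambda>\<theta>. (hop V ^^ k) (comb (cis \<theta>)) n) has_integral 2 * of_real pi * (hop V ^^ k) (delta 0) n) {0..2 * pi}"
proof (induction k arbitrary: n)
  case 0
  show ?case
  proof (cases "int p dvd n")
    case True
    then have "n div int p = 0 \<longleftrightarrow> n = 0" using p2 by auto
    then show ?thesis
      using has_integral_cis_int[of "n div int p"] True
      by (cases "n = 0") (simp_all add: comb_cis delta_def)
  next
    case False
    then have "n \<noteq> 0" by auto
    then show ?thesis using False by (simp add: comb_cis delta_def)
  qed
next
  case (Suc k)
  have "((\<lambda>\<theta>. (hop V ^^ k) (comb (cis \<theta>)) (n - 1) + (hop V ^^ k) (comb (cis \<theta>)) (n + 1)
      + of_real (V n) * (hop V ^^ k) (comb (cis \<theta>)) n) has_integral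
      (2 * of_real pi * (hop V ^^ k) (delta 0) (n - 1) + 2 * of_real pi * (hop V ^^ k) (delta 0) (n + 1)
      + of_real (V n) * (2 * of_real pi * (hop V ^^ k) (delta 0) n))) {0..2 * pi}"
    by (intro has_integral_add has_integral_mult_right Suc)
  then show ?case unfolding hop_funpow_Suc by (simp add: algebra_simps)
qed

definition fibre_prop :: "real \<Rightarrow> int \<Rightarrow> real \<Rightarrow> complex"
  where "fibre_prop t n \<theta> = (\<Sum>k. (- \<i> * of_real t) ^ k / fact k * (hop V ^^ k) (comb (cis \<theta>)) n)"

lemma V_bounded: obtains C where "\<And>n. \<bar>V n\<bar> \<le> C"
proof -
  have "periodic_potential V"
    unfolding periodic_potential_def using per p2 by (intro exI[of _ "int p"]) auto
  then show thesis by (rule periodic_potential_bounded) (rule that)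
qed

lemma continuous_on_hop_comb: "continuous_on S (\<lambda>\<theta>. (hop V ^^ k) (comb (cis \<theta>)) n)"
proof (induction k arbitrary: n)
  case 0
  show ?case by (cases "int p dvd n") (auto simp: comb_cis intro!: continuous_intros)
next
  case (Suc k)
  show ?case unfolding hop_funpow_Suc by (intro continuous_intros Suc)
qed

lemma cmod_comb_le: "cmod (comb (cis \<theta>) n) \<le> 1"
  by (simp add: comb_cis)

lemma uniform_limit_fibre_prop:
  "uniform_limit S (\<lambda>m \<theta>. \<Sum>k<m. (- \<i> * of_real t) ^ k / fact k * (hop V ^^ k) (comb (cis \<theta>)) n)
    (fibre_prop t n) sequentially"
proof -
  obtain C where C: "\<And>n. \<bar>V n\<bar> \<le> C" by (rule V_bounded) blast
  show ?thesis
    unfolding fibre_prop_def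
    by (rule Weierstrass_m_test[OF _ summable_exp[of "\<bar>t\<bar> * (2 + C)"]])
      (rule hop_series_term_bound[OF C cmod_comb_le])
qed

lemma continuous_on_fibre_prop: "continuous_on S (fibre_prop t n)"
  by (rule uniform_limit_theorem[OF _ uniform_limit_fibre_prop])
    (auto intro!: always_eventually continuous_intros continuous_on_hop_comb)

lemma prop_kernel_fibre:
  "2 * of_real pi * prop_kernel V t n = integral {0..2 * pi} (fibre_prop t n)"
proof -
  let ?c = "\<lambda>k. (- \<i> * of_real t) ^ k / fact k :: complex"
  obtain C where C: "\<And>n. \<bar>V n\<bar> \<le> C" by (rule V_bounded) blast
  obtain I J where I: "\<And>m. ((\<lambda>\<theta>. \<Sum>k<m. ?c k * (hop V ^^ k) (comb (cis \<theta>)) n) has_integral I m) {0..2 * pi}"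
    and J: "(fibre_prop t n has_integral J) {0..2 * pi}" and lim: "I \<longlonglongrightarrow> J"
    by (rule uniform_limit_integral[OF uniform_limit_fibre_prop[where S = "{0..2 * pi}" and t = t and n = n]])
      (auto intro!: continuous_intros continuous_on_hop_comb)
  have "((\<lambda>\<theta>. \<Sum>k<m. ?c k * (hop V ^^ k) (comb (cis \<theta>)) n) has_integral
      (\<Sum>k<m. ?c k * (2 * of_real pi * (hop V ^^ k) (delta 0) n))) {0..2 * pi}" for m
    by (intro has_integral_sum has_integral_mult_right has_integral_hop_comb) auto
  with I have Im: "I m = (\<Sum>k<m. ?c k * (2 * of_real pi * (hop V ^^ k) (delta 0) n))" for m
    by (rule has_integral_unique)
  have "(\<lambda>k. 2 * of_real pi * (?c k * (hop V ^^ k) (delta 0) n)) sums (2 * of_real pi * prop_kernel V t n)"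
    unfolding prop_kernel_def
    by (intro sums_mult summable_sums summable_hop_series[OF C cmod_delta_le])
  then have "I \<longlonglongrightarrow> 2 * of_real pi * prop_kernel V t n"
    unfolding sums_def Im[abs_def] by (simp add: algebra_simps)
  with lim have "J = 2 * of_real pi * prop_kernel V t n" by (rule LIMSEQ_unique)
  then show ?thesis using J by (simp add: integral_unique)
qed

end

section \<open>Analytic branches and amplitudes\<close>

lemma analytic_on_singleton_ball:
  assumes "f analytic_on {a}"
  obtains r where "r > 0" "f holomorphic_on ball a r"
  using assms by (auto simp: analytic_on_def)

lemma analytic_local_inverse:
  assumes f: "f analytic_on {x}" and d: "deriv f x \<noteq> 0"
  obtains g where "g analytic_on {f x}" "g (f x) = x" "eventually (\<lambda>w. f (g w) = w) (nhds (f x))"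
proof -
  obtain r0 where r0: "r0 > 0" "f holomorphic_on ball x r0" using analytic_on_singleton_ball[OF f] .
  obtain r where r: "r > 0" "ball x r \<subseteq> ball x r0" "open (f ` ball x r)" "inj_on f (ball x r)"
    by (rule has_complex_derivative_locally_invertible[OF r0(2) _ open_ball d]) (use r0 in auto)
  have hf: "f holomorphic_on ball x r" by (rule holomorphic_on_subset[OF r0(2) r(2)])
  obtain g where g: "g holomorphic_on f ` ball x r" "\<And>z. z \<in> ball x r \<Longrightarrow> g (f z) = z"
    by (rule holomorphic_has_inverse[OF hf open_ball r(4)]) blast
  have fx: "f x \<in> f ` ball x r" using r by auto
  show thesis
  proof (rule that)
    show "g analytic_on {f x}"
      using analytic_on_open[OF r(3)] g(1) fx by (meson analytic_on_subset empty_subsetI insert_subset)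
    show "g (f x) = x" using g(2) r by simp
    show "eventually (\<lambda>w. f (g w) = w) (nhds (f x))"
      using eventually_nhds_in_open[OF r(3) fx] by eventually_elim (use g(2) in auto)
  qed
qed

lemma analytic_factor_zero:
  assumes f: "f analytic_on {a}" and 0: "f a = 0"
  obtains g where "g analytic_on {a}" "g a = deriv f a" "eventually (\<lambda>z. f z = (z - a) * g z) (nhds a)"
proof -
  obtain r where r: "r > 0" "f holomorphic_on ball a r" using analytic_on_singleton_ball[OF f] .
  let ?g = "\<lambda>z. if z = a then deriv f a else (f z - f a) / (z - a)"
  have "?g holomorphic_on ball a r" by (rule pole_lemma_open[OF r(2) open_ball])
  then have "?g analytic_on {a}" using r(1) by (auto simp: analytic_on_def)
  moreover have "eventually (\<lambda>z. f z = (z - a) * ?g z) (nhds a)"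
    using 0 by (intro always_eventually) auto
  ultimately show thesis by (intro that[of ?g]) auto
qed

lemma eventually_ne_of_analytic:
  assumes "f analytic_on {a}" "g analytic_on {a}" "f a \<noteq> g a"
  shows "eventually (\<lambda>z. f z \<noteq> g z) (nhds a)"
proof -
  have "isCont (\<lambda>z. f z - g z) a"
    using assms by (intro continuous_intros analytic_at_imp_isCont)
  then have "((\<lambda>z. f z - g z) \<longlongrightarrow> f a - g a) (nhds a)"
    using tendsto_at_iff_tendsto_nhds[of "\<lambda>z. f z - g z" a] by (simp add: isCont_def)
  then have "eventually (\<lambda>z. f z - g z \<noteq> 0) (nhds a)"
    by (rule tendsto_imp_eventually_ne) (use assms in auto)
  then show ?thesis by eventually_elim auto
qed

lemma tendsto_nhds_analytic: "f analytic_on {a} \<Longrightarrow> filterlim f (nhds (f a)) (nhds a)"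
  using analytic_at_imp_isCont[of f a] tendsto_at_iff_tendsto_nhds[of f a] by (simp add: isCont_def)

lemma order_linear_power_mult:
  assumes "poly q x \<noteq> 0"
  shows "order x ([:- x, 1:] ^ n * q) = n"
proof -
  have "q \<noteq> 0" using assms by auto
  moreover have "[:- x, 1:] ^ n \<noteq> 0" by simp
  ultimately have "order x ([:- x, 1:] ^ n * q) = order x ([:- x, 1:] ^ n) + order x q"
    by (intro order_mult) auto
  then show ?thesis using assms by (simp add: order_power_n_n order_0I)
qed

lemma sum_order_eq_degree_complex:
  fixes Q :: "complex poly"
  assumes "Q \<noteq> 0"
  shows "(\<Sum>x | poly Q x = 0. order x Q) = degree Q"
  using size_proots_complex[of Q] assms
  by (simp add: size_multiset_overloaded_eq)

section \<open>Oscillatory integrals with holomorphic phase and amplitude\<close>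

lemma has_vector_derivative_of_real_comp:
  assumes "(F has_field_derivative F') (at (complex_of_real u))"
  shows "((\<lambda>u. F (of_real u)) has_vector_derivative F') (at u within S)"
  using field_vector_diff_chain_within[of complex_of_real 1 u S F F'] assms
    has_vector_derivative_of_real[of "\<lambda>u. u" 1 "at u within S"]
  by (simp add: o_def has_field_derivative_at_within)

lemma has_real_derivative_Re_of_real:
  assumes "(F has_field_derivative F') (at (complex_of_real u))"
  shows "((\<lambda>u. Re (F (of_real u))) has_real_derivative Re F') (at u within S)"
  using bounded_linear.has_vector_derivative[OF bounded_linear_Re has_vector_derivative_of_real_comp[OF assms]]
  by (simp add: has_real_derivative_iff_has_vector_derivative)

text \<open>Near \<open>\<theta>\<close> the derivative that is nonzero there keeps at least half
  its size and its sign, so van der Corput's lemma applies with fixed constants. All subintervals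
  are covered because the circle is later subdivided without control over the cut points.\<close>

lemma local_oscillatory_bound:
  fixes E A :: "complex \<Rightarrow> complex" and \<theta> :: real
  assumes E: "E analytic_on {of_real \<theta>}" and A: "A analytic_on {of_real \<theta>}"
    and real: "r0 > 0" "\<And>u. \<bar>u - \<theta>\<bar> < r0 \<Longrightarrow> E (of_real u) \<in> \<real>"
    and nd: "(deriv ^^ 2) E (of_real \<theta>) \<noteq> 0 \<or> (deriv ^^ 3) E (of_real \<theta>) \<noteq> 0"
  obtains \<delta> C where "\<delta> > 0"
    "\<And>\<alpha> \<beta> t N. \<theta> - \<delta> \<le> \<alpha> \<Longrightarrow> \<alpha> \<le> \<beta> \<Longrightarrow> \<beta> \<le> \<theta> + \<delta> \<Longrightarrow> \<bar>t\<bar> \<ge> 1 \<Longrightarrow>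
      cmod (integral {\<alpha>..\<beta>} (\<lambda>u. cis (N * u) * exp (- \<i> * of_real t * E (of_real u)) * A (of_real u)))
        \<le> C * \<bar>t\<bar> powr (-1/3)"
    "\<And>\<alpha> \<beta> t N. \<theta> - \<delta> \<le> \<alpha> \<Longrightarrow> \<beta> \<le> \<theta> + \<delta> \<Longrightarrow>
      (\<lambda>u. cis (N * u) * exp (- \<i> * of_real t * E (of_real u)) * A (of_real u)) integrable_on {\<alpha>..\<beta>}"
proof -
  let ?a = "complex_of_real \<theta>"
  obtain ra where ra: "ra > 0" "E holomorphic_on ball ?a ra" using analytic_on_singleton_ball[OF E] .
  obtain rb where rb: "rb > 0" "A holomorphic_on ball ?a rb" using analytic_on_singleton_ball[OF A] .
  define r where "r = min (min ra rb) r0"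
  have r: "r > 0" "E holomorphic_on ball ?a r" "A holomorphic_on ball ?a r"
    using ra rb real(1) by (auto simp: r_def intro: holomorphic_on_subset)
  have in_ball: "of_real u \<in> ball ?a r" if "\<bar>u - \<theta>\<bar> < r" for u
    using that by (simp add: dist_norm norm_minus_commute flip: of_real_diff)
  define e where "e = (\<lambda>j u. Re ((deriv ^^ j) E (of_real u)))"
  have hE: "(deriv ^^ j) E holomorphic_on ball ?a r" for j
    by (rule holomorphic_higher_deriv[OF r(2) open_ball])
  have dE: "((deriv ^^ j) E has_field_derivative (deriv ^^ Suc j) E z) (at z)" if "z \<in> ball ?a r" for j z
    using holomorphic_derivI[OF hE open_ball that] by simp
  \<comment> \<open>Differentiation at \<open>u\<close> needs real values on a neighbourhood of
    \<open>u\<close>; the radius \<open>r - \<bar>u - \<theta>\<bar>\<close> is left for it.\<close>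
  have ereal: "(deriv ^^ j) E (of_real u) \<in> \<real>" if "\<bar>u - \<theta>\<bar> < r" for j u
    using that
  proof (induction j arbitrary: u)
    case 0
    then show ?case using real(2)[of u] by (simp add: r_def)
  next
    case (Suc j)
    show ?case
    proof (rule deriv_real_of_real_valued[OF dE[OF in_ball[OF Suc.prems]]])
      show "r - \<bar>u - \<theta>\<bar> > 0" using Suc.prems by simp
      show "(deriv ^^ j) E (of_real v) \<in> \<real>" if "\<bar>v - u\<bar> < r - \<bar>u - \<theta>\<bar>" for v
        using that by (intro Suc.IH) linarith
    qed
  qed
  have e_eq: "(deriv ^^ j) E (of_real u) = of_real (e j u)" if "\<bar>u - \<theta>\<bar> < r" for j u
    using ereal[OF that] by (simp add: e_def)
  have de: "(e j has_real_derivative e (Suc j) u) (at u within S)" if "\<bar>u - \<theta>\<bar> < r" for j u S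
    using has_real_derivative_Re_of_real[OF dE[OF in_ball[OF that]]] unfolding e_def .
  have ce: "isCont (e j) \<theta>" for j
    using de[of \<theta> j UNIV] r by (intro DERIV_isCont) auto
  have small: "\<exists>d>0. d < r \<and> (\<forall>u. \<bar>u - \<theta>\<bar> \<le> d \<longrightarrow> \<bar>e j u - e j \<theta>\<bar> \<le> \<bar>e j \<theta>\<bar> / 2)" if "e j \<theta> \<noteq> 0" for j
  proof -
    have "\<bar>e j \<theta>\<bar> / 2 > 0" using that by simp
    then obtain d where d: "d > 0" "\<And>u. \<bar>u - \<theta>\<bar> < d \<Longrightarrow> \<bar>e j u - e j \<theta>\<bar> < \<bar>e j \<theta>\<bar> / 2"
      using ce[of j, unfolded continuous_at_eps_delta dist_real_def] by blast
    show ?thesis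
      by (rule exI[of _ "min (d/2) (r/2)"]) (use d r in \<open>auto intro!: less_imp_le\<close>)
  qed
  obtain d c where d: "d > 0" "d < r" and c: "c > 0"
    and ndc: "(\<forall>u. \<bar>u - \<theta>\<bar> \<le> d \<longrightarrow> \<bar>e 2 u\<bar> \<ge> c) \<or> (\<forall>u. \<bar>u - \<theta>\<bar> \<le> d \<longrightarrow> e 3 u \<ge> c)
      \<or> (\<forall>u. \<bar>u - \<theta>\<bar> \<le> d \<longrightarrow> e 3 u \<le> - c)"
  proof -
    have t0: "\<bar>\<theta> - \<theta>\<bar> < r" using r by simp
    from nd have "e 2 \<theta> \<noteq> 0 \<or> e 3 \<theta> \<noteq> 0"
      unfolding e_eq[OF t0] of_real_eq_0_iff .
    then show thesis
    proof
      assume n: "e 2 \<theta> \<noteq> 0"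
      then obtain d where d: "d > 0" "d < r" "\<And>u. \<bar>u - \<theta>\<bar> \<le> d \<Longrightarrow> \<bar>e 2 u - e 2 \<theta>\<bar> \<le> \<bar>e 2 \<theta>\<bar> / 2"
        using small[OF n] by auto
      show thesis
      proof (rule that[of d "\<bar>e 2 \<theta>\<bar> / 2"])
        have "\<bar>e 2 u\<bar> \<ge> \<bar>e 2 \<theta>\<bar> / 2" if "\<bar>u - \<theta>\<bar> \<le> d" for u
          using d(3)[OF that] by linarith
        then show "(\<forall>u. \<bar>u - \<theta>\<bar> \<le> d \<longrightarrow> \<bar>e 2 u\<bar> \<ge> \<bar>e 2 \<theta>\<bar> / 2) \<or> (\<forall>u. \<bar>u - \<theta>\<bar> \<le> d \<longrightarrow> e 3 u \<ge> \<bar>e 2 \<theta>\<bar> / 2)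
          \<or> (\<forall>u. \<bar>u - \<theta>\<bar> \<le> d \<longrightarrow> e 3 u \<le> - (\<bar>e 2 \<theta>\<bar> / 2))" by blast
      qed (use d n in auto)
    next
      assume n: "e 3 \<theta> \<noteq> 0"
      then obtain d where d: "d > 0" "d < r" "\<And>u. \<bar>u - \<theta>\<bar> \<le> d \<Longrightarrow> \<bar>e 3 u - e 3 \<theta>\<bar> \<le> \<bar>e 3 \<theta>\<bar> / 2"
        using small[OF n] by auto
      show thesis
      proof (rule that[of d "\<bar>e 3 \<theta>\<bar> / 2"])
        have "(e 3 \<theta> > 0 \<longrightarrow> e 3 u \<ge> \<bar>e 3 \<theta>\<bar> / 2) \<and> (e 3 \<theta> < 0 \<longrightarrow> e 3 u \<le> - (\<bar>e 3 \<theta>\<bar> / 2))" if "\<bar>u - \<theta>\<bar> \<le> d" for u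
          using d(3)[OF that] by linarith
        then show "(\<forall>u. \<bar>u - \<theta>\<bar> \<le> d \<longrightarrow> \<bar>e 2 u\<bar> \<ge> \<bar>e 3 \<theta>\<bar> / 2) \<or> (\<forall>u. \<bar>u - \<theta>\<bar> \<le> d \<longrightarrow> e 3 u \<ge> \<bar>e 3 \<theta>\<bar> / 2)
          \<or> (\<forall>u. \<bar>u - \<theta>\<bar> \<le> d \<longrightarrow> e 3 u \<le> - (\<bar>e 3 \<theta>\<bar> / 2))"
          using n by (metis linorder_neqE_linordered_idom)
      qed (use d n in auto)
    qed
  qed
  have cball_sub: "cball ?a d \<subseteq> ball ?a r" using d by auto
  have hA': "deriv A holomorphic_on ball ?a r" by (rule holomorphic_deriv[OF r(3) open_ball])
  have bounded: "\<exists>K. \<forall>z\<in>cball ?a d. cmod (F z) \<le> K" if "F holomorphic_on ball ?a r" for F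
  proof -
    have "compact (F ` cball ?a d)"
      by (intro compact_continuous_image holomorphic_on_imp_continuous_on
          holomorphic_on_subset[OF that cball_sub] compact_cball)
    then have "bounded (F ` cball ?a d)" by (rule compact_imp_bounded)
    then show ?thesis by (auto simp: bounded_iff)
  qed
  obtain K1 K2 where K1: "\<And>z. z \<in> cball ?a d \<Longrightarrow> cmod (A z) \<le> K1"
    and K2: "\<And>z. z \<in> cball ?a d \<Longrightarrow> cmod (deriv A z) \<le> K2"
    using bounded[OF r(3)] bounded[OF hA'] by blast
  \<comment> \<open>The bound \<open>1/2\<close> keeps subintervals of length at most 1, as the
    linear-phase estimate requires.\<close>
  define \<delta> where "\<delta> = min d (1/2)"
  have \<delta>: "\<delta> > 0" "\<delta> \<le> d" "\<delta> \<le> 1/2" using d by (auto simp: \<delta>_def)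
  define K where "K = max K1 K2"
  show thesis
  proof (rule that[OF \<delta>(1), of "2 * K * (10 / sqrt c + 22 * c powr (-1/3))"])
    fix \<alpha> \<beta> t N :: real
    assume ab: "\<theta> - \<delta> \<le> \<alpha>" "\<alpha> \<le> \<beta>" "\<beta> \<le> \<theta> + \<delta>" and t: "\<bar>t\<bar> \<ge> 1"
    have ud: "\<bar>u - \<theta>\<bar> \<le> d" and ur: "\<bar>u - \<theta>\<bar> < r" if "u \<in> {\<alpha>..\<beta>}" for u
      using that ab \<delta> d by auto
    have uc: "of_real u \<in> cball ?a d" if "u \<in> {\<alpha>..\<beta>}" for u
      using ud[OF that] by (simp add: dist_norm norm_minus_commute flip: of_real_diff)
    have "integral {\<alpha>..\<beta>} (\<lambda>u. cis (N * u) * exp (- \<i> * of_real t * E (of_real u)) * A (of_real u))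
        = integral {\<alpha>..\<beta>} (\<lambda>u. cis (N * u - t * e 0 u) * A (of_real u))"
    proof (rule integral_cong)
      fix u assume u: "u \<in> {\<alpha>..\<beta>}"
      have "E (of_real u) = of_real (e 0 u)" using e_eq[OF ur[OF u], of 0] by simp
      then have "exp (- \<i> * of_real t * E (of_real u)) = cis (- t * e 0 u)"
        by (simp add: cis_conv_exp mult_ac)
      then show "cis (N * u) * exp (- \<i> * of_real t * E (of_real u)) * A (of_real u)
          = cis (N * u - t * e 0 u) * A (of_real u)"
        by (simp add: cis_mult)
    qed
    also have "cmod \<dots> \<le> 2 * K * (10 / sqrt c + 22 * c powr (-1/3)) * \<bar>t\<bar> powr (-1/3)"
    proof (rule van_der_Corput_linear_phase[where ?e1.0 = "e 1" and ?e2.0 = "e 2" and ?e3.0 = "e 3"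
          and A' = "\<lambda>u. deriv A (of_real u)"])
      show "(e 0 has_real_derivative e 1 u) (at u within {\<alpha>..\<beta>})" if "u \<in> {\<alpha>..\<beta>}" for u
        using de[OF ur[OF that], of 0] by simp
      show "(e 1 has_real_derivative e 2 u) (at u within {\<alpha>..\<beta>})" if "u \<in> {\<alpha>..\<beta>}" for u
        using de[OF ur[OF that], of 1] by (simp add: numeral_2_eq_2)
      show "(e 2 has_real_derivative e 3 u) (at u within {\<alpha>..\<beta>})" if "u \<in> {\<alpha>..\<beta>}" for u
        using de[OF ur[OF that], of 2] by (simp add: numeral_3_eq_3)
      show "(\<forall>x\<in>{\<alpha>..\<beta>}. c \<le> \<bar>e 2 x\<bar>) \<or> (\<forall>x\<in>{\<alpha>..\<beta>}. c \<le> e 3 x) \<or> (\<forall>x\<in>{\<alpha>..\<beta>}. e 3 x \<le> - c)"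
        using ndc ud by blast
      show "((\<lambda>u. A (of_real u)) has_vector_derivative deriv A (of_real u)) (at u within {\<alpha>..\<beta>})"
        if "u \<in> {\<alpha>..\<beta>}" for u
        by (rule has_vector_derivative_of_real_comp[OF holomorphic_derivI[OF r(3) open_ball in_ball[OF ur[OF that]]]])
      show "continuous_on {\<alpha>..\<beta>} (\<lambda>u. deriv A (of_real u))"
      proof (rule continuous_on_compose2[OF holomorphic_on_imp_continuous_on[OF hA']])
        show "complex_of_real ` {\<alpha>..\<beta>} \<subseteq> ball ?a r" using in_ball ur by blast
      qed (intro continuous_intros)
      show "cmod (A (of_real u)) \<le> K" "cmod (deriv A (of_real u)) \<le> K" if "u \<in> {\<alpha>..\<beta>}" for u
        using K1[OF uc[OF that]] K2[OF uc[OF that]] by (auto simp: K_def)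
      show "\<beta> - \<alpha> \<le> 1" using ab \<delta> by linarith
    qed (use ab c t in auto)
    finally show "cmod (integral {\<alpha>..\<beta>} (\<lambda>u. cis (N * u) * exp (- \<i> * of_real t * E (of_real u)) * A (of_real u)))
      \<le> 2 * K * (10 / sqrt c + 22 * c powr (-1/3)) * \<bar>t\<bar> powr (-1/3)" .
  next
    fix \<alpha> \<beta> t N :: real
    assume ab: "\<theta> - \<delta> \<le> \<alpha>" "\<beta> \<le> \<theta> + \<delta>"
    have sub: "complex_of_real ` {\<alpha>..\<beta>} \<subseteq> ball ?a r"
    proof (rule image_subsetI)
      fix u assume "u \<in> {\<alpha>..\<beta>}"
      then show "of_real u \<in> ball ?a r" using ab \<delta> d by (intro in_ball) auto
    qed
    have cont: "continuous_on {\<alpha>..\<beta>} (\<lambda>u. F (complex_of_real u))" if "F holomorphic_on ball ?a r" for F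
      by (rule continuous_on_compose2[OF holomorphic_on_imp_continuous_on[OF that] _ sub])
        (intro continuous_intros)
    show "(\<lambda>u. cis (N * u) * exp (- \<i> * of_real t * E (of_real u)) * A (of_real u)) integrable_on {\<alpha>..\<beta>}"
      by (intro integrable_continuous_interval continuous_intros cont r)
  qed
qed


lemma analytic_poly_comp:
  assumes "E analytic_on {a}"
  shows "(\<lambda>z. poly q (E z)) analytic_on {a :: complex}"
proof -
  have "(\<lambda>z. poly q z) holomorphic_on UNIV" by (intro holomorphic_intros)
  then have "poly q analytic_on {E a}" by (intro holomorphic_on_imp_analytic_at[of _ UNIV]) auto
  then show ?thesis using analytic_on_compose[OF assms, of "poly q"] by (simp add: o_def)
qed

section \<open>Germs of bands and their amplitudes\<close>

context periodic_chain
begin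

text \<open>Only the germ at \<open>\<theta>\<close> is constrained; at a closed gap two analytic
  branches cross, so they do not follow the ordering of the eigenvalues.\<close>

definition branch :: "real \<Rightarrow> (complex \<Rightarrow> complex) \<Rightarrow> bool"
  where "branch \<theta> E \<longleftrightarrow> E analytic_on {of_real \<theta>} \<and>
    eventually (\<lambda>z. poly discr (E z) = 2 * cos z) (nhds (of_real \<theta>))"

text \<open>Invert \<open>discr\<close> locally and compose with \<open>2 * cos\<close>. Open gap
  edges are included, since there only the derivative of the cosine vanishes.\<close>

lemma simple_root_branch:
  assumes x: "poly discr x = 2 * cos (of_real \<theta>)" and d: "poly (pderiv discr) x \<noteq> 0"
  obtains E where "branch \<theta> E" "E (of_real \<theta>) = x"
proof -
  have "deriv (poly discr) x = poly (pderiv discr) x"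
    by (rule DERIV_imp_deriv) (rule poly_DERIV)
  moreover have an: "poly discr analytic_on {x}"
  proof -
    have "(\<lambda>z. poly discr z) holomorphic_on UNIV" by (intro holomorphic_intros)
    then show ?thesis by (intro holomorphic_on_imp_analytic_at[of _ UNIV]) auto
  qed
  ultimately obtain g where g: "g analytic_on {poly discr x}" "g (poly discr x) = x"
      "eventually (\<lambda>w. poly discr (g w) = w) (nhds (poly discr x))"
    using analytic_local_inverse[of "poly discr" x] d by metis
  show thesis
  proof (rule that)
    have an: "(\<lambda>z::complex. 2 * cos z) analytic_on {of_real \<theta>}" by (auto intro!: analytic_intros)
    show "branch \<theta> (\<lambda>z. g (2 * cos z))"
      unfolding branch_def
    proof
      show "(\<lambda>z. g (2 * cos z)) analytic_on {of_real \<theta>}"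
        using analytic_on_compose[OF an, of g] g(1) x by (simp add: o_def)
      show "eventually (\<lambda>z. poly discr (g (2 * cos z)) = 2 * cos z) (nhds (of_real \<theta>))"
        using g(3) unfolding x by (rule eventually_compose_filterlim) (rule tendsto_nhds_analytic[OF an])
    qed
    show "g (2 * cos (of_real \<theta>)) = x" using g(2) x by simp
  qed
qed

text \<open>
  At a closed gap \<open>discr\<close> touches \<open>\<plusminus> 2\<close> quadratically; extracting a square root of both sides of
  \<open>discr E = 2 cos z\<close> shows that the two bands cross there analytically.
\<close>

lemma double_root_branches:
  assumes x: "poly discr x = 2 * cos (of_real \<theta>)" and d: "poly (pderiv discr) x = 0"
  obtains E F where "branch \<theta> E" "branch \<theta> F" "E (of_real \<theta>) = x" "F (of_real \<theta>) = x"
    "eventually (\<lambda>z. E z \<noteq> F z) (at (of_real \<theta>))"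
    "order x (discr - [:2 * cos (of_real \<theta>):]) = 2"
proof -
  let ?a = "complex_of_real \<theta>"
  let ?Q = "discr - [:2 * cos ?a:]"
  \<comment> \<open>As \<open>sin \<theta> = 0\<close>, this is \<open>1\<close> or
    \<open>-1\<close>, and \<open>2 * cos z - 2 * \<epsilon> = - 4 * \<epsilon> * (sin ((z -
    \<theta>) / 2))^2\<close>.\<close>
  define \<epsilon> where "\<epsilon> = cos ?a"
  have sin0: "sin \<theta> = 0" and d2: "poly (pderiv (pderiv discr)) x \<noteq> 0"
    using discr_double_point[OF x d] by auto
  have sina: "sin ?a = 0" using sin0 by (simp add: sin_of_real)
  have \<epsilon>2: "\<epsilon> * \<epsilon> = 1"
    using sin_cos_squared_add[of ?a] sina by (simp add: \<epsilon>_def power2_eq_square)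
  have "poly ?Q x = 0" using x by simp
  then have "[:- x, 1:] dvd ?Q" by (simp only: poly_eq_0_iff_dvd)
  then obtain q1 where q1: "?Q = [:- x, 1:] * q1" by (rule dvdE)
  have dQ: "pderiv ?Q = pderiv discr" by (simp add: pderiv_diff pderiv_pCons)
  have "pderiv ?Q = [:- x, 1:] * pderiv q1 + q1"
    unfolding q1 pderiv_mult by (simp add: pderiv_pCons)
  then have "poly q1 x = 0" using d unfolding dQ by simp
  then have "[:- x, 1:] dvd q1" by (simp only: poly_eq_0_iff_dvd)
  then obtain q where q: "q1 = [:- x, 1:] * q" by (rule dvdE)
  have Qq: "?Q = [:- x, 1:] ^ 2 * q" unfolding q1 q power2_eq_square by (simp only: mult.assoc)
  have "pderiv (pderiv ?Q) = pderiv (pderiv ([:- x, 1:] * ([:- x, 1:] * q)))" unfolding q1 q ..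
  then have "poly (pderiv (pderiv ?Q)) x = 2 * poly q x"
    unfolding pderiv_mult by (simp add: pderiv_mult pderiv_add pderiv_pCons pderiv_diff pderiv_smult)
  then have qx: "poly q x \<noteq> 0" using d2 unfolding dQ by auto
  have discr_eq: "poly discr z = 2 * \<epsilon> + (z - x)\<^sup>2 * poly q z" for z
    using arg_cong[OF Qq, of "\<lambda>r. poly r z"] by (simp add: \<epsilon>_def diff_eq_eq add.commute)
  \<comment> \<open>The factor \<open>- \<epsilon>\<close> brings the equation into the form
    \<open>(E - x)^2 * h E = (2 * sin ((z - \<theta>) / 2))^2\<close>; as
    \<open>h x \<noteq> 0\<close>, \<open>h\<close> has a holomorphic square root near
    \<open>x\<close>.\<close>
  define h where "h = (\<lambda>z. - \<epsilon> * poly q z)"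
  have hx: "h x \<noteq> 0" using qx \<epsilon>2 by (auto simp: h_def)
  have hcont: "isCont h x" unfolding h_def by (intro continuous_intros)
  obtain r where r: "r > 0" "\<And>z. z \<in> ball x r \<Longrightarrow> h z \<noteq> 0"
    using continuous_at_avoid[OF hcont, of 0] hx by (auto simp: dist_commute)
  have "h holomorphic_on ball x r" unfolding h_def by (intro holomorphic_intros)
  then obtain \<psi> where \<psi>: "\<psi> holomorphic_on ball x r" "\<And>z. z \<in> ball x r \<Longrightarrow> h z = (\<psi> z)\<^sup>2"
    using contractible_imp_holomorphic_sqrt[of h "ball x r"] r convex_imp_contractible[OF convex_ball] by metis
  have \<psi>x: "\<psi> x \<noteq> 0" using \<psi>(2)[of x] hx r by auto
  define f where "f = (\<lambda>z. (z - x) * \<psi> z)"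
  have \<psi>a: "\<psi> analytic_on {x}" using \<psi>(1) r(1) by (auto simp: analytic_on_def)
  have fa: "f analytic_on {x}" unfolding f_def by (intro analytic_intros \<psi>a)
  have "(\<psi> has_field_derivative deriv \<psi> x) (at x)"
    by (rule holomorphic_derivI[OF \<psi>(1) open_ball]) (use r in simp)
  then have "(f has_field_derivative \<psi> x) (at x)"
    unfolding f_def by (auto intro!: derivative_eq_intros)
  then have "deriv f x \<noteq> 0" using \<psi>x by (simp add: DERIV_imp_deriv)
  moreover have f0: "f x = 0" by (simp add: f_def)
  ultimately obtain g where g: "g analytic_on {0}" "g 0 = x" "eventually (\<lambda>w. f (g w) = w) (nhds 0)"
    using analytic_local_inverse[OF fa] by metis
  have gr: "eventually (\<lambda>w. g w \<in> ball x r) (nhds 0)"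
    using tendsto_nhds_analytic[OF g(1)] r(1) unfolding g(2) by (intro topological_tendstoD) auto
  \<comment> \<open>The two signs of the root, \<open>s = 2\<close> and \<open>s = -2\<close>, give
    the two bands; the second conjunct serves to tell them apart.\<close>
  have half: "eventually (\<lambda>z. poly discr (g (s * sin ((z - ?a) / 2))) = 2 * cos z
      \<and> f (g (s * sin ((z - ?a) / 2))) = s * sin ((z - ?a) / 2)) (nhds ?a)"
    if s: "s = 2 \<or> s = -2" for s :: complex
  proof -
    have an: "(\<lambda>z. s * sin ((z - ?a) / 2)) analytic_on {?a}" by (auto intro!: analytic_intros)
    have lim: "filterlim (\<lambda>z. s * sin ((z - ?a) / 2)) (nhds 0) (nhds ?a)"
      using tendsto_nhds_analytic[OF an] by simp
    have "eventually (\<lambda>w. f (g w) = w \<and> g w \<in> ball x r) (nhds 0)"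
      using g(3) gr by eventually_elim auto
    from eventually_compose_filterlim[OF this lim] show ?thesis
    proof eventually_elim
      case (elim z)
      let ?w = "s * sin ((z - ?a) / 2)"
      have "(f u)\<^sup>2 = - \<epsilon> * ((u - x)\<^sup>2 * poly q u)" if "u \<in> ball x r" for u
        using \<psi>(2)[OF that] by (simp add: f_def power_mult_distrib h_def flip: \<psi>(2)[OF that])
      then have "(f (g ?w))\<^sup>2 = - \<epsilon> * ((g ?w - x)\<^sup>2 * poly q (g ?w))" using elim by blast
      then have e: "?w\<^sup>2 = - \<epsilon> * ((g ?w - x)\<^sup>2 * poly q (g ?w))" using elim by (simp only:)
      have "?w\<^sup>2 = 4 * (sin ((z - ?a) / 2))\<^sup>2" using s by (auto simp: power_mult_distrib)
      also have "\<dots> = 2 * (1 - cos (z - ?a))"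
      proof -
        have e2: "2 * ((z - ?a) / 2) = z - ?a" by simp
        show ?thesis using cos_double_sin[of "(z - ?a) / 2"] unfolding e2 by simp
      qed
      also have "cos (z - ?a) = \<epsilon> * cos z"
        using sina by (simp add: cos_diff \<epsilon>_def)
      finally have "\<epsilon> * (- \<epsilon> * ((g ?w - x)\<^sup>2 * poly q (g ?w))) = \<epsilon> * (2 * (1 - \<epsilon> * cos z))"
        using e by simp
      then have "- (\<epsilon> * \<epsilon>) * ((g ?w - x)\<^sup>2 * poly q (g ?w)) = 2 * \<epsilon> - 2 * (\<epsilon> * \<epsilon>) * cos z"
        by (simp add: algebra_simps)
      then have "(g ?w - x)\<^sup>2 * poly q (g ?w) = 2 * cos z - 2 * \<epsilon>"
        unfolding \<epsilon>2 by (simp add: algebra_simps minus_equation_iff)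
      then show ?case using elim discr_eq[of "g ?w"] by simp
    qed
  qed
  have br: "branch \<theta> (\<lambda>z. g (s * sin ((z - ?a) / 2)))" if s: "s = 2 \<or> s = -2" for s :: complex
    unfolding branch_def
  proof
    have an: "(\<lambda>z. s * sin ((z - ?a) / 2)) analytic_on {?a}" by (auto intro!: analytic_intros)
    show "(\<lambda>z. g (s * sin ((z - ?a) / 2))) analytic_on {?a}"
      using analytic_on_compose[OF an, of g] g(1) by (simp add: o_def)
    show "eventually (\<lambda>z. poly discr (g (s * sin ((z - ?a) / 2))) = 2 * cos z) (nhds ?a)"
      using half[OF s] by eventually_elim auto
  qed
  have sin_ne: "eventually (\<lambda>z. sin ((z - ?a) / 2) \<noteq> 0) (at ?a)"
  proof -
    have an: "(\<lambda>z. sin ((z - ?a) / 2)) analytic_on {?a}" by (auto intro!: analytic_intros)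
    have "((\<lambda>z. sin ((z - ?a) / 2)) has_field_derivative 1/2) (at ?a)"
      by (auto intro!: derivative_eq_intros)
    then have "deriv (\<lambda>z. sin ((z - ?a) / 2)) ?a = 1/2" by (rule DERIV_imp_deriv)
    with analytic_factor_zero[OF an] obtain k where k: "k analytic_on {?a}" "k ?a = 1/2"
      "eventually (\<lambda>z. sin ((z - ?a) / 2) = (z - ?a) * k z) (nhds ?a)" by auto
    have "eventually (\<lambda>z. k z \<noteq> 0) (nhds ?a)"
      by (rule eventually_ne_of_analytic[OF k(1)]) (use k(2) in auto)
    with k(3) have "eventually (\<lambda>z. z \<noteq> ?a \<longrightarrow> sin ((z - ?a) / 2) \<noteq> 0) (nhds ?a)"
      by eventually_elim auto
    then show ?thesis by (simp add: eventually_at_filter)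
  qed
  show thesis
  proof (rule that[of "\<lambda>z. g (2 * sin ((z - ?a) / 2))" "\<lambda>z. g (- 2 * sin ((z - ?a) / 2))"])
    show "branch \<theta> (\<lambda>z. g (2 * sin ((z - ?a) / 2)))" "branch \<theta> (\<lambda>z. g (- 2 * sin ((z - ?a) / 2)))"
      by (rule br; simp)+
    show "eventually (\<lambda>z. g (2 * sin ((z - ?a) / 2)) \<noteq> g (- 2 * sin ((z - ?a) / 2))) (at ?a)"
    proof -
      have "eventually (\<lambda>z. z \<noteq> ?a \<longrightarrow> sin ((z - ?a) / 2) \<noteq> 0) (nhds ?a)"
        using sin_ne by (simp add: eventually_at_filter)
      with half[OF disjI1[OF refl]] half[OF disjI2[OF refl]]
      have "eventually (\<lambda>z. z \<noteq> ?a \<longrightarrow> g (2 * sin ((z - ?a) / 2)) \<noteq> g (- 2 * sin ((z - ?a) / 2))) (nhds ?a)"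
      proof eventually_elim
        case (elim z)
        show ?case
        proof (intro impI notI)
          assume "z \<noteq> ?a" and e: "g (2 * sin ((z - ?a) / 2)) = g (- 2 * sin ((z - ?a) / 2))"
          have "2 * sin ((z - ?a) / 2) = f (g (2 * sin ((z - ?a) / 2)))" using elim(1) by (simp only:)
          also have "\<dots> = - 2 * sin ((z - ?a) / 2)" unfolding e using elim(2) by (simp only:)
          finally show False using elim(3) \<open>z \<noteq> ?a\<close> by simp
        qed
      qed
      then show ?thesis by (simp add: eventually_at_filter)
    qed
    show "order x ?Q = 2" unfolding Qq by (rule order_linear_power_mult[OF qx])
  qed (simp_all add: g)
qed

lemma branch_at:
  assumes "branch \<theta> E"
  shows "poly discr (E (of_real \<theta>)) = 2 * cos (of_real \<theta>)"
  using assms unfolding branch_def by (auto dest: eventually_nhds_x_imp_x)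

lemma branch_ball:
  assumes "branch \<theta> E"
  obtains r where "r > 0" "E holomorphic_on ball (of_real \<theta>) r"
    "\<And>z. z \<in> ball (of_real \<theta>) r \<Longrightarrow> poly discr (E z) = 2 * cos z"
proof -
  obtain ra where ra: "ra > 0" "E holomorphic_on ball (of_real \<theta>) ra"
    using assms by (auto simp: branch_def analytic_on_def)
  obtain rb where rb: "rb > 0" "\<And>z. dist z (of_real \<theta>) < rb \<Longrightarrow> poly discr (E z) = 2 * cos z"
    using assms by (auto simp: branch_def eventually_nhds_metric)
  show thesis
    by (rule that[of "min ra rb"]) (use ra rb in \<open>auto simp: dist_commute intro: holomorphic_on_subset\<close>)
qed

lemma branch_real:
  assumes "branch \<theta> E"
  obtains r where "r > 0" "\<And>u. \<bar>u - \<theta>\<bar> < r \<Longrightarrow> E (of_real u) \<in> \<real>"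
    "\<And>u. \<bar>u - \<theta>\<bar> < r \<Longrightarrow> poly discr (E (of_real u)) = 2 * cos (of_real u)"
proof -
  obtain r where r: "r > 0" "\<And>z. z \<in> ball (of_real \<theta>) r \<Longrightarrow> poly discr (E z) = 2 * cos z"
    using branch_ball[OF assms] by metis
  have eq: "poly discr (E (of_real u)) = 2 * cos (of_real u)" if "\<bar>u - \<theta>\<bar> < r" for u
    using that by (intro r(2)) (simp add: dist_norm norm_minus_commute flip: of_real_diff)
  have re: "E (of_real u) \<in> \<real>" if "\<bar>u - \<theta>\<bar> < r" for u
    by (rule discr_real_rooted) (use eq[OF that] in \<open>auto simp: cos_of_real abs_mult\<close>)
  show thesis by (rule that[OF r(1) re eq])
qed

lemma branch_nondegenerate:
  assumes "branch \<theta> E"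
  shows "(deriv ^^ 2) E (of_real \<theta>) \<noteq> 0 \<or> (deriv ^^ 3) E (of_real \<theta>) \<noteq> 0"
  by (rule band_nondegenerate[of discr])
    (use assms p2 discr_real_rooted in \<open>auto simp: branch_def discr_degree\<close>)

text \<open>The chain rule trades the denominator of the amplitudes for \<open>sin z\<close>, whose
  zeros are simple.\<close>

lemma branch_discr_deriv:
  assumes "branch \<theta> E"
  shows "eventually (\<lambda>z. poly (pderiv discr) (E z) * deriv E z = - 2 * sin z) (nhds (of_real \<theta>))"
proof -
  obtain r where r: "r > 0" "E holomorphic_on ball (of_real \<theta>) r"
    "\<And>z. z \<in> ball (of_real \<theta>) r \<Longrightarrow> poly discr (E z) = 2 * cos z"
    by (rule branch_ball[OF assms]) blast
  have "poly (pderiv discr) (E z) * deriv E z = - 2 * sin z" if z: "z \<in> ball (of_real \<theta>) r" for z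
  proof -
    have "((\<lambda>z. poly discr (E z)) has_field_derivative poly (pderiv discr) (E z) * deriv E z) (at z)"
      by (rule DERIV_chain2[OF poly_DERIV holomorphic_derivI[OF r(2) open_ball z]])
    moreover have "((\<lambda>z. 2 * cos z) has_field_derivative - 2 * sin z) (at z)"
      by (auto intro!: derivative_eq_intros)
    then have "((\<lambda>z. poly discr (E z)) has_field_derivative - 2 * sin z) (at z)"
      by (rule has_field_derivative_transform_within_open[OF _ open_ball z]) (use r in simp)
    ultimately show ?thesis by (rule DERIV_unique)
  qed
  then show ?thesis
    using eventually_nhds_in_open[OF open_ball, of "of_real \<theta>" "of_real \<theta>" r] r(1)
    by (auto elim!: eventually_mono)
qed

text \<open>At a double root the quotient is \<open>0 / 0\<close>. Expanding it by
  \<open>deriv E z\<close> turns the denominator into \<open>- 2 * sin z\<close>, with a simple zero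
  at \<open>\<theta>\<close>, where the numerator also vanishes by
  \<open>discr_double_point\<close>; one factor \<open>z - \<theta>\<close> cancels. The power of
  the multiplier depending on the cell is left out, so that the amplitudes form a finite
  family.\<close>

lemma branch_amplitude:
  assumes E: "branch \<theta> E" and k: "k \<le> p"
  obtains A where "A analytic_on {of_real \<theta>}"
    "eventually (\<lambda>z. (poly (rsol k) (E z) + exp (\<i> * z) * poly (lsol k) (E z)) / poly (pderiv discr) (E z) = A z)
      (at (of_real \<theta>))"
proof -
  let ?a = "complex_of_real \<theta>"
  have an: "E analytic_on {?a}" using E by (simp add: branch_def)
  define f where "f = (\<lambda>z. poly (rsol k) (E z) + exp (\<i> * z) * poly (lsol k) (E z))"
  have fa: "f analytic_on {?a}"
    unfolding f_def by (intro analytic_intros analytic_poly_comp[OF an])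
  have ga: "(\<lambda>z. poly (pderiv discr) (E z)) analytic_on {?a}" by (rule analytic_poly_comp[OF an])
  show thesis
  proof (cases "poly (pderiv discr) (E ?a) = 0")
    case False
    then have "(\<lambda>z. f z / poly (pderiv discr) (E z)) analytic_on {?a}"
      by (intro analytic_on_divide fa ga) auto
    then show thesis by (rule that) (simp add: f_def)
  next
    case True
    have s0: "sin \<theta> = 0" and b0: "poly (bloch (cis \<theta>) n) (E ?a) = 0" for n
      using discr_double_point[OF branch_at[OF E] True] by auto
    have "f ?a = poly (bloch (cis \<theta>) (int k)) (E ?a)"
      using bloch_eq[OF k, of "cis \<theta>" 0] by (simp add: f_def cis_conv_exp)
    then have f0: "f ?a = 0" using b0 by simp
    obtain f1 where f1: "f1 analytic_on {?a}" "eventually (\<lambda>z. f z = (z - ?a) * f1 z) (nhds ?a)"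
      using analytic_factor_zero[OF fa f0] by metis
    have sa: "sin analytic_on {?a}" by (auto intro!: analytic_intros)
    have "deriv sin ?a = cos ?a" by (rule DERIV_imp_deriv) (rule DERIV_sin)
    moreover have sina: "sin ?a = 0" using s0 by (simp add: sin_of_real)
    ultimately obtain s1 where s1: "s1 analytic_on {?a}" "s1 ?a = cos ?a"
       "eventually (\<lambda>z. sin z = (z - ?a) * s1 z) (nhds ?a)"
      using analytic_factor_zero[OF sa] by metis
    have s1a: "s1 ?a \<noteq> 0"
      using sin_cos_squared_add[of ?a] sina s1(2) by auto
    have s1n: "eventually (\<lambda>z. s1 z \<noteq> 0) (nhds ?a)"
      by (rule eventually_ne_of_analytic[OF s1(1)]) (use s1a in auto)
    have "(\<lambda>z. - (f1 z * deriv E z) / (2 * s1 z)) analytic_on {?a}"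
      by (intro analytic_intros f1(1) s1(1) analytic_deriv[OF an]) (use s1a in auto)
    moreover have "eventually (\<lambda>z. z \<noteq> ?a \<longrightarrow> f z / poly (pderiv discr) (E z) = - (f1 z * deriv E z) / (2 * s1 z)) (nhds ?a)"
      using f1(2) s1(3) s1n branch_discr_deriv[OF E]
    proof eventually_elim
      case (elim z)
      show ?case
      proof
        assume z: "z \<noteq> ?a"
        have e: "poly (pderiv discr) (E z) * deriv E z = (z - ?a) * (- 2 * s1 z)"
          using elim by simp
        then have nz: "poly (pderiv discr) (E z) \<noteq> 0" using z elim by auto
        have "f z * (2 * s1 z) = - (f1 z * ((z - ?a) * (- 2 * s1 z)))"
          using elim(1) by simp
        also have "\<dots> = - (f1 z * deriv E z) * poly (pderiv discr) (E z)"
          unfolding e[symmetric] by simp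
        finally show "f z / poly (pderiv discr) (E z) = - (f1 z * deriv E z) / (2 * s1 z)"
          using nz elim(3) by (subst frac_eq_eq) auto
      qed
    qed
    ultimately show thesis
      by (intro that) (auto simp: eventually_at_filter f_def)
  qed
qed

text \<open>Every root carries as many branches as its order, one or two, and the orders add up to
  the degree \<open>p\<close>. Distinctness off \<open>\<theta>\<close> is included because
  interpolation needs \<open>p\<close> different eigenvalues.\<close>

lemma branches_exist:
  "\<exists>B. finite B \<and> card B = p \<and> (\<forall>E\<in>B. branch \<theta> E) \<and>
    (\<forall>E\<in>B. \<forall>F\<in>B. E \<noteq> F \<longrightarrow> eventually (\<lambda>z. E z \<noteq> F z) (at (of_real \<theta>)))"
proof -
  let ?a = "complex_of_real \<theta>"
  define Q where "Q = discr - [:2 * cos ?a:]"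
  define Z where "Z = {x. poly Q x = 0}"
  have cQ: "coeff Q p = 1"
    using discr_degree p2 by (simp add: Q_def coeff_pCons split: nat.split)
  have "degree Q \<le> p"
    unfolding Q_def by (rule degree_diff_le) (use discr_degree in auto)
  with cQ have degQ: "degree Q = p"
    by (intro antisym le_degree) auto
  have Q0: "Q \<noteq> 0" using cQ by auto
  have finZ: "finite Z" unfolding Z_def by (rule poly_roots_finite[OF Q0])
  have sumZ: "(\<Sum>x\<in>Z. order x Q) = p"
    using sum_order_eq_degree_complex[OF Q0] by (simp add: Z_def degQ)
  have "\<exists>B. finite B \<and> card B = order x Q \<and> (\<forall>E\<in>B. branch \<theta> E \<and> E ?a = x) \<and>
    (\<forall>E\<in>B. \<forall>F\<in>B. E \<noteq> F \<longrightarrow> eventually (\<lambda>z. E z \<noteq> F z) (at ?a))" if x: "x \<in> Z" for x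
  proof (cases "poly (pderiv discr) x = 0")
    case False
    have dx: "poly discr x = 2 * cos ?a" using x by (simp add: Z_def Q_def)
    obtain E where E: "branch \<theta> E" "E ?a = x" using simple_root_branch[OF dx False] .
    have "[:- x, 1:] dvd Q" using x by (simp add: Z_def poly_eq_0_iff_dvd)
    then obtain q where q: "Q = [:- x, 1:] * q" by (rule dvdE)
    have "pderiv Q = [:- x, 1:] * pderiv q + q"
      unfolding q pderiv_mult by (simp add: pderiv_pCons)
    then have "poly q x \<noteq> 0" using False by (simp add: Q_def pderiv_diff pderiv_pCons)
    then have "order x Q = 1" using order_linear_power_mult[of q x 1] q by simp
    then show ?thesis using E by (intro exI[of _ "{E}"]) auto
  next
    case True
    have dx: "poly discr x = 2 * cos ?a" using x by (simp add: Z_def Q_def)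
    obtain E F where EF: "branch \<theta> E" "branch \<theta> F" "E ?a = x" "F ?a = x"
      "eventually (\<lambda>z. E z \<noteq> F z) (at ?a)" "order x Q = 2"
      unfolding Q_def by (rule double_root_branches[OF dx True])
    have "E \<noteq> F"
    proof
      assume "E = F"
      then have "eventually (\<lambda>z. False) (at ?a)" using EF(5) by simp
      then show False by (simp add: eventually_False)
    qed
    moreover have "eventually (\<lambda>z. F z \<noteq> E z) (at ?a)" using EF(5) by eventually_elim auto
    ultimately show ?thesis using EF by (intro exI[of _ "{E, F}"]) auto
  qed
  then obtain B where B: "\<And>x. x \<in> Z \<Longrightarrow> finite (B x) \<and> card (B x) = order x Q \<and>
    (\<forall>E\<in>B x. branch \<theta> E \<and> E ?a = x) \<and>
    (\<forall>E\<in>B x. \<forall>F\<in>B x. E \<noteq> F \<longrightarrow> eventually (\<lambda>z. E z \<noteq> F z) (at ?a))" by metis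
  have B1: "finite (B x)" "card (B x) = order x Q" if "x \<in> Z" for x
    using B[OF that] by auto
  have B2: "branch \<theta> E" "E ?a = x" if "x \<in> Z" "E \<in> B x" for x E
    using B[OF that(1)] that(2) by auto
  have B3: "eventually (\<lambda>z. E z \<noteq> F z) (at ?a)" if "x \<in> Z" "E \<in> B x" "F \<in> B x" "E \<noteq> F" for x E F
    using B[OF that(1)] that(2-) by auto
  show ?thesis
  proof (intro exI[of _ "\<Union>x\<in>Z. B x"] conjI ballI impI)
    show "finite (\<Union>x\<in>Z. B x)" using finZ B1(1) by (rule finite_UN_I)
    have "card (\<Union>x\<in>Z. B x) = (\<Sum>x\<in>Z. card (B x))"
    proof (rule card_UN_disjoint[OF finZ])
      show "\<forall>x\<in>Z. finite (B x)" using B1(1) by simp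
      have False if "x \<in> Z" "y \<in> Z" "x \<noteq> y" "E \<in> B x" "E \<in> B y" for x y E
        using B2(2)[OF that(1,4)] B2(2)[OF that(2,5)] that(3) by simp
      then show "\<forall>x\<in>Z. \<forall>y\<in>Z. x \<noteq> y \<longrightarrow> B x \<inter> B y = {}" by auto
    qed
    also have "\<dots> = p" using B1(2) sumZ by simp
    finally show "card (\<Union>x\<in>Z. B x) = p" .
    show "branch \<theta> E" if "E \<in> (\<Union>x\<in>Z. B x)" for E using that B2(1) by auto
    fix E F assume EF: "E \<in> (\<Union>x\<in>Z. B x)" "F \<in> (\<Union>x\<in>Z. B x)" "E \<noteq> F"
    obtain x where x: "x \<in> Z" "E \<in> B x" using EF(1) by auto
    obtain y where y: "y \<in> Z" "F \<in> B y" using EF(2) by auto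
    show "eventually (\<lambda>z. E z \<noteq> F z) (at ?a)"
    proof (cases "x = y")
      case True
      then show ?thesis using B3 x y EF(3) by simp
    next
      case False
      have "E analytic_on {?a}" "F analytic_on {?a}" "E ?a \<noteq> F ?a"
        using B2[OF x] B2[OF y] False by (auto simp: branch_def)
      from eventually_ne_of_analytic[OF this] show ?thesis
        by (simp add: eventually_nhds_conv_at)
    qed
  qed
qed

end

section \<open>The dispersive estimate\<close>

lemma eventually_at_of_real:
  assumes "eventually P (at (complex_of_real \<theta>))"
  shows "eventually (\<lambda>u. P (of_real u)) (at \<theta>)"
proof (rule eventually_compose_filterlim[OF assms])
  show "filterlim complex_of_real (at (of_real \<theta>)) (at \<theta>)"
    by (rule filterlim_atI) (auto intro!: tendsto_eq_intros simp: eventually_at_filter)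
qed

context periodic_chain
begin

lemma fibre_prop_eq_sum:
  assumes Z: "finite Z" "card Z = p" "\<And>z. z \<in> Z \<Longrightarrow> poly discr z = 2 * cos (of_real u)"
  shows "fibre_prop t n u
    = (\<Sum>z\<in>Z. exp (- \<i> * of_real t * z) * (poly (bloch (cis u) n) z / poly (pderiv discr) z))"
proof -
  let ?c = "- \<i> * of_real t :: complex"
  have "poly discr z = cis u + inverse (cis u)" if "z \<in> Z" for z
    using Z(3)[OF that] unfolding cos_of_real by (simp add: complex_eq_iff)
  then have h: "(hop V ^^ k) (comb (cis u)) n
      = (\<Sum>z\<in>Z. z ^ k * poly (bloch (cis u) n) z / poly (pderiv discr) z)" for k
    using hop_funpow_comb[of "cis u" Z k] Z by simp
  have "(\<lambda>k. \<Sum>z\<in>Z. ((?c * z) ^ k /\<^sub>R fact k) * (poly (bloch (cis u) n) z / poly (pderiv discr) z))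
      sums (\<Sum>z\<in>Z. exp (?c * z) * (poly (bloch (cis u) n) z / poly (pderiv discr) z))"
    by (intro sums_sum sums_mult2 exp_converges)
  moreover have "(\<Sum>z\<in>Z. ((?c * z) ^ k /\<^sub>R fact k) * (poly (bloch (cis u) n) z / poly (pderiv discr) z))
      = ?c ^ k / fact k * (hop V ^^ k) (comb (cis u)) n" for k
    unfolding h sum_distrib_left
    by (intro sum.cong refl) (simp only: power_mult_distrib scaleR_conv_of_real, simp add: field_simps)
  ultimately have "(\<lambda>k. ?c ^ k / fact k * (hop V ^^ k) (comb (cis u)) n)
      sums (\<Sum>z\<in>Z. exp (?c * z) * (poly (bloch (cis u) n) z / poly (pderiv discr) z))"
    by (simp only:)
  from sums_unique[OF this, symmetric] show ?thesis unfolding fibre_prop_def .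
qed

text \<open>A single existential statement, from which amplitude, radius and constant can be chosen
  for all branches and residues at once.\<close>

lemma branch_oscillatory_bound:
  assumes E: "branch \<theta> E" and k: "k \<le> p"
  shows "\<exists>A \<delta> C. \<delta> > 0 \<and>
    eventually (\<lambda>z. (poly (rsol k) (E z) + exp (\<i> * z) * poly (lsol k) (E z)) / poly (pderiv discr) (E z) = A z)
      (at (of_real \<theta>)) \<and>
    (\<forall>\<alpha> \<beta> t N. \<theta> - \<delta> \<le> \<alpha> \<longrightarrow> \<alpha> \<le> \<beta> \<longrightarrow> \<beta> \<le> \<theta> + \<delta> \<longrightarrow> \<bar>t\<bar> \<ge> 1 \<longrightarrow>
      cmod (integral {\<alpha>..\<beta>} (\<lambda>u. cis (N * u) * exp (- \<i> * of_real t * E (of_real u)) * A (of_real u)))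
        \<le> C * \<bar>t\<bar> powr (-1/3)) \<and>
    (\<forall>\<alpha> \<beta> t N. \<theta> - \<delta> \<le> \<alpha> \<longrightarrow> \<beta> \<le> \<theta> + \<delta> \<longrightarrow>
      (\<lambda>u. cis (N * u) * exp (- \<i> * of_real t * E (of_real u)) * A (of_real u)) integrable_on {\<alpha>..\<beta>})"
proof -
  have an: "E analytic_on {of_real \<theta>}" using E by (simp add: branch_def)
  obtain A where A: "A analytic_on {of_real \<theta>}"
    "eventually (\<lambda>z. (poly (rsol k) (E z) + exp (\<i> * z) * poly (lsol k) (E z)) / poly (pderiv discr) (E z) = A z)
      (at (of_real \<theta>))"
    by (rule branch_amplitude[OF E k])
  obtain r0 where r0: "r0 > 0" "\<And>u. \<bar>u - \<theta>\<bar> < r0 \<Longrightarrow> E (of_real u) \<in> \<real>"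
    by (rule branch_real[OF E]) blast
  show ?thesis
    by (rule local_oscillatory_bound[OF an A(1) r0 branch_nondegenerate[OF E]])
      (use A(2) in blast)+
qed

text \<open>In \<open>n = N * int p + int k\<close> the residue \<open>k\<close> takes
  \<open>p\<close> values, and \<open>N\<close> is the frequency of a factor in which the branch
  estimates are uniform. Finitely many pairs of branch and residue thus yield one radius and one
  constant for all \<open>n\<close>.\<close>

lemma fibre_prop_local_bound:
  "\<exists>\<delta>>0. \<exists>C. \<forall>\<alpha> \<beta> t n. \<theta> - \<delta> \<le> \<alpha> \<longrightarrow> \<alpha> \<le> \<beta> \<longrightarrow> \<beta> \<le> \<theta> + \<delta> \<longrightarrow> \<bar>t\<bar> \<ge> 1 \<longrightarrow>
    cmod (integral {\<alpha>..\<beta>} (fibre_prop t n)) \<le> C * \<bar>t\<bar> powr (-1/3)"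
proof -
  let ?a = "complex_of_real \<theta>"
  from branches_exist[of \<theta>] obtain B where BB: "finite B" "card B = p" "\<forall>E\<in>B. branch \<theta> E"
    "\<forall>E\<in>B. \<forall>F\<in>B. E \<noteq> F \<longrightarrow> eventually (\<lambda>z. E z \<noteq> F z) (at ?a)"
    by (elim exE conjE)
  note B = BB(1,2) bspec[OF BB(3)]
  let ?I = "B \<times> {..<p}"
  define good where "good = (\<lambda>i A \<delta> C. \<delta> > (0::real) \<and>
    eventually (\<lambda>z. (poly (rsol (snd i)) (fst i z) + exp (\<i> * z) * poly (lsol (snd i)) (fst i z))
      / poly (pderiv discr) (fst i z) = A z) (at ?a) \<and>
    (\<forall>\<alpha> \<beta> t N. \<theta> - \<delta> \<le> \<alpha> \<longrightarrow> \<alpha> \<le> \<beta> \<longrightarrow> \<beta> \<le> \<theta> + \<delta> \<longrightarrow> \<bar>t\<bar> \<ge> 1 \<longrightarrow>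
      cmod (integral {\<alpha>..\<beta>} (\<lambda>u. cis (N * u) * exp (- \<i> * of_real t * fst i (of_real u)) * A (of_real u)))
        \<le> C * \<bar>t\<bar> powr (-1/3)) \<and>
    (\<forall>\<alpha> \<beta> t N. \<theta> - \<delta> \<le> \<alpha> \<longrightarrow> \<beta> \<le> \<theta> + \<delta> \<longrightarrow>
      (\<lambda>u. cis (N * u) * exp (- \<i> * of_real t * fst i (of_real u)) * A (of_real u)) integrable_on {\<alpha>..\<beta>}))"
  have "\<exists>A \<delta> C. good i A \<delta> C" if "i \<in> ?I" for i
    unfolding good_def
    by (rule branch_oscillatory_bound) (use that B(3) in auto)
  then obtain A \<delta> C where good: "\<And>i. i \<in> ?I \<Longrightarrow> good i (A i) (\<delta> i) (C i)" by metis
  have finI: "finite ?I" using B(1) by simp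
  \<comment> \<open>What the interpolation formula needs at a point. It is claimed only off
    \<open>\<theta>\<close>, where distinct branches may meet.\<close>
  define split where "split = (\<lambda>z. (\<forall>i\<in>?I. (poly (rsol (snd i)) (fst i z) + exp (\<i> * z) * poly (lsol (snd i)) (fst i z))
      / poly (pderiv discr) (fst i z) = A i z) \<and> (\<forall>E\<in>B. \<forall>F\<in>B. E \<noteq> F \<longrightarrow> E z \<noteq> F z)
      \<and> (\<forall>E\<in>B. poly discr (E z) = 2 * cos z))"
  have "eventually (\<lambda>z. \<forall>i\<in>?I. (poly (rsol (snd i)) (fst i z) + exp (\<i> * z) * poly (lsol (snd i)) (fst i z))
      / poly (pderiv discr) (fst i z) = A i z) (at ?a)"
    using good finI by (intro eventually_ball_finite ballI) (auto simp: good_def)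
  moreover have "eventually (\<lambda>z. \<forall>E\<in>B. \<forall>F\<in>B. E \<noteq> F \<longrightarrow> E z \<noteq> F z) (at ?a)"
  proof (intro eventually_ball_finite[OF B(1)] ballI)
    fix E F assume "E \<in> B" "F \<in> B"
    then show "eventually (\<lambda>z. E \<noteq> F \<longrightarrow> E z \<noteq> F z) (at ?a)"
      using BB(4) by (cases "E = F") simp_all
  qed
  moreover have "eventually (\<lambda>z. \<forall>E\<in>B. poly discr (E z) = 2 * cos z) (at ?a)"
  proof (intro eventually_ball_finite[OF B(1)] ballI)
    fix E assume "E \<in> B"
    then show "eventually (\<lambda>z. poly discr (E z) = 2 * cos z) (at ?a)"
      using B(3) by (simp add: branch_def eventually_nhds_conv_at)
  qed
  ultimately have "eventually split (at ?a)"
    unfolding split_def eventually_conj_iff by (intro conjI)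
  then have "eventually (\<lambda>u. split (of_real u)) (at \<theta>)" by (rule eventually_at_of_real)
  then obtain d where d: "d > 0" and near: "\<And>u. u \<noteq> \<theta> \<Longrightarrow> \<bar>u - \<theta>\<bar> < d \<Longrightarrow> split (of_real u)"
    by (auto simp: eventually_at dist_real_def)
  have fibre: "fibre_prop t (N * int p + int k) u
    = (\<Sum>E\<in>B. cis (of_int N * u) * exp (- \<i> * of_real t * E (of_real u)) * A (E, k) (of_real u))"
    if u: "u \<noteq> \<theta>" "\<bar>u - \<theta>\<bar> < d" and k: "k < p" for t N k u
  proof -
    let ?e = "\<lambda>E. E (complex_of_real u)"
    note near = near[OF u, unfolded split_def]
    have inj: "inj_on ?e B" using near by (auto simp: inj_on_def)
    have "fibre_prop t (N * int p + int k) u = (\<Sum>z\<in>?e ` B. exp (- \<i> * of_real t * z) *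
        (poly (bloch (cis u) (N * int p + int k)) z / poly (pderiv discr) z))"
      by (rule fibre_prop_eq_sum) (use near B inj in \<open>auto simp: card_image\<close>)
    also have "\<dots> = (\<Sum>E\<in>B. exp (- \<i> * of_real t * ?e E) *
        (poly (bloch (cis u) (N * int p + int k)) (?e E) / poly (pderiv discr) (?e E)))"
      using inj by (simp add: sum.reindex)
    also have "\<dots> = (\<Sum>E\<in>B. cis (of_int N * u) * exp (- \<i> * of_real t * ?e E) * A (E, k) (of_real u))"
    proof (intro sum.cong refl)
      fix E assume E: "E \<in> B"
      have "(poly (rsol k) (?e E) + exp (\<i> * of_real u) * poly (lsol k) (?e E)) / poly (pderiv discr) (?e E)
          = A (E, k) (of_real u)"
        using bspec[OF conjunct1[OF near], of "(E, k)"] E k by simp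
      then have a: "(poly (rsol k) (?e E) + cis u * poly (lsol k) (?e E)) / poly (pderiv discr) (?e E)
          = A (E, k) (of_real u)"
        by (simp only: cis_conv_exp)
      have "poly (bloch (cis u) (N * int p + int k)) (?e E)
          = cis (of_int N * u) * (poly (rsol k) (?e E) + cis u * poly (lsol k) (?e E))"
        using bloch_eq[of k "cis u" N] k by (simp add: cis_power_int)
      then show "exp (- \<i> * of_real t * ?e E) *
          (poly (bloch (cis u) (N * int p + int k)) (?e E) / poly (pderiv discr) (?e E))
        = cis (of_int N * u) * exp (- \<i> * of_real t * ?e E) * A (E, k) (of_real u)"
        unfolding a[symmetric] by simp
    qed
    finally show ?thesis .
  qed
  define \<delta>0 where "\<delta>0 = Min (insert (d / 2) (\<delta> ` ?I))"
  have \<delta>0: "\<delta>0 > 0" "\<delta>0 \<le> d / 2" "\<And>i. i \<in> ?I \<Longrightarrow> \<delta>0 \<le> \<delta> i"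
  proof -
    have fin: "finite (insert (d / 2) (\<delta> ` ?I))" using finI by simp
    have "\<delta> i > 0" if "i \<in> ?I" for i using good[OF that] unfolding good_def by (rule conjunct1)
    then show "\<delta>0 > 0" unfolding \<delta>0_def using fin d by (subst Min_gr_iff) auto
    show "\<delta>0 \<le> d / 2" unfolding \<delta>0_def by (rule Min_le[OF fin]) simp
    show "\<delta>0 \<le> \<delta> i" if "i \<in> ?I" for i
      unfolding \<delta>0_def by (rule Min_le[OF fin]) (use that in blast)
  qed
  define M where "M = (\<Sum>i\<in>?I. \<bar>C i\<bar>)"
  show ?thesis
  proof (rule exI[of _ \<delta>0], intro conjI exI[of _ M] allI impI)
    fix \<alpha> \<beta> t :: real and n :: int
    assume ab: "\<theta> - \<delta>0 \<le> \<alpha>" "\<alpha> \<le> \<beta>" "\<beta> \<le> \<theta> + \<delta>0" and t: "\<bar>t\<bar> \<ge> 1"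
    obtain N k where n: "n = N * int p + int k" "k < p" by (rule int_decompose)
    define g where "g = (\<lambda>E u. cis (of_int N * u) * exp (- \<i> * of_real t * E (of_real u)) * A (E, k) (of_real u))"
    have g: "cmod (integral {\<alpha>..\<beta>} (g E)) \<le> C (E, k) * \<bar>t\<bar> powr (-1/3)" "g E integrable_on {\<alpha>..\<beta>}" if "E \<in> B" for E
    proof -
      have i: "(E, k) \<in> ?I" using that n by simp
      note gd = good[OF i, unfolded good_def fst_conv, THEN conjunct2, THEN conjunct2]
      have near: "\<theta> - \<delta> (E, k) \<le> \<alpha>" "\<beta> \<le> \<theta> + \<delta> (E, k)" using \<delta>0(3)[OF i] ab by auto
      show "cmod (integral {\<alpha>..\<beta>} (g E)) \<le> C (E, k) * \<bar>t\<bar> powr (-1/3)"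
        unfolding g_def by (rule gd[THEN conjunct1, rule_format, OF near(1) ab(2) near(2) t])
      show "g E integrable_on {\<alpha>..\<beta>}"
        unfolding g_def by (rule gd[THEN conjunct2, rule_format, OF near])
    qed
    \<comment> \<open>The centre, where eigenvalues may coincide, is a null set.\<close>
    have "integral {\<alpha>..\<beta>} (fibre_prop t n) = integral {\<alpha>..\<beta>} (\<lambda>u. \<Sum>E\<in>B. g E u)"
    proof (rule integral_spike[of "{\<theta>}"])
      show "negligible {\<theta>}" by simp
      fix u assume "u \<in> {\<alpha>..\<beta>} - {\<theta>}"
      then have "u \<noteq> \<theta>" "\<bar>u - \<theta>\<bar> < d" using ab \<delta>0 d by auto
      then show "(\<Sum>E\<in>B. g E u) = fibre_prop t n u"
        unfolding g_def n(1) using fibre n(2) by simp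
    qed
    also have "\<dots> = (\<Sum>E\<in>B. integral {\<alpha>..\<beta>} (g E))"
      by (rule integral_sum[OF B(1) g(2)])
    also have "cmod \<dots> \<le> (\<Sum>E\<in>B. \<bar>C (E, k)\<bar> * \<bar>t\<bar> powr (-1/3))"
    proof (rule sum_norm_le)
      fix E assume "E \<in> B"
      then have "cmod (integral {\<alpha>..\<beta>} (g E)) \<le> C (E, k) * \<bar>t\<bar> powr (-1/3)" by (rule g(1))
      also have "\<dots> \<le> \<bar>C (E, k)\<bar> * \<bar>t\<bar> powr (-1/3)" by (intro mult_right_mono) auto
      finally show "cmod (integral {\<alpha>..\<beta>} (g E)) \<le> \<bar>C (E, k)\<bar> * \<bar>t\<bar> powr (-1/3)" .
    qed
    also have "\<dots> = (\<Sum>E\<in>B. \<bar>C (E, k)\<bar>) * \<bar>t\<bar> powr (-1/3)" by (rule sum_distrib_right[symmetric])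
    also have "\<dots> \<le> M * \<bar>t\<bar> powr (-1/3)"
    proof (rule mult_right_mono)
      have "(\<Sum>E\<in>B. \<bar>C (E, k)\<bar>) = (\<Sum>i\<in>(\<lambda>E. (E, k)) ` B. \<bar>C i\<bar>)"
        by (subst sum.reindex) (auto simp: inj_on_def)
      also have "\<dots> \<le> M"
        unfolding M_def by (rule sum_mono2[OF finI]) (use n in auto)
      finally show "(\<Sum>E\<in>B. \<bar>C (E, k)\<bar>) \<le> M" .
    qed auto
    finally show "cmod (integral {\<alpha>..\<beta>} (fibre_prop t n)) \<le> M * \<bar>t\<bar> powr (-1/3)" .
  qed (use \<delta>0 in auto)
qed

text \<open>Compactness in the form of bisection: the property passes to unions of adjacent
  intervals, with constants adding up, and holds for small intervals around every point.\<close>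

lemma fibre_prop_integral_bound:
  "\<exists>C. \<forall>t n. \<bar>t\<bar> \<ge> 1 \<longrightarrow> cmod (integral {0..2 * pi} (fibre_prop t n)) \<le> C * \<bar>t\<bar> powr (-1/3)"
proof (rule Bolzano[of 0 "2 * pi" "\<lambda>\<alpha> \<beta>. \<exists>C. \<forall>t n. \<bar>t\<bar> \<ge> 1 \<longrightarrow>
    cmod (integral {\<alpha>..\<beta>} (fibre_prop t n)) \<le> C * \<bar>t\<bar> powr (-1/3)"])
  fix a b c :: real
  assume P1: "\<exists>C. \<forall>t n. \<bar>t\<bar> \<ge> 1 \<longrightarrow> cmod (integral {a..b} (fibre_prop t n)) \<le> C * \<bar>t\<bar> powr (-1/3)"
    and P2: "\<exists>C. \<forall>t n. \<bar>t\<bar> \<ge> 1 \<longrightarrow> cmod (integral {b..c} (fibre_prop t n)) \<le> C * \<bar>t\<bar> powr (-1/3)"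
    and ord: "a \<le> b" "b \<le> c"
  obtain C1 where C1: "\<And>t n. \<bar>t\<bar> \<ge> 1 \<Longrightarrow> cmod (integral {a..b} (fibre_prop t n)) \<le> C1 * \<bar>t\<bar> powr (-1/3)"
    using P1 by blast
  obtain C2 where C2: "\<And>t n. \<bar>t\<bar> \<ge> 1 \<Longrightarrow> cmod (integral {b..c} (fibre_prop t n)) \<le> C2 * \<bar>t\<bar> powr (-1/3)"
    using P2 by blast
  have "cmod (integral {a..c} (fibre_prop t n)) \<le> (C1 + C2) * \<bar>t\<bar> powr (-1/3)" if t: "\<bar>t\<bar> \<ge> 1" for t n
  proof -
    have "integral {a..c} (fibre_prop t n) = integral {a..b} (fibre_prop t n) + integral {b..c} (fibre_prop t n)"
      by (rule Henstock_Kurzweil_Integration.integral_combine[symmetric, OF ord])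
        (intro integrable_continuous_interval continuous_on_fibre_prop)
    then have "cmod (integral {a..c} (fibre_prop t n))
        \<le> cmod (integral {a..b} (fibre_prop t n)) + cmod (integral {b..c} (fibre_prop t n))"
      by (simp only: norm_triangle_ineq)
    also have "\<dots> \<le> C1 * \<bar>t\<bar> powr (-1/3) + C2 * \<bar>t\<bar> powr (-1/3)"
      by (intro add_mono C1 C2 t)
    finally show ?thesis by (simp only: distrib_right)
  qed
  then show "\<exists>C. \<forall>t n. \<bar>t\<bar> \<ge> 1 \<longrightarrow> cmod (integral {a..c} (fibre_prop t n)) \<le> C * \<bar>t\<bar> powr (-1/3)" by blast
next
  fix \<theta> :: real
  obtain \<delta> C where \<delta>: "\<delta> > 0" "\<And>\<alpha> \<beta> t n. \<theta> - \<delta> \<le> \<alpha> \<Longrightarrow> \<alpha> \<le> \<beta> \<Longrightarrow> \<beta> \<le> \<theta> + \<delta> \<Longrightarrow> \<bar>t\<bar> \<ge> 1 \<Longrightarrow>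
    cmod (integral {\<alpha>..\<beta>} (fibre_prop t n)) \<le> C * \<bar>t\<bar> powr (-1/3)"
    using fibre_prop_local_bound[of \<theta>] by blast
  have "\<exists>C. \<forall>t n. \<bar>t\<bar> \<ge> 1 \<longrightarrow> cmod (integral {a..b} (fibre_prop t n)) \<le> C * \<bar>t\<bar> powr (-1/3)"
    if "a \<le> \<theta>" "\<theta> \<le> b" "b - a < \<delta>" for a b
    using \<delta>(2)[of a b] that by (intro exI[of _ C]) auto
  then show "\<exists>d>0. \<forall>a b. a \<le> \<theta> \<and> \<theta> \<le> b \<and> b - a < d \<longrightarrow>
      (\<exists>C. \<forall>t n. \<bar>t\<bar> \<ge> 1 \<longrightarrow> cmod (integral {a..b} (fibre_prop t n)) \<le> C * \<bar>t\<bar> powr (-1/3))"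
    using \<delta>(1) by blast
qed simp

lemma prop_kernel_dispersive:
  "\<exists>M. \<forall>t n. cmod (prop_kernel V t n) \<le> M * japanese_bracket t powr (-1/3)"
proof -
  obtain C where C: "\<And>t n. \<bar>t\<bar> \<ge> 1 \<Longrightarrow> cmod (integral {0..2 * pi} (fibre_prop t n)) \<le> C * \<bar>t\<bar> powr (-1/3)"
    using fibre_prop_integral_bound by blast
  obtain b where b: "\<And>n. \<bar>V n\<bar> \<le> b" by (rule V_bounded) blast
  have b0: "b \<ge> 0" using b[of 0] by linarith
  have jb: "japanese_bracket t > 0" for t
    by (simp add: japanese_bracket_def add_pos_nonneg)
  have 2: "(2::real) powr (-1/3) > 0" by simp
  \<comment> \<open>\<open>japanese_bracket t\<close> is at most \<open>2 * \<bar>t\<bar>\<close>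
    for \<open>\<bar>t\<bar> \<ge> 1\<close> and at most 2 otherwise; the divisor pays for this
    factor 2 in both cases.\<close>
  define M where "M = (\<bar>C\<bar> + exp (2 + b)) / 2 powr (-1/3)"
  have "cmod (prop_kernel V t n) \<le> M * japanese_bracket t powr (-1/3)" for t n
  proof (cases "\<bar>t\<bar> \<ge> 1")
    case True
    have "2 * pi * cmod (prop_kernel V t n) = cmod (2 * of_real pi * prop_kernel V t n)"
      by (simp add: norm_mult)
    also have "\<dots> \<le> C * \<bar>t\<bar> powr (-1/3)" unfolding prop_kernel_fibre by (rule C[OF True])
    also have "\<dots> \<le> \<bar>C\<bar> * \<bar>t\<bar> powr (-1/3)" by (intro mult_right_mono) auto
    finally have 1: "2 * pi * cmod (prop_kernel V t n) \<le> \<bar>C\<bar> * \<bar>t\<bar> powr (-1/3)" .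
    have "1 * cmod (prop_kernel V t n) \<le> 2 * pi * cmod (prop_kernel V t n)"
      using pi_gt3 by (intro mult_right_mono) auto
    with 1 have k: "cmod (prop_kernel V t n) \<le> \<bar>C\<bar> * \<bar>t\<bar> powr (-1/3)" by simp
    have "japanese_bracket t \<le> 2 * \<bar>t\<bar>"
    proof -
      have "1 \<le> t\<^sup>2" using one_le_power[OF True, of 2] by simp
      then have "1 + t\<^sup>2 \<le> (2 * \<bar>t\<bar>)\<^sup>2" by (simp add: power_mult_distrib)
      then show ?thesis unfolding japanese_bracket_def by (intro real_le_lsqrt) auto
    qed
    then have "(2 * \<bar>t\<bar>) powr (-1/3) \<le> japanese_bracket t powr (-1/3)"
      by (intro powr_mono2') (use jb in auto)
    then have "2 powr (-1/3) * \<bar>t\<bar> powr (-1/3) \<le> japanese_bracket t powr (-1/3)"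
      by (simp add: powr_mult)
    then have "\<bar>t\<bar> powr (-1/3) \<le> japanese_bracket t powr (-1/3) / 2 powr (-1/3)"
      using 2 by (simp only: pos_le_divide_eq mult.commute)
    then have "\<bar>C\<bar> * \<bar>t\<bar> powr (-1/3) \<le> \<bar>C\<bar> * (japanese_bracket t powr (-1/3) / 2 powr (-1/3))"
      by (intro mult_left_mono) auto
    also have "\<dots> \<le> (\<bar>C\<bar> + exp (2 + b)) * (japanese_bracket t powr (-1/3) / 2 powr (-1/3))"
      by (intro mult_right_mono) auto
    also have "\<dots> = M * japanese_bracket t powr (-1/3)" by (simp add: M_def)
    finally show ?thesis using k by linarith
  next
    case False
    have "cmod (prop_kernel V t n) \<le> exp (\<bar>t\<bar> * (2 + b))" by (rule prop_kernel_bound[OF b])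
    also have "\<dots> \<le> exp (2 + b)" using False b0 mult_right_mono[of "\<bar>t\<bar>" 1 "2 + b"] by simp
    finally have k: "cmod (prop_kernel V t n) \<le> exp (2 + b)" .
    have "t\<^sup>2 \<le> 1" using False by (simp add: abs_square_le_1)
    then have "japanese_bracket t \<le> 2" unfolding japanese_bracket_def by (intro real_le_lsqrt) auto
    then have "2 powr (-1/3) \<le> japanese_bracket t powr (-1/3)"
      by (intro powr_mono2') (use jb in auto)
    then have "1 \<le> japanese_bracket t powr (-1/3) / 2 powr (-1/3)"
      using 2 by (simp only: pos_le_divide_eq mult_1)
    then have "exp (2 + b) * 1 \<le> (\<bar>C\<bar> + exp (2 + b)) * (japanese_bracket t powr (-1/3) / 2 powr (-1/3))"
      by (intro mult_mono) auto
    also have "\<dots> = M * japanese_bracket t powr (-1/3)" by (simp add: M_def)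
    finally show ?thesis using k by simp
  qed
  then show ?thesis by blast
qed

end

theorem theorem1p1:
  fixes V :: "int \<Rightarrow> real"
  assumes "periodic_potential V"
  shows "\<exists>M>0. \<forall>t::real. \<forall>\<psi>\<in>ell1.
    sup_norm (ell2_seq (blinfun_apply (schroedinger_group V t) (Abs_ell2 \<psi>)))
      \<le> M * japanese_bracket t powr (-1/3) * ell1_norm \<psi>"
proof -
  obtain q :: int where q: "q \<ge> 1" "\<And>n. V (n + q) = V n"
    using assms by (auto simp: periodic_potential_def)
  define p where "p = nat (2 * q)"
  have ip: "int p = q + q" and p2: "p \<ge> 2" using q(1) by (auto simp: p_def)
  have per: "V (n + int p) = V n" for n
    using q(2)[of n] q(2)[of "n + q"] by (simp add: ip add.assoc)
  interpret base: periodic_chain V p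
    by standard (use p2 per in auto)
  \<comment> \<open>A source at \<open>m\<close> leads to the translate of \<open>V\<close> by
    \<open>m\<close>, again a periodic chain with the same \<open>p\<close>.\<close>
  have chain: "periodic_chain (\<lambda>j. V (j + m)) p" for m
  proof
    show "V (n + int p + m) = V (n + m)" for n
      using per[of "n + m"] by (simp add: algebra_simps)
  qed (rule p2)
  have "\<forall>m. \<exists>M. \<forall>t n. cmod (prop_kernel (\<lambda>j. V (j + m)) t n) \<le> M * japanese_bracket t powr (-1/3)"
    using periodic_chain.prop_kernel_dispersive[OF chain] by blast
  then obtain M where M: "\<And>m t n. cmod (prop_kernel (\<lambda>j. V (j + m)) t n) \<le> M m * japanese_bracket t powr (-1/3)"
    by metis
  \<comment> \<open>Translates depend on \<open>m\<close> modulo \<open>p\<close> only, so finitely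
    many constants occur; the summand 1 ensures positivity.\<close>
  define M0 where "M0 = (\<Sum>m\<in>{0..<int p}. \<bar>M m\<bar>) + 1"
  have M0: "M0 > 0" unfolding M0_def by (intro add_nonneg_pos sum_nonneg) auto
  have kernel: "cmod (prop_kernel (\<lambda>j. V (j + m)) t n) \<le> M0 * japanese_bracket t powr (-1/3)" for m t n
  proof -
    have "V (j + m) = V (j + m mod int p)" for j
      using base.per_mult[of "j + m mod int p" "m div int p"] by (simp add: add.assoc)
    then have "cmod (prop_kernel (\<lambda>j. V (j + m)) t n) \<le> M (m mod int p) * japanese_bracket t powr (-1/3)"
      using M by simp
    also have "\<dots> \<le> M0 * japanese_bracket t powr (-1/3)"
    proof (rule mult_right_mono)
      have "M (m mod int p) \<le> \<bar>M (m mod int p)\<bar>" by simp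
      also have "\<dots> \<le> (\<Sum>m\<in>{0..<int p}. \<bar>M m\<bar>)"
        by (rule member_le_sum) (use p2 in auto)
      finally show "M (m mod int p) \<le> M0" by (simp add: M0_def)
    qed auto
    finally show ?thesis .
  qed
  obtain C where C: "\<And>n. \<bar>V n\<bar> \<le> C" by (rule periodic_potential_bounded[OF assms]) blast
  show ?thesis
    using M0 sup_norm_schroedinger_group_le[OF C kernel] by blast
qed

end
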